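(* Let $s>3$. Assume that $u_0\in H^s(S^1)$ has non-zero mean and satisfies $\Lambda_\mu^2u_0\ge0$ on $S^1$ (or $\Lambda_\mu^2u_0\le 0$ on $S^1$). Then the Cauchy problem $$u_t+uu_x+3\mu(u)\,\partial_x\Lambda_\mu^{-2}u=0,\qquad u(0)=u_0,$$ has a unique global solution $u\in C(\mathbb{R},H^s(S^1))\cap C^1(\mathbb{R},H^{s-1}(S^1))$.
   Context: $S^1=\mathbb{R}/\mathbb{Z}\simeq[0,1)$, $\mu(v)=\int_0^1v\,dx$, $H^s(S^1)$ is the periodic Sobolev space, and $\Lambda_\mu^2v=\mu(v)-v_{xx}$, an invertible operator $H^s\to H^{s-2}$ with inverse $\Lambda_\mu^{-2}$. The equation is the $\mu$DP equation $\mu(u_t)-u_{txx}+3\mu(u)u_x-3u_xu_{xx}-uu_{xxx}=0$. *)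

theory Defs
  imports "HOL-Analysis.Analysis"
begin

text \<open>Functions on the circle S^1 = R/Z are represented as 1-periodic functions real => real.
  Elements of H^s(S^1) (only used for s > 2, where H^s embeds into C^1) are represented by
  their continuous representatives.\<close>

definition per1 :: "(real \<Rightarrow> real) \<Rightarrow> bool" where
  "per1 f \<longleftrightarrow> (\<forall>x. f (x + 1) = f x)"

definition mu :: "(real \<Rightarrow> real) \<Rightarrow> real" where
  "mu v = integral {0..1} v"

definition fcoeff :: "(real \<Rightarrow> real) \<Rightarrow> int \<Rightarrow> complex" where
  "fcoeff f k = integral {0..1} (\<lambda>x. complex_of_real (f x) * cis (- 2 * pi * real_of_int k * x))"

definition sob_weight :: "real \<Rightarrow> int \<Rightarrow> real" where
  "sob_weight s k = (1 + (2 * pi * real_of_int k)\<^sup>2) powr s"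

definition Hs :: "real \<Rightarrow> (real \<Rightarrow> real) set" where
  "Hs s = {f. per1 f \<and> continuous_on UNIV f \<and>
              (\<lambda>k. sob_weight s k * (cmod (fcoeff f k))\<^sup>2) summable_on (UNIV :: int set)}"

definition hs_norm :: "real \<Rightarrow> (real \<Rightarrow> real) \<Rightarrow> real" where
  "hs_norm s f = sqrt (infsum (\<lambda>k. sob_weight s k * (cmod (fcoeff f k))\<^sup>2) (UNIV :: int set))"

definition Lam2 :: "(real \<Rightarrow> real) \<Rightarrow> real \<Rightarrow> real" where
  "Lam2 v = (\<lambda>x. mu v - deriv (deriv v) x)"

definition Lam_inv :: "(real \<Rightarrow> real) \<Rightarrow> real \<Rightarrow> real" where
  "Lam_inv f = (THE w. per1 w \<and> (\<forall>x. (w has_real_derivative deriv w x) (at x)) \<and>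
                       (\<forall>x. (deriv w has_real_derivative (mu w - f x)) (at x)))"

definition muDP_global_solution :: "real \<Rightarrow> (real \<Rightarrow> real) \<Rightarrow> (real \<Rightarrow> real \<Rightarrow> real) \<Rightarrow> bool" where
  "muDP_global_solution s u0 u \<longleftrightarrow>
     u 0 = u0 \<and>
     (\<forall>t. u t \<in> Hs s) \<and>
     (\<forall>t. ((\<lambda>\<tau>. hs_norm s (\<lambda>x. u \<tau> x - u t x)) \<longlongrightarrow> 0) (at t)) \<and>
     (\<exists>ut. (\<forall>t. ut t \<in> Hs (s - 1)) \<and>
           (\<forall>t. ((\<lambda>\<tau>. hs_norm (s - 1) (\<lambda>x. ut \<tau> x - ut t x)) \<longlongrightarrow> 0) (at t)) \<and>
           (\<forall>t. ((\<lambda>h. hs_norm (s - 1) (\<lambda>x. (u (t + h) x - u t x) / h - ut t x)) \<longlongrightarrow> 0) (at 0)) \<and>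
           (\<forall>t x. ut t x + u t x * deriv (u t) x + 3 * mu (u t) * deriv (Lam_inv (u t)) x = 0))"

end

theory Submission
  imports Defs
begin

text \<open>
  The momentum \<open>m = \<Lambda>\<^sup>2 u\<close> satisfies \<open>m\<^sub>t + u m\<^sub>x + 3 u\<^sub>x m = 0\<close>, so \<open>(m \<circ> \<phi>) \<phi>\<^sub>x\<^sup>3\<close> is conserved along the
  flow \<open>\<phi>\<close> of \<open>u\<close>. For \<open>r = ln \<phi>\<^sub>x\<close> the equation becomes an ordinary differential equation
  \<open>r\<^sub>t = W r\<close> for continuous functions on the circle, with \<open>W r = u\<^sub>x \<circ> \<phi>\<close>. If the initial momentum
  has one sign, \<open>W\<close> can be expressed by probability densities; it is then bounded and globally Lipschitz,
  and a solution with bounded \<open>u\<^sub>x\<^sub>x\<close> exists for all times.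

  The \<open>H\<^sup>s\<close> regularity is propagated on the side of the Fourier coefficients \<open>a\<^sub>k\<close>: symmetrising
  the cubic form \<open>\<Sum> k w\<^sub>k cnj a\<^sub>k (a * a)\<^sub>k\<close> in its three frequencies yields an energy estimate for
  the clipped weights \<open>w\<^sub>k = min ((1 + (2 \<pi> k)\<^sup>2)\<^sup>s) N\<close> that is uniform in \<open>N\<close>. It holds in both time
  directions and therefore also bounds the norm at time \<open>\<tau>\<close> by almost the norm at a nearby time \<open>t\<close>;
  together with the continuity of each \<open>a\<^sub>k\<close> this gives strong continuity in \<open>H\<^sup>s\<close>. Uniqueness is the
  analogous estimate in \<open>L\<^sup>2\<close> for the difference of two solutions.
\<close>

section \<open>Fourier series\<close>

text \<open>The flow construction yields only u_xx bounded on bounded time intervals, so at later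
  times the H^s energy might be infinite and cannot be differentiated directly. Clipped weights keep
  every energy finite; the estimate may then use the solution only through the sum of |k| |a_k|,
  which a bound on u_xx controls. The nonlocal term multiplies a_k by i times a real number, so it
  is skew and leaves every energy unchanged; only the transport term has to be symmetrised.

  In Lagrangian coordinates the conservation law makes the spatial derivative of u_x o phi equal to
  mean * (phi_x - h phi_x^(-2)), where h is the initial momentum divided by its mean. A nonzero mean
  permits this division, and the sign condition makes h a probability density. The primitive of a
  difference of two probability densities is bounded by 1, however large the densities are; this
  replaces an a priori bound on u_x. Perturbing r by a small e changes each density by a relative
  error of order e, hence the primitive by order e in the sup norm, independently of the size of r:
  this is the source of the global Lipschitz bound.\<close>

definition ek :: "int \<Rightarrow> real \<Rightarrow> complex" where
  "ek k x = cis (2 * pi * real_of_int k * x)"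

text \<open>\<open>fcoeff\<close> accepts real functions only, while the series \<open>fsum\<close>
  below are complex-valued.\<close>

definition cfc :: "(real \<Rightarrow> complex) \<Rightarrow> int \<Rightarrow> complex" where
  "cfc g k = integral {0..1} (\<lambda>x. g x * ek (-k) x)"

lemma fcoeff_eq_cfc: "fcoeff f k = cfc (\<lambda>x. complex_of_real (f x)) k"
  by (simp add: fcoeff_def cfc_def ek_def)

lemma ek_0 [simp]: "ek 0 x = 1"
  by (simp add: ek_def)

lemma ek_at_0 [simp]: "ek k 0 = 1"
  by (simp add: ek_def)

lemma ek_add: "ek (j + k) x = ek j x * ek k x"
  by (simp add: ek_def cis_mult algebra_simps)

lemma cnj_ek: "cnj (ek k x) = ek (-k) x"
  by (simp add: ek_def cis_cnj)

lemma norm_ek [simp]: "cmod (ek k x) = 1"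
  by (simp add: ek_def)

lemma ek_per: "ek k (x + 1) = ek k x"
proof -
  have "ek k (x + 1) = ek k x * cis (2 * pi * real_of_int k)"
    by (simp add: ek_def cis_mult algebra_simps)
  also have "cis (2 * pi * real_of_int k) = 1"
    by (rule cis_multiple_2pi) simp
  finally show ?thesis by simp
qed

lemma ek_at_1 [simp]: "ek k 1 = 1"
  using ek_per[of k 0] by simp

text \<open>The Fourier symbol of the derivative.\<close>

definition dsym :: "int \<Rightarrow> complex" where
  "dsym k = 2 * complex_of_real pi * \<i> * of_int k"

lemma dsym_0 [simp]: "dsym 0 = 0"
  by (simp add: dsym_def)

lemma dsym_eq_0_iff [simp]: "dsym k = 0 \<longleftrightarrow> k = 0"
  by (simp add: dsym_def)

lemma dsym_minus: "dsym (- k) = - dsym k"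
  by (simp add: dsym_def)

lemma norm_dsym: "cmod (dsym k) = 2 * pi * \<bar>real_of_int k\<bar>"
  by (simp add: dsym_def norm_mult)

lemma ek_has_vderiv:
  "(ek k has_vector_derivative (dsym k * ek k x)) (at x within S)"
  unfolding ek_def dsym_def has_vector_derivative_complex_iff
  by (auto intro!: derivative_eq_intros simp: field_simps)

lemma continuous_on_ek [continuous_intros]:
  "continuous_on S f \<Longrightarrow> continuous_on S (\<lambda>x. ek k (f x))"
  unfolding ek_def cis_conv_exp by (intro continuous_intros)

lemma integral_ek: "integral {0..1} (ek k) = (if k = 0 then 1 else 0)"
proof (cases "k = 0")
  case True
  then have "ek k = (\<lambda>x. 1)" by (auto simp: fun_eq_iff)
  then show ?thesis using True by simp
next
  case False
  have "((\<lambda>x. dsym k * ek k x) has_integral (ek k 1 - ek k 0)) {0..1}"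
    by (rule fundamental_theorem_of_calculus) (auto intro: ek_has_vderiv)
  then have "((\<lambda>x. inverse (dsym k) * (dsym k * ek k x)) has_integral
      inverse (dsym k) * (ek k 1 - ek k 0)) {0..1}"
    by (rule has_integral_mult_right)
  moreover have "inverse (dsym k) * (dsym k * ek k x) = ek k x" for x
    using False by simp
  ultimately have "(ek k has_integral 0) {0..1}" by simp
  then show ?thesis using False by (simp add: integral_unique)
qed

section \<open>Trigonometric polynomials, their density, and uniqueness of Fourier
  coefficients\<close>

inductive trig_poly :: "(real \<Rightarrow> complex) \<Rightarrow> bool" where
  mono: "trig_poly (\<lambda>x. c * ek k x)"
| add: "trig_poly f \<Longrightarrow> trig_poly g \<Longrightarrow> trig_poly (\<lambda>x. f x + g x)"

lemma trig_poly_mult_mono: "trig_poly f \<Longrightarrow> trig_poly (\<lambda>x. c * ek k x * f x)"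
proof (induction rule: trig_poly.induct)
  case (mono d j)
  have "(\<lambda>x. c * ek k x * (d * ek j x)) = (\<lambda>x. (c * d) * ek (k + j) x)"
    by (simp add: ek_add algebra_simps)
  then show ?case by (simp only: trig_poly.mono)
next
  case (add f g)
  then show ?case using trig_poly.add[OF add.IH] by (simp add: algebra_simps)
qed

lemma trig_poly_mult: "trig_poly f \<Longrightarrow> trig_poly g \<Longrightarrow> trig_poly (\<lambda>x. f x * g x)"
proof (induction rule: trig_poly.induct)
  case (mono c k)
  then show ?case by (rule trig_poly_mult_mono)
next
  case (add f1 f2)
  then show ?case using trig_poly.add[OF add.IH(1)[OF add.prems] add.IH(2)[OF add.prems]]
    by (simp add: algebra_simps)
qed

text \<open>On the unit circle a real-linear functional is a combination of cos and sin, hence of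
  \<open>ek 1\<close> and \<open>ek (-1)\<close>; the class is closed under sums and
  products.\<close>

lemma trig_poly_of_real_polynomial_function:
  fixes p :: "complex \<Rightarrow> real"
  assumes "real_polynomial_function p"
  shows "trig_poly (\<lambda>x. complex_of_real (p (cis (2 * pi * x))))"
  using assms
proof (induction rule: real_polynomial_function.induct)
  case (linear f)
  have f: "f (cis y) = cos y * f 1 + sin y * f \<i>" for y
  proof -
    have "cis y = cos y *\<^sub>R 1 + sin y *\<^sub>R \<i>" by (simp add: complex_eq_iff)
    then have "f (cis y) = f (cos y *\<^sub>R 1 + sin y *\<^sub>R \<i>)" by simp
    also have "\<dots> = cos y * f 1 + sin y * f \<i>"
      using linear by (simp add: bounded_linear.linear linear_add linear_cmul)
    finally show ?thesis .
  qed
  have "(\<lambda>x. complex_of_real (f (cis (2 * pi * x)))) =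
     (\<lambda>x. ((f 1 - \<i> * f \<i>) / 2) * ek 1 x + ((f 1 + \<i> * f \<i>) / 2) * ek (-1) x)"
    by (rule ext, simp only: f) (auto simp: ek_def complex_eq_iff field_simps)
  then show ?case by (simp only: trig_poly.intros)
next
  case (const c)
  show ?case using trig_poly.mono[of c 0] by simp
next
  case (add f g)
  then show ?case using trig_poly.add by simp
next
  case (mult f g)
  then show ?case using trig_poly_mult by simp
qed

text \<open>\<open>Arg2pi\<close> jumps across the positive real axis, and \<open>f 0 = f 1\<close>
  closes that gap. The constant homotopy of the loop \<open>f\<close> with itself is used only to
  obtain the associated continuous map on the circle.\<close>

lemma continuous_on_circle_lift:
  fixes f :: "real \<Rightarrow> 'a::real_normed_vector"
  assumes "continuous_on {0..1} f" "f 0 = f 1"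
  shows "continuous_on (sphere 0 1) (\<lambda>z::complex. f (Arg2pi z / (2 * pi)))"
proof -
  have "path f" "pathfinish f = pathstart f"
    using assms by (auto simp: path_def pathfinish_def pathstart_def)
  then have "homotopic_loops UNIV f f" by (simp add: homotopic_loops_refl)
  then show ?thesis
    using homotopic_loops_imp_homotopic_circlemaps homotopic_with_imp_continuous
    by (fastforce simp: o_def)
qed

lemma Arg2pi_cis_frac: "Arg2pi (cis (2 * pi * x)) / (2 * pi) = frac x"
proof -
  have "cis (2 * pi * x) = cis (2 * pi * frac x)"
  proof -
    have "2 * pi * x = 2 * pi * frac x + 2 * pi * of_int \<lfloor>x\<rfloor>"
      by (simp add: frac_def algebra_simps)
    then have "cis (2 * pi * x) = cis (2 * pi * frac x) * cis (2 * pi * of_int \<lfloor>x\<rfloor>)"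
      by (simp only: cis_mult)
    also have "cis (2 * pi * of_int \<lfloor>x\<rfloor>) = 1" by (rule cis_multiple_2pi) simp
    finally show ?thesis by simp
  qed
  moreover have "Arg2pi (cis (2 * pi * frac x)) = 2 * pi * frac x"
    by (rule Arg2pi_unique[of 1]) (auto simp: cis_conv_exp frac_lt_1 algebra_simps)
  ultimately show ?thesis by simp
qed

lemma continuous_on_frac_extension:
  fixes f :: "real \<Rightarrow> 'a::real_normed_vector"
  assumes "continuous_on {0..1} f" "f 0 = f 1"
  shows "continuous_on UNIV (\<lambda>x. f (frac x))"
proof -
  have "continuous_on UNIV (\<lambda>x::real. f (Arg2pi (cis (2 * pi * x)) / (2 * pi)))"
    by (rule continuous_on_compose2[OF continuous_on_circle_lift[OF assms]])
       (auto simp: cis_conv_exp intro!: continuous_intros)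
  then show ?thesis by (simp only: Arg2pi_cis_frac)
qed

text \<open>Stone-Weierstrass is applied to the lift of \<open>f\<close> to the unit circle, where
  polynomials in the real and imaginary parts are trigonometric polynomials of the angle.\<close>

lemma trig_approx:
  fixes f :: "real \<Rightarrow> real"
  assumes "continuous_on {0..1} f" "f 0 = f 1" "e > 0"
  obtains q where "trig_poly (\<lambda>x. complex_of_real (q x))" "\<And>x. x \<in> {0..1} \<Longrightarrow> \<bar>f x - q x\<bar> < e"
    "continuous_on UNIV q"
proof -
  obtain p where p: "real_polynomial_function p"
      "\<And>z. z \<in> sphere (0::complex) 1 \<Longrightarrow> \<bar>f (Arg2pi z / (2 * pi)) - p z\<bar> < e"
    using Stone_Weierstrass_real_polynomial_function[OF compact_sphere
        continuous_on_circle_lift[OF assms(1,2)] assms(3)] by metis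
  show ?thesis
  proof
    show "trig_poly (\<lambda>x. complex_of_real (p (cis (2 * pi * x))))"
      by (rule trig_poly_of_real_polynomial_function[OF p(1)])
    have "continuous_on UNIV p" using p(1)
      by (simp add: continuous_at_imp_continuous_on continuous_real_polymonial_function)
    then show "continuous_on UNIV (\<lambda>x. p (cis (2 * pi * x)))"
      unfolding cis_conv_exp
      by (rule continuous_on_compose2) (auto intro!: continuous_intros)
    fix x :: real assume x: "x \<in> {0..1}"
    have "\<bar>f (frac x) - p (cis (2 * pi * x))\<bar> < e"
      using p(2)[of "cis (2 * pi * x)"] by (simp add: Arg2pi_cis_frac)
    moreover have "f (frac x) = f x"
    proof (cases "x = 1")
      case True then show ?thesis using assms(2) by simp
    next
      case False
      then have "frac x = x" using x by (simp add: frac_eq)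
      then show ?thesis by simp
    qed
    ultimately show "\<bar>f x - p (cis (2 * pi * x))\<bar> < e" by simp
  qed
qed

lemma integral_trig_poly_zero:
  assumes g: "continuous_on {0..1} g" and z: "\<And>k. cfc g k = 0" and q: "trig_poly q"
  shows "integral {0..1} (\<lambda>x. g x * q x) = 0 \<and> continuous_on UNIV q"
  using q
proof (induction rule: trig_poly.induct)
  case (mono c k)
  have "integral {0..1} (\<lambda>x. g x * (c * ek k x)) = c * cfc g (-k)"
    unfolding cfc_def by (subst integral_mult_right[symmetric]) (simp add: algebra_simps)
  then show ?case using z by (auto intro!: continuous_intros)
next
  case (add f h)
  have "(\<lambda>x. g x * f x) integrable_on {0..1}" "(\<lambda>x. g x * h x) integrable_on {0..1}"
    using add.IH g by (auto intro!: integrable_continuous_real continuous_intros intro: continuous_on_subset)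
  then show ?case using add.IH
    by (auto simp: distrib_left integral_add intro!: continuous_intros)
qed

text \<open>For a real trigonometric polynomial \<open>q\<close> the integral of
  \<open>g * q\<close> vanishes, and so does its real part, the integral of \<open>f * q\<close>.
  Thus the integral of f^2 equals that of f (f - q), which is as small as the approximation. The
  imaginary part follows later from the same statement for -i g.\<close>

lemma fourier_unique_Re:
  assumes g: "continuous_on {0..1} g" "g 0 = g 1" and z: "\<And>k. cfc g k = 0" and x: "x \<in> {0..1}"
  shows "Re (g x) = 0"
proof -
  define f where "f = (\<lambda>x. Re (g x))"
  have f: "continuous_on {0..1} f" "f 0 = f 1" using g by (auto simp: f_def intro!: continuous_intros)
  obtain M where M: "\<And>x. x \<in> {0..1} \<Longrightarrow> \<bar>f x\<bar> \<le> M" "M > 0"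
  proof -
    have "bounded (f ` {0..1})"
      using f(1) compact_continuous_image compact_imp_bounded by blast
    then obtain b where "b > 0" "\<forall>y\<in>f ` {0..1}. norm y \<le> b" by (auto simp: bounded_pos)
    then show ?thesis using that[of b] by auto
  qed
  have le: "integral {0..1} (\<lambda>x. f x * f x) \<le> M * e" if e: "e > 0" for e
  proof -
    obtain q where q: "trig_poly (\<lambda>x. complex_of_real (q x))" "\<And>x. x \<in> {0..1} \<Longrightarrow> \<bar>f x - q x\<bar> < e"
       "continuous_on UNIV q"
      using trig_approx[OF f e] by metis
    have qc: "continuous_on {0..1} q" using q(3) continuous_on_subset by blast
    have int: "(\<lambda>x. g x * complex_of_real (q x)) integrable_on {0..1}"
      using g qc by (auto intro!: integrable_continuous_real continuous_intros)
    have "integral {0..1} (\<lambda>x. f x * q x) = integral {0..1} (\<lambda>x. Re (g x * complex_of_real (q x)))"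
      by (simp add: f_def)
    also have "\<dots> = Re (integral {0..1} (\<lambda>x. g x * complex_of_real (q x)))"
      using integral_linear[OF int bounded_linear_Re] by (simp add: o_def)
    also have "\<dots> = 0" using integral_trig_poly_zero[OF g(1) z q(1)] by simp
    finally have 0: "integral {0..1} (\<lambda>x. f x * q x) = 0" .
    have "integral {0..1} (\<lambda>x. f x * f x) = integral {0..1} (\<lambda>x. f x * (f x - q x)) + integral {0..1} (\<lambda>x. f x * q x)"
      by (subst integral_add[symmetric])
         (auto intro!: integrable_continuous_real continuous_intros f qc simp: algebra_simps)
    also have "integral {0..1} (\<lambda>x. f x * (f x - q x)) \<le> integral {0..1} (\<lambda>x::real. M * e)"
    proof (rule integral_le)
      fix x :: real assume x: "x \<in> {0..1}"
      have "f x * (f x - q x) \<le> \<bar>f x\<bar> * \<bar>f x - q x\<bar>" by (metis abs_ge_self abs_mult)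
      also have "\<dots> \<le> M * e" by (intro mult_mono) (use M q(2) x in \<open>auto intro: less_imp_le\<close>)
      finally show "f x * (f x - q x) \<le> M * e" .
    qed (auto intro!: integrable_continuous_real continuous_intros f qc)
    finally show ?thesis using 0 by simp
  qed
  have "integral {0..1} (\<lambda>x. f x * f x) \<le> 0"
  proof (rule field_le_epsilon)
    fix e :: real assume "e > 0"
    then show "integral {0..1} (\<lambda>x. f x * f x) \<le> 0 + e"
      using le[of "e / M"] M(2) by simp
  qed
  moreover have "integral {0..1} (\<lambda>x. f x * f x) \<ge> 0"
    by (intro integral_nonneg integrable_continuous_real continuous_intros f) simp
  ultimately have "integral {0..1} (\<lambda>x. f x * f x) = 0" by simp
  then have "((\<lambda>x. f x * f x) has_integral 0) (cbox 0 1)"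
    by (auto simp: has_integral_iff intro!: integrable_continuous_real continuous_intros f)
  then have "f x * f x = 0"
    by (rule has_integral_0_cbox_imp_0[rotated 2]) (use x in \<open>auto intro!: continuous_intros f\<close>)
  then show ?thesis by (simp add: f_def)
qed

lemma fourier_unique:
  assumes g: "continuous_on {0..1} g" "g 0 = g 1" and z: "\<And>k. cfc g k = 0" and x: "x \<in> {0..1}"
  shows "g x = 0"
proof -
  have "Re (g x) = 0" using fourier_unique_Re[OF assms] .
  moreover have "Re (- \<i> * g x) = 0"
  proof (rule fourier_unique_Re)
    fix k
    have "cfc (\<lambda>x. - \<i> * g x) k = - \<i> * cfc g k"
      unfolding cfc_def by (subst integral_mult_right[symmetric]) (simp add: algebra_simps)
    then show "cfc (\<lambda>x. - \<i> * g x) k = 0" using z by simp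
  qed (use g x in \<open>auto intro!: continuous_intros\<close>)
  ultimately show ?thesis by (simp add: complex_eq_iff)
qed

definition fsum :: "(int \<Rightarrow> complex) \<Rightarrow> real \<Rightarrow> complex" where
  "fsum c x = (\<Sum>\<^sub>\<infinity>k. c k * ek k x)"

subsection \<open>Absolutely convergent Fourier series\<close>

lemma has_sum_minus:
  fixes f g :: "'a \<Rightarrow> 'b::real_normed_vector"
  assumes "(f has_sum x) A" "(g has_sum y) A"
  shows "((\<lambda>k. f k - g k) has_sum (x - y)) A"
  using has_sum_add[of f A x "\<lambda>k. - g k" "- y"] assms by (simp add: has_sum_uminus)

lemma abs_summable_fsum:
  assumes "(\<lambda>k. norm (c k)) summable_on UNIV"
  shows "(\<lambda>k. norm (c k * ek k x)) summable_on UNIV"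
  using assms by (simp add: norm_mult)

lemma uniform_limit_fsum:
  assumes "(\<lambda>k. norm (c k)) summable_on UNIV"
  shows "uniform_limit S (\<lambda>F x. \<Sum>k\<in>F. c k * ek k x) (fsum c) (finite_subsets_at_top UNIV)"
  unfolding fsum_def
  by (rule Weierstrass_m_test_general[OF _ assms]) (simp add: norm_mult)

lemma continuous_on_fsum:
  assumes "(\<lambda>k. norm (c k)) summable_on UNIV"
  shows "continuous_on S (fsum c)"
  by (rule uniform_limit_theorem[OF _ uniform_limit_fsum[OF assms]])
     (auto intro!: continuous_intros always_eventually)

lemma fsum_per: "fsum c (x + 1) = fsum c x"
  by (simp add: fsum_def ek_per)

text \<open>Integration term by term against a free factor \<open>h\<close>. Taking \<open>h\<close>
  as an exponential recovers coefficients, as a function times an exponential it gives the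
  convolution formula, and \<open>h = 1\<close> gives differentiation of the series.\<close>

lemma has_sum_integral_fsum:
  assumes c: "(\<lambda>k. norm (c k)) summable_on UNIV" and h: "continuous_on {p..q} h"
  shows "((\<lambda>k. c k * integral {p..q} (\<lambda>x. ek k x * h x)) has_sum
           integral {p..q} (\<lambda>x. fsum c x * h x)) UNIV"
proof -
  have bd: "bounded (h ` {p..q})"
    using h compact_continuous_image compact_imp_bounded by blast
  have "uniform_limit {p..q} (\<lambda>F x. (\<Sum>k\<in>F. c k * ek k x) * h x) (\<lambda>x. fsum c x * h x) (finite_subsets_at_top UNIV)"
  proof (rule uniform_lim_mult[OF uniform_limit_fsum[OF c] uniform_limit_const])
    have "compact (fsum c ` {p..q})" using continuous_on_fsum[OF c] compact_continuous_image by blast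
    then show "bounded (fsum c ` {p..q})" by (rule compact_imp_bounded)
    show "bounded (h ` {p..q})" by (rule bd)
  qed
  then obtain I J where IJ: "\<And>F. ((\<lambda>x. (\<Sum>k\<in>F. c k * ek k x) * h x) has_integral I F) {p..q}"
     "((\<lambda>x. fsum c x * h x) has_integral J) {p..q}" "(I \<longlongrightarrow> J) (finite_subsets_at_top UNIV)"
    by (rule uniform_limit_integral) (auto intro!: continuous_intros h)
  have I: "I F = (\<Sum>k\<in>F. c k * integral {p..q} (\<lambda>x. ek k x * h x))" for F
  proof (cases "finite F")
    case True
    have "((\<lambda>x. \<Sum>k\<in>F. c k * (ek k x * h x)) has_integral (\<Sum>k\<in>F. c k * integral {p..q} (\<lambda>x. ek k x * h x))) {p..q}"
      by (intro has_integral_sum True has_integral_mult_right integrable_integral integrable_continuous_real continuous_intros h)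
    then have "((\<lambda>x. (\<Sum>k\<in>F. c k * ek k x) * h x) has_integral (\<Sum>k\<in>F. c k * integral {p..q} (\<lambda>x. ek k x * h x))) {p..q}"
      by (simp add: sum_distrib_right mult.assoc)
    then show ?thesis using IJ(1) has_integral_unique by blast
  next
    \<comment> \<open>Sums over infinite sets are 0, so here the integrand and both sides vanish.
      This case is needed because \<open>I\<close> has to equal the sum functional on all
      sets.\<close>
    case False then show ?thesis using IJ(1)[of F] by simp
  qed
  have "I = sum (\<lambda>k. c k * integral {p..q} (\<lambda>x. ek k x * h x))"
    by (rule ext, rule I)
  with IJ(3) have "((\<lambda>k. c k * integral {p..q} (\<lambda>x. ek k x * h x)) has_sum J) UNIV"
    by (simp only: has_sum_def)
  then show ?thesis using IJ(2) by (simp add: integral_unique)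
qed

lemma cfc_fsum:
  assumes c: "(\<lambda>k. norm (c k)) summable_on UNIV"
  shows "cfc (fsum c) k = c k"
proof -
  have "((\<lambda>j. c j * integral {0..1} (\<lambda>x. ek j x * ek (-k) x)) has_sum cfc (fsum c) k) UNIV"
    unfolding cfc_def by (intro has_sum_integral_fsum[OF c] continuous_intros)
  also have "(\<lambda>j. c j * integral {0..1} (\<lambda>x. ek j x * ek (-k) x)) = (\<lambda>j. if j = k then c k else 0)"
    by (rule ext) (simp add: ek_add[symmetric] integral_ek)
  finally have 1: "((\<lambda>j. if j = k then c k else 0) has_sum cfc (fsum c) k) UNIV" .
  have "((\<lambda>j. if j = k then c k else 0) has_sum c k) UNIV"
    by (rule has_sum_finite_neutralI[of "{k}"]) auto
  with 1 show ?thesis by (rule has_sum_unique)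
qed

lemma per1_frac:
  assumes "\<And>x. f (x + 1) = f x"
  shows "f (frac x) = f (x::real)"
proof -
  have nat: "f (x + of_nat n) = f x" for n x
  proof (induction n)
    case (Suc n)
    have "f (x + of_nat (Suc n)) = f ((x + of_nat n) + 1)" by (simp add: algebra_simps)
    then show ?case using assms Suc by simp
  qed simp
  have int: "f (x + of_int k) = f x" for k x
  proof (cases "k \<ge> 0")
    case True
    then show ?thesis using nat[of x "nat k"] by simp
  next
    case False
    then show ?thesis using nat[of "x + of_int k" "nat (-k)"] by simp
  qed
  show ?thesis using int[of "frac x" "\<lfloor>x\<rfloor>"] by (simp add: frac_def)
qed

lemma cfc_diff:
  assumes "continuous_on {0..1} f" "continuous_on {0..1} g"
  shows "cfc (\<lambda>x. f x - g x) k = cfc f k - cfc g k"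
  unfolding cfc_def
  by (subst integral_diff[symmetric])
     (auto intro!: integrable_continuous_real continuous_intros assms simp: algebra_simps)

lemma cfc_add:
  assumes "continuous_on {0..1} f" "continuous_on {0..1} g"
  shows "cfc (\<lambda>x. f x + g x) k = cfc f k + cfc g k"
  unfolding cfc_def
  by (subst integral_add[symmetric])
     (auto intro!: integrable_continuous_real continuous_intros assms simp: algebra_simps)

lemma cfc_cmult: "cfc (\<lambda>x. c * f x) k = c * cfc f k"
  unfolding cfc_def by (subst integral_mult_right[symmetric]) (simp add: algebra_simps)

lemma fourier_inversion:
  assumes g: "continuous_on UNIV g" "\<And>x. g (x + 1) = g x"
    and c: "(\<lambda>k. norm (cfc g k)) summable_on UNIV"
  shows "g = fsum (cfc g)"
proof -
  define h where "h = (\<lambda>x. g x - fsum (cfc g) x)"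
  have hp: "h (x + 1) = h x" for x by (simp add: h_def g fsum_per)
  have gc: "continuous_on {0..1} g" using g(1) continuous_on_subset by blast
  have "h x = 0" if "x \<in> {0..1}" for x
  proof (rule fourier_unique[OF _ _ _ that])
    show "continuous_on {0..1} h" unfolding h_def by (intro continuous_intros gc continuous_on_fsum c)
    show "h 0 = h 1" using hp[of 0] by simp
    show "cfc h k = 0" for k unfolding h_def
      by (subst cfc_diff) (auto intro!: gc continuous_on_fsum c simp: cfc_fsum[OF c])
  qed
  then have "h (frac x) = 0" for x by (simp add: frac_lt_1 less_imp_le)
  then have "h x = 0" for x using per1_frac[of h, OF hp] by simp
  then show ?thesis by (auto simp: h_def)
qed

definition conv :: "(int \<Rightarrow> complex) \<Rightarrow> (int \<Rightarrow> complex) \<Rightarrow> int \<Rightarrow> complex" where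
  "conv a b k = (\<Sum>\<^sub>\<infinity>l. a l * b (k - l))"

lemma cfc_mult:
  assumes f: "continuous_on UNIV f" "\<And>x. f (x + 1) = f x"
    and c: "(\<lambda>k. norm (cfc f k)) summable_on UNIV"
    and g: "continuous_on {0..1} g"
  shows "cfc (\<lambda>x. f x * g x) k = conv (cfc f) (cfc g) k"
proof -
  have "((\<lambda>l. cfc f l * integral {0..1} (\<lambda>x. ek l x * (g x * ek (-k) x))) has_sum
      integral {0..1} (\<lambda>x. fsum (cfc f) x * (g x * ek (-k) x))) UNIV"
    by (intro has_sum_integral_fsum[OF c] continuous_intros g)
  moreover have "integral {0..1} (\<lambda>x. ek l x * (g x * ek (-k) x)) = cfc g (k - l)" for l
    unfolding cfc_def by (simp add: ek_add[of l "-k", simplified] algebra_simps)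
  moreover have "integral {0..1} (\<lambda>x. fsum (cfc f) x * (g x * ek (-k) x)) = cfc (\<lambda>x. f x * g x) k"
    unfolding cfc_def fourier_inversion[OF f c, symmetric] by (simp add: algebra_simps)
  ultimately show ?thesis
    unfolding conv_def by (simp add: infsumI)
qed

text \<open>Integrating the series of derivatives term by term from \<open>p\<close> to
  \<open>y\<close> telescopes to \<open>fsum c y - fsum c p\<close>; the fundamental theorem then
  differentiates this. The base point x - 1 merely puts \<open>x\<close> in the interior.\<close>

lemma fsum_has_vderiv:
  assumes c: "(\<lambda>k. norm (c k)) summable_on UNIV" and d: "(\<lambda>k. norm (dsym k * c k)) summable_on UNIV"
  shows "(fsum c has_vector_derivative fsum (\<lambda>k. dsym k * c k) x) (at x)"
proof -
  define p where "p = x - 1"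
  let ?d = "\<lambda>k. dsym k * c k"
  have *: "integral {p..y} (fsum ?d) = fsum c y - fsum c p" if "p \<le> y" for y
  proof -
    have "((\<lambda>k. ?d k * integral {p..y} (\<lambda>x. ek k x * 1)) has_sum integral {p..y} (\<lambda>x. fsum ?d x * 1)) UNIV"
      by (intro has_sum_integral_fsum[OF d] continuous_intros)
    moreover have "?d k * integral {p..y} (\<lambda>x. ek k x * 1) = c k * ek k y - c k * ek k p" for k
    proof -
      have "((\<lambda>x. dsym k * ek k x) has_integral (ek k y - ek k p)) {p..y}"
        by (rule fundamental_theorem_of_calculus[OF that]) (auto intro: ek_has_vderiv)
      then have "integral {p..y} (\<lambda>x. dsym k * ek k x) = ek k y - ek k p" by (rule integral_unique)
      then have "dsym k * integral {p..y} (ek k) = ek k y - ek k p" by simp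
      then show ?thesis by (simp only: mult.assoc mult.left_commute[of "dsym k"] right_diff_distrib[symmetric] mult_1_right)
    qed
    ultimately have "((\<lambda>k. c k * ek k y - c k * ek k p) has_sum integral {p..y} (fsum ?d)) UNIV"
      by simp
    moreover have "((\<lambda>k. c k * ek k y - c k * ek k p) has_sum (fsum c y - fsum c p)) UNIV"
      unfolding fsum_def
      by (intro has_sum_minus has_sum_infsum abs_summable_summable[OF abs_summable_fsum[OF c]])
    ultimately show ?thesis by (rule has_sum_unique)
  qed
  have "((\<lambda>y. integral {p..y} (fsum ?d)) has_vector_derivative fsum ?d x) (at x within {p..x+1})"
    by (rule integral_has_vector_derivative) (auto intro: continuous_on_fsum d simp: p_def)
  moreover have "x \<in> interior {p..x+1}" by (simp add: p_def)
  ultimately have "((\<lambda>y. integral {p..y} (fsum ?d)) has_vector_derivative fsum ?d x) (at x)"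
    by (metis at_within_interior)
  then have "((\<lambda>y. fsum c p + integral {p..y} (fsum ?d)) has_vector_derivative fsum ?d x) (at x)"
    by (auto intro!: derivative_eq_intros)
  then show ?thesis
  proof (rule has_vector_derivative_transform_within_open[where S = "{p<..}"])
    show "\<And>y. y \<in> {p<..} \<Longrightarrow> fsum c p + integral {p..y} (fsum ?d) = fsum c y"
      by (subst *) auto
  qed (auto simp: p_def)
qed

text \<open>Integrate the pointwise inequality |g - S|^2 >= 0, where \<open>S\<close> is the partial
  Fourier sum over \<open>F\<close>. The cross term contributes 2X and the square X, which leaves X
  on the left.\<close>

lemma bessel:
  assumes g: "continuous_on {0..1} g" and M: "\<And>x. x \<in> {0..1} \<Longrightarrow> cmod (g x) \<le> M" and F: "finite F"
  shows "(\<Sum>k\<in>F. (cmod (cfc g k))\<^sup>2) \<le> M\<^sup>2"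
proof -
  define S where "S = (\<lambda>x. \<Sum>k\<in>F. cfc g k * ek k x)"
  have Sc: "continuous_on {0..1} S" unfolding S_def by (intro continuous_intros)
  note ci = integrable_continuous_real continuous_intros g Sc
  define X where "X = (\<Sum>k\<in>F. (cmod (cfc g k))\<^sup>2)"
  have gS: "integral {0..1} (\<lambda>x. g x * cnj (S x)) = of_real X"
  proof -
    have "integral {0..1} (\<lambda>x. g x * cnj (S x)) = integral {0..1} (\<lambda>x. \<Sum>k\<in>F. cnj (cfc g k) * (g x * ek (-k) x))"
      by (simp add: S_def sum_distrib_left cnj_ek algebra_simps)
    also have "\<dots> = (\<Sum>k\<in>F. integral {0..1} (\<lambda>x. cnj (cfc g k) * (g x * ek (-k) x)))"
      by (intro integral_sum F ci)
    also have "\<dots> = (\<Sum>k\<in>F. cnj (cfc g k) * cfc g k)"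
      by (simp add: cfc_def)
    also have "\<dots> = of_real X"
      unfolding X_def of_real_sum
      by (intro sum.cong) (simp_all add: complex_norm_square mult.commute del: of_real_power)
    finally show ?thesis .
  qed
  have SS: "integral {0..1} (\<lambda>x. S x * cnj (S x)) = of_real X"
  proof -
    have "integral {0..1} (\<lambda>x. S x * cnj (S x)) = integral {0..1} (\<lambda>x. \<Sum>k\<in>F. cnj (cfc g k) * (S x * ek (-k) x))"
      by (subst (2) S_def) (simp add: sum_distrib_left cnj_ek algebra_simps)
    also have "\<dots> = (\<Sum>k\<in>F. integral {0..1} (\<lambda>x. cnj (cfc g k) * (S x * ek (-k) x)))"
      by (intro integral_sum F ci)
    also have "\<dots> = (\<Sum>k\<in>F. cnj (cfc g k) * cfc g k)"
    proof (intro sum.cong refl)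
      fix k assume k: "k \<in> F"
      have "integral {0..1} (\<lambda>x. S x * ek (-k) x) = integral {0..1} (\<lambda>x. \<Sum>j\<in>F. cfc g j * ek (j - k) x)"
        by (simp add: S_def sum_distrib_right ek_add[symmetric] mult.assoc)
      also have "\<dots> = (\<Sum>j\<in>F. integral {0..1} (\<lambda>x. cfc g j * ek (j - k) x))"
        by (intro integral_sum F ci)
      also have "\<dots> = (\<Sum>j\<in>F. if j = k then cfc g k else 0)"
        by (intro sum.cong) (auto simp: integral_ek)
      also have "\<dots> = cfc g k" using k F by simp
      finally show "integral {0..1} (\<lambda>x. cnj (cfc g k) * (S x * ek (-k) x)) = cnj (cfc g k) * cfc g k"
        by simp
    qed
    also have "\<dots> = of_real X"
      unfolding X_def of_real_sum
      by (intro sum.cong) (simp_all add: complex_norm_square mult.commute del: of_real_power)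
    finally show ?thesis .
  qed
  have Re: "integral {0..1} (\<lambda>x. Re (h x)) = Re (integral {0..1} h)" if "continuous_on {0..1} h" for h :: "real \<Rightarrow> complex"
    using integral_linear[OF integrable_continuous_real[OF that] bounded_linear_Re] by (simp add: o_def)
  have 1: "integral {0..1} (\<lambda>x. Re (g x * cnj (S x))) = X"
    by (subst Re) (auto intro!: continuous_intros g Sc simp: gS)
  have 2: "integral {0..1} (\<lambda>x. Re (S x * cnj (S x))) = X"
    by (subst Re) (auto intro!: continuous_intros g Sc simp: SS)
  have "2 * X - X = 2 * integral {0..1} (\<lambda>x. Re (g x * cnj (S x))) - integral {0..1} (\<lambda>x. Re (S x * cnj (S x)))"
    by (simp only: 1 2)
  also have "\<dots> = integral {0..1} (\<lambda>x. 2 * Re (g x * cnj (S x)) - Re (S x * cnj (S x)))"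
    by (subst integral_diff) (intro ci, intro ci, simp only: integral_mult_right)
  also have "\<dots> \<le> integral {0..1} (\<lambda>x::real. M\<^sup>2)"
  proof (rule integral_le)
    fix x :: real assume x: "x \<in> {0..1}"
    have "0 \<le> (cmod (g x - S x))\<^sup>2" by simp
    also have "\<dots> = (cmod (g x))\<^sup>2 - (2 * Re (g x * cnj (S x)) - Re (S x * cnj (S x)))"
      unfolding cmod_power2 by (simp add: power2_eq_square algebra_simps)
    also have "(cmod (g x))\<^sup>2 \<le> M\<^sup>2" using M[OF x] by (intro power_mono) auto
    finally show "2 * Re (g x * cnj (S x)) - Re (S x * cnj (S x)) \<le> M\<^sup>2" by simp
  qed (auto intro!: ci)
  finally show ?thesis by (simp add: X_def)
qed

section \<open>The equation for the Fourier coefficients\<close>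

subsection \<open>Double sums\<close>

lemma has_sum_product_nonneg:
  fixes x :: "'a \<Rightarrow> real" and y :: "'b \<Rightarrow> real"
  assumes "(x has_sum X) UNIV" "(y has_sum Y) UNIV" "\<And>j. x j \<ge> 0" "\<And>l. y l \<ge> 0"
  shows "((\<lambda>(j, l). x j * y l) has_sum (X * Y)) UNIV"
proof -
  have 1: "((\<lambda>l. x j * y l) has_sum (x j * Y)) UNIV" for j
    by (rule has_sum_cmult_right[OF assms(2)])
  have 2: "((\<lambda>j. x j * Y) has_sum (X * Y)) UNIV"
    by (rule has_sum_cmult_left[OF assms(1)])
  have 3: "(\<lambda>(j, l). x j * y l) summable_on (UNIV \<times> UNIV)"
    by (rule summable_on_SigmaI[where g = "\<lambda>j. x j * Y"])
       (use 1 2 assms in \<open>auto intro: has_sum_imp_summable\<close>)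
  show ?thesis
    using has_sum_SigmaI[where A = UNIV and B = "\<lambda>_. UNIV" and f = "\<lambda>(j, l). x j * y l" and g = "\<lambda>j. x j * Y" and S = "X * Y"] 1 2 3
    by simp
qed

text \<open>A pair (j, l) stands for the zero-sum triple (j, l, -(j + l)); the maps
  \<open>bij_pair_rot1\<close> to \<open>bij_pair_rot4\<close> permute its three entries.\<close>

lemma bij_pair_rot1: "bij (\<lambda>(j, l). (j, - (j + l)) :: int \<times> int)"
  by (rule bij_betw_byWitness[where f' = "\<lambda>(j, l). (j, - (j + l))"]) auto

lemma bij_pair_rot2: "bij (\<lambda>(j, l). (- (j + l), l) :: int \<times> int)"
  by (rule bij_betw_byWitness[where f' = "\<lambda>(j, l). (- (j + l), l)"]) auto

lemma bij_pair_rot3: "bij (\<lambda>(j, l). (- (j + l), j) :: int \<times> int)"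
  by (rule bij_betw_byWitness[where f' = "\<lambda>(j, l). (l, - (j + l))"]) auto

lemma bij_pair_rot4: "bij (\<lambda>(j, l). (l, - (j + l)) :: int \<times> int)"
  by (rule bij_betw_byWitness[where f' = "\<lambda>(j, l). (- (j + l), j)"]) auto

lemma bij_pair_add: "bij (\<lambda>(j, l). (j + l, l) :: int \<times> int)"
  by (rule bij_betw_byWitness[where f' = "\<lambda>(j, l). (j - l, l)"]) auto

lemma bij_pair_neg: "bij (\<lambda>(j, l). (- j, l) :: int \<times> int)"
  by (rule bij_betw_byWitness[where f' = "\<lambda>(j, l). (- j, l)"]) auto

lemma has_sum_pair_bij:
  assumes "(f has_sum S) (UNIV :: (int \<times> int) set)" "bij h"
  shows "((\<lambda>p. f (h p)) has_sum S) UNIV"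
  using has_sum_reindex_bij_betw[of h UNIV UNIV f S] assms by simp

lemma has_sum_Sigma_UNIV:
  fixes f :: "int \<times> int \<Rightarrow> complex"
  assumes "f summable_on UNIV"
  shows "((\<lambda>k. \<Sum>\<^sub>\<infinity>l. f (k, l)) has_sum infsum f UNIV) UNIV"
proof -
  have "f summable_on (UNIV \<times> UNIV)" using assms by simp
  then show ?thesis
    using infsum_Sigma_banach[of f UNIV "\<lambda>_. UNIV"] summable_on_Sigma_banach[of "\<lambda>x y. f (x, y)" UNIV "\<lambda>_. UNIV"]
    by (simp add: has_sum_iff case_prod_unfold)
qed

subsection \<open>Slowly varying weights\<close>

text \<open>\<open>W\<close> is the square of the Sobolev weight; \<open>K\<close> measures its variation and \<open>D\<close> its doubling.
  The energy estimate depends on \<open>W\<close> only through \<open>K\<close> and \<open>D\<close>, not through an upper bound of \<open>W\<close>.\<close>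

definition good_weight :: "real \<Rightarrow> real \<Rightarrow> (int \<Rightarrow> real) \<Rightarrow> bool" where
  "good_weight K D W \<longleftrightarrow> K \<ge> 0 \<and> D \<ge> 1 \<and> (\<forall>k. W k \<ge> 0) \<and> (\<forall>k. W (- k) = W k) \<and>
     (\<forall>j k. \<bar>j\<bar> \<le> \<bar>k\<bar> \<longrightarrow> W j \<le> W k) \<and>
     (\<forall>x y. \<bar>y\<bar> \<le> \<bar>x\<bar> \<longrightarrow> \<bar>x\<bar> \<le> 2 * \<bar>y\<bar> \<longrightarrow> \<bar>of_int y\<bar> * (W x - W y) \<le> K * \<bar>of_int (x - y)\<bar> * W x) \<and>
     (\<forall>x y. \<bar>x\<bar> \<le> 2 * \<bar>y\<bar> \<longrightarrow> W x \<le> D * W y)"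

lemma good_weightD:
  assumes "good_weight K D W"
  shows "K \<ge> 0" "D \<ge> 1" "W k \<ge> 0" "W (- k) = W k"
    "\<bar>j\<bar> \<le> \<bar>k\<bar> \<Longrightarrow> W j \<le> W k"
    "\<bar>y\<bar> \<le> \<bar>x\<bar> \<Longrightarrow> \<bar>x\<bar> \<le> 2 * \<bar>y\<bar> \<Longrightarrow> \<bar>of_int y\<bar> * (W x - W y) \<le> K * \<bar>of_int (x - y)\<bar> * W x"
    "\<bar>x\<bar> \<le> 2 * \<bar>y\<bar> \<Longrightarrow> W x \<le> D * W y"
  using assms unfolding good_weight_def by blast+

text \<open>The two large frequencies almost cancel: with k1 = -(k2 + k3) the sum becomes -k3 W(k1)
  - k2 (W(k1) - W(k2)) + k3 W(k3). Slow variation bounds the difference by K |k3| W(k1), and since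
  |k1| is at most 2 |k2|, doubling replaces W(k1) by D W(k2). Only the smallest frequency survives
  as a factor.\<close>

lemma symbol_bound_aux:
  assumes W: "good_weight K D W"
    and k: "k1 + k2 + k3 = 0" "\<bar>k3\<bar> \<le> \<bar>k2\<bar>" "\<bar>k2\<bar> \<le> \<bar>k1\<bar>"
  shows "\<bar>of_int k1 * W k1 + of_int k2 * W k2 + of_int k3 * W k3\<bar>
     \<le> ((1 + K) * D + 1) * \<bar>of_int k3\<bar> * W k2 \<and> W k2 \<le> W k1"
proof -
  note g = good_weightD[OF W]
  have k1: "k1 = - (k2 + k3)" using k(1) by simp
  have a: "\<bar>k1\<bar> \<le> 2 * \<bar>k2\<bar>" using k by linarith
  have e: "of_int k1 * W k1 + of_int k2 * W k2 = - of_int k3 * W k1 - of_int k2 * (W k1 - W k2)"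
    unfolding k1 by (simp add: algebra_simps)
  have mon: "W k2 \<le> W k1" "W k3 \<le> W k2" using g(5) k by auto
  have "\<bar>of_int (- k2)\<bar> * (W k1 - W (- k2)) \<le> K * \<bar>of_int (k1 - (- k2))\<bar> * W k1"
    by (rule g(6)) (use k a in auto)
  also have "k1 - (- k2) = - k3" using k1 by simp
  finally have b: "\<bar>of_int k2\<bar> * (W k1 - W k2) \<le> K * \<bar>of_int k3\<bar> * W k1"
    by (simp add: g(4))
  have "\<bar>of_int k1 * W k1 + of_int k2 * W k2 + of_int k3 * W k3\<bar>
      \<le> \<bar>of_int k3\<bar> * W k1 + \<bar>of_int k2\<bar> * (W k1 - W k2) + \<bar>of_int k3\<bar> * W k3"
  proof -
    have "\<bar>of_int k3 * W k1\<bar> = \<bar>of_int k3\<bar> * W k1" "\<bar>of_int k3 * W k3\<bar> = \<bar>of_int k3\<bar> * W k3"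
       "\<bar>of_int k2 * (W k1 - W k2)\<bar> = \<bar>of_int k2\<bar> * (W k1 - W k2)"
      using g(3) mon by (simp_all add: abs_mult)
    then show ?thesis unfolding e by linarith
  qed
  also have "\<dots> \<le> \<bar>of_int k3\<bar> * W k1 + K * \<bar>of_int k3\<bar> * W k1 + \<bar>of_int k3\<bar> * W k2"
    using b mon(2) by (intro add_mono mult_left_mono) auto
  also have "\<dots> = (1 + K) * \<bar>of_int k3\<bar> * W k1 + \<bar>of_int k3\<bar> * W k2" by (simp add: algebra_simps)
  also have "\<dots> \<le> (1 + K) * \<bar>of_int k3\<bar> * (D * W k2) + \<bar>of_int k3\<bar> * W k2"
    using g(7)[OF a] g(1) by (intro add_mono mult_left_mono) auto
  also have "\<dots> = ((1 + K) * D + 1) * \<bar>of_int k3\<bar> * W k2" by (simp add: algebra_simps)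
  finally show ?thesis using mon by simp
qed

lemma quad_bound:
  fixes w1 w2 p q :: real
  assumes "0 \<le> w2" "w2 \<le> w1" "p \<ge> 0" "q \<ge> 0"
  shows "w2 * (p * q) \<le> (w1 * p\<^sup>2 + w2 * q\<^sup>2) / 2"
proof -
  have "0 \<le> (p - q)\<^sup>2" by simp
  then have "2 * (p * q) \<le> p\<^sup>2 + q\<^sup>2" by (simp add: power2_eq_square algebra_simps)
  then have "w2 * (2 * (p * q)) \<le> w2 * (p\<^sup>2 + q\<^sup>2)" using assms by (intro mult_left_mono)
  also have "\<dots> \<le> w1 * p\<^sup>2 + w2 * q\<^sup>2"
    using mult_right_mono[OF assms(2), of "p\<^sup>2"] by (simp add: algebra_simps)
  finally show ?thesis by simp
qed

lemma symbol_bound_ord: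
  fixes x :: "int \<Rightarrow> real"
  assumes W: "good_weight K D W" and x: "\<And>k. x k \<ge> 0"
    and k: "k1 + k2 + k3 = 0" "\<bar>k3\<bar> \<le> \<bar>k2\<bar>" "\<bar>k2\<bar> \<le> \<bar>k1\<bar>"
  shows "\<bar>of_int k1 * W k1 + of_int k2 * W k2 + of_int k3 * W k3\<bar> * (x k1 * x k2 * x k3)
     \<le> ((1 + K) * D + 1) / 2 * (\<bar>of_int k3\<bar> * x k3) * (W k1 * (x k1)\<^sup>2 + W k2 * (x k2)\<^sup>2)"
proof -
  note g = good_weightD[OF W]
  let ?C = "(1 + K) * D + 1"
  have C: "?C \<ge> 0" using g(1,2) by (intro add_nonneg_nonneg mult_nonneg_nonneg) auto
  have s: "\<bar>of_int k1 * W k1 + of_int k2 * W k2 + of_int k3 * W k3\<bar> \<le> ?C * \<bar>of_int k3\<bar> * W k2"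
     "W k2 \<le> W k1" using symbol_bound_aux[OF W k] by auto
  have "\<bar>of_int k1 * W k1 + of_int k2 * W k2 + of_int k3 * W k3\<bar> * (x k1 * x k2 * x k3)
     \<le> ?C * \<bar>of_int k3\<bar> * W k2 * (x k1 * x k2 * x k3)"
    by (rule mult_right_mono[OF s(1)]) (simp add: x)
  also have "\<dots> = ?C * (\<bar>of_int k3\<bar> * x k3) * (W k2 * (x k1 * x k2))" by (simp add: algebra_simps)
  also have "\<dots> \<le> ?C * (\<bar>of_int k3\<bar> * x k3) * ((W k1 * (x k1)\<^sup>2 + W k2 * (x k2)\<^sup>2) / 2)"
    using C x s g(3) by (intro mult_left_mono quad_bound mult_nonneg_nonneg) auto
  finally show ?thesis by simp
qed

text \<open>All six products appear so that the bound is symmetric in the three frequencies. Their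
  ordering varies with (j, l), and a symmetric bound can be summed without splitting the index
  set.\<close>

lemma symbol_bound:
  fixes x :: "int \<Rightarrow> real"
  assumes W: "good_weight K D W" and x: "\<And>k. x k \<ge> 0"
  defines "A \<equiv> \<lambda>k. \<bar>of_int k\<bar> * x k" and "B \<equiv> \<lambda>k. W k * (x k)\<^sup>2"
  assumes k: "j + l + n = 0"
  shows "\<bar>of_int j * W j + of_int l * W l + of_int n * W n\<bar> * (x j * x l * x n)
     \<le> ((1 + K) * D + 1) / 2 * (A n * B j + A n * B l + A j * B l + A j * B n + A l * B j + A l * B n)"
    (is "?L j l n \<le> ?C * ?S")
proof -
  note g = good_weightD[OF W]
  have C: "?C \<ge> 0" using g(1,2) by (intro divide_nonneg_nonneg add_nonneg_nonneg mult_nonneg_nonneg) auto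
  have nn: "A k \<ge> 0" "B k \<ge> 0" for k using x g(3) by (auto simp: A_def B_def)
  have nnp: "A k * B k' \<ge> 0" for k k' using nn by simp
  have key: "?L k1 k2 k3 \<le> ?C * (A k3 * B k1 + A k3 * B k2)"
    if "k1 + k2 + k3 = 0" "\<bar>k3\<bar> \<le> \<bar>k2\<bar>" "\<bar>k2\<bar> \<le> \<bar>k1\<bar>" for k1 k2 k3
    using symbol_bound_ord[OF W, of x, OF _ that] x by (simp add: A_def B_def distrib_left mult.assoc)
  have le: "?L k1 k2 k3 \<le> ?C * ?S" if "?L k1 k2 k3 \<le> ?C * (A k3 * B k1 + A k3 * B k2)"
     "A k3 * B k1 + A k3 * B k2 \<le> ?S" for k1 k2 k3
    using that(1) mult_left_mono[OF that(2) C] by linarith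
  consider "\<bar>n\<bar> \<le> \<bar>l\<bar>" "\<bar>l\<bar> \<le> \<bar>j\<bar>" | "\<bar>n\<bar> \<le> \<bar>j\<bar>" "\<bar>j\<bar> \<le> \<bar>l\<bar>" | "\<bar>l\<bar> \<le> \<bar>n\<bar>" "\<bar>n\<bar> \<le> \<bar>j\<bar>"
    | "\<bar>l\<bar> \<le> \<bar>j\<bar>" "\<bar>j\<bar> \<le> \<bar>n\<bar>" | "\<bar>j\<bar> \<le> \<bar>l\<bar>" "\<bar>l\<bar> \<le> \<bar>n\<bar>" | "\<bar>j\<bar> \<le> \<bar>n\<bar>" "\<bar>n\<bar> \<le> \<bar>l\<bar>"
    by linarith
  then show ?thesis
  proof cases
    case 1
    show ?thesis by (rule le[OF key]) (use 1 k nnp in \<open>auto simp: add_nonneg_nonneg\<close>)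
  next
    case 2
    have "?L l j n \<le> ?C * ?S" by (rule le[OF key]) (use 2 k nnp in \<open>auto simp: add_nonneg_nonneg\<close>)
    then show ?thesis by (simp add: ac_simps)
  next
    case 3
    have "?L j n l \<le> ?C * ?S" by (rule le[OF key]) (use 3 k nnp in \<open>auto simp: add_nonneg_nonneg\<close>)
    then show ?thesis by (simp add: ac_simps)
  next
    case 4
    have "?L n j l \<le> ?C * ?S" by (rule le[OF key]) (use 4 k nnp in \<open>auto simp: add_nonneg_nonneg\<close>)
    then show ?thesis by (simp add: ac_simps)
  next
    case 5
    have "?L n l j \<le> ?C * ?S" by (rule le[OF key]) (use 5 k nnp in \<open>auto simp: add_nonneg_nonneg\<close>)
    then show ?thesis by (simp add: ac_simps)
  next
    case 6
    have "?L l n j \<le> ?C * ?S" by (rule le[OF key]) (use 6 k nnp in \<open>auto simp: add_nonneg_nonneg\<close>)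
    then show ?thesis by (simp add: ac_simps)
  qed
qed

lemma summable_imp_bounded:
  fixes x :: "'a \<Rightarrow> real"
  assumes "x summable_on UNIV" "\<And>k. x k \<ge> 0"
  shows "x k \<le> infsum x UNIV"
  using finite_sum_le_infsum[OF assms(1), of "{k}"] assms(2) by simp

lemma summable_pair_product:
  fixes x y :: "int \<Rightarrow> complex"
  assumes "(\<lambda>k. norm (x k)) summable_on UNIV" "(\<lambda>k. norm (y k)) summable_on UNIV"
  shows "(\<lambda>(k, l). norm (x k) * norm (y l)) summable_on UNIV"
  using has_sum_product_nonneg[OF has_sum_infsum[OF assms(1)] has_sum_infsum[OF assms(2)]]
  by (auto intro: has_sum_imp_summable)

text \<open>The third factor is bounded by its own sum, which leaves a product of two summable
  sequences in independent indices.\<close>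

lemma summable_trilinear:
  fixes p q r :: "int \<Rightarrow> complex"
  assumes p: "(\<lambda>k. norm (p k)) summable_on UNIV" and q: "(\<lambda>k. norm (q k)) summable_on UNIV"
    and r: "(\<lambda>k. norm (r k)) summable_on UNIV"
  shows "(\<lambda>(k, l). p k * (q l * r (k - l))) summable_on UNIV"
proof (rule abs_summable_summable[where f = "\<lambda>(k, l). p k * (q l * r (k - l))"], rule Infinite_Sum.abs_summable_on_comparison_test')
  define R where "R = infsum (\<lambda>k. norm (r k)) UNIV"
  show "(\<lambda>(k, l). norm (p k) * norm (q l) * R) summable_on UNIV"
    using summable_on_cmult_left[OF summable_pair_product[OF p q], of R] by (simp add: case_prod_unfold)
  fix kl :: "int \<times> int"
  obtain k l where kl: "kl = (k, l)" by force
  have "norm (r (k - l)) \<le> R" unfolding R_def by (rule summable_imp_bounded[OF r]) simp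
  then have "norm (p k) * norm (q l) * norm (r (k - l)) \<le> norm (p k) * norm (q l) * R"
    by (intro mult_left_mono) auto
  then show "norm (case kl of (k, l) \<Rightarrow> p k * (q l * r (k - l))) \<le> (case kl of (k, l) \<Rightarrow> norm (p k) * norm (q l) * R)"
    by (simp add: kl norm_mult mult.assoc)
qed

lemma has_sum_trilinear:
  fixes p q r :: "int \<Rightarrow> complex"
  assumes "(\<lambda>k. norm (p k)) summable_on UNIV" and "(\<lambda>k. norm (q k)) summable_on UNIV"
    and "(\<lambda>k. norm (r k)) summable_on UNIV"
  shows "((\<lambda>k. p k * conv q r k) has_sum (\<Sum>\<^sub>\<infinity>(k, l). p k * (q l * r (k - l)))) UNIV"
proof -
  have "((\<lambda>k. \<Sum>\<^sub>\<infinity>l. (case (k, l) of (k, l) \<Rightarrow> p k * (q l * r (k - l)))) has_sum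
      (\<Sum>\<^sub>\<infinity>(k, l). p k * (q l * r (k - l)))) UNIV"
    by (rule has_sum_Sigma_UNIV[OF summable_trilinear[OF assms]])
  then show ?thesis by (simp add: conv_def infsum_cmult_right')
qed

subsection \<open>Trilinear estimates\<close>

text \<open>In the coordinates \<open>j\<close>, \<open>l\<close>, \<open>- (j + l)\<close> the sum is invariant under exchanging the three
  frequencies; averaging replaces \<open>f k = k W k\<close> by \<open>f (j + l) - f j - f l\<close>, which costs only one
  factor of the smallest frequency.\<close>

lemma trilinear_estimate:
  fixes a :: "int \<Rightarrow> complex"
  assumes W: "good_weight K D W" and Wb: "\<And>k. W k \<le> N"
    and sym: "\<And>k. a (- k) = cnj (a k)"
    and A: "(\<lambda>k. \<bar>of_int k\<bar> * norm (a k)) summable_on UNIV"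
    and a: "(\<lambda>k. norm (a k)) summable_on UNIV"
    and B: "(\<lambda>k. W k * (norm (a k))\<^sup>2) summable_on UNIV"
  obtains T where "((\<lambda>k. of_int k * of_real (W k) * cnj (a k) * conv a a k) has_sum T) UNIV"
    "norm T \<le> ((1 + K) * D + 1) * (\<Sum>\<^sub>\<infinity>k. \<bar>of_int k\<bar> * norm (a k)) * (\<Sum>\<^sub>\<infinity>k. W k * (norm (a k))\<^sup>2)"
proof -
  note g = good_weightD[OF W]
  define f :: "int \<Rightarrow> complex" where "f k = of_real (of_int k * W k)" for k
  define G where "G = (\<lambda>(j, l). a j * a l * a (- (j + l)))"
  define p where "p k = f k * a (- k)" for k
  \<comment> \<open>The upper bound \<open>N\<close> of the weight guarantees absolute convergence,
    and with it the legitimacy of the rearrangements; it does not enter the final constant.\<close>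
  have psum: "(\<lambda>k. norm (p k)) summable_on UNIV"
  proof (rule summable_on_comparison_test[OF summable_on_cmult_left[OF A, of N]])
    fix k
    have "norm (p k) = \<bar>of_int k\<bar> * norm (a k) * W k" using g(3) by (simp add: p_def f_def norm_mult abs_mult sym)
    also have "\<dots> \<le> \<bar>of_int k\<bar> * norm (a k) * N" using Wb by (intro mult_left_mono) auto
    finally show "norm (p k) \<le> \<bar>of_int k\<bar> * norm (a k) * N" .
  qed simp
  define T where "T = (\<Sum>\<^sub>\<infinity>(k, l). p k * (a l * a (k - l)))"
  have hs: "((\<lambda>k. p k * conv a a k) has_sum T) UNIV"
    unfolding T_def by (rule has_sum_trilinear[OF psum a a])
  have "((\<lambda>(k, l). p k * (a l * a (k - l))) has_sum T) UNIV"
    unfolding T_def by (rule has_sum_infsum[OF summable_trilinear[OF psum a a]])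
  from has_sum_pair_bij[OF this bij_pair_add]
  have S0: "((\<lambda>(j, l). f (j + l) * G (j, l)) has_sum T) UNIV"
    by (simp add: case_prod_unfold p_def G_def algebra_simps)
  from has_sum_pair_bij[OF this bij_pair_rot1]
  have S1: "((\<lambda>(j, l). - f l * G (j, l)) has_sum T) UNIV"
    by (simp add: case_prod_unfold f_def g(4) G_def algebra_simps)
  from has_sum_pair_bij[OF S0 bij_pair_rot2]
  have S2: "((\<lambda>(j, l). - f j * G (j, l)) has_sum T) UNIV"
    by (simp add: case_prod_unfold f_def g(4) G_def algebra_simps)
  have S3: "((\<lambda>(j, l). (f (j + l) - f j - f l) * G (j, l)) has_sum (T + T + T)) UNIV"
    using has_sum_add[OF has_sum_add[OF S0 S1] S2] by (simp add: case_prod_unfold algebra_simps)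
  define x where "x k = norm (a k)" for k
  define AA where "AA k = \<bar>of_int k\<bar> * x k" for k
  define BB where "BB k = W k * (x k)\<^sup>2" for k
  have xn: "x (- k) = x k" for k by (simp add: x_def sym)
  let ?C = "((1 + K) * D + 1) / 2"
  define XX where "XX = infsum AA UNIV * infsum BB UNIV"
  have hA: "(AA has_sum infsum AA UNIV) UNIV" and hB: "(BB has_sum infsum BB UNIV) UNIV"
    using A B by (auto simp: AA_def[abs_def] BB_def[abs_def] x_def)
  have nn: "AA k \<ge> 0" "BB k \<ge> 0" for k using g(3) by (auto simp: AA_def BB_def x_def)
  have P1: "((\<lambda>(j, l). AA j * BB l) has_sum XX) UNIV"
    unfolding XX_def by (rule has_sum_product_nonneg[OF hA hB nn])
  have P2: "((\<lambda>(j, l). AA l * BB j) has_sum XX) UNIV"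
    using has_sum_pair_bij[OF P1 bij_swap] by (simp add: case_prod_unfold)
  have Q1: "((\<lambda>(j, l). AA (-(j+l)) * BB j) has_sum XX) UNIV"
    using has_sum_pair_bij[OF P1 bij_pair_rot3] by (simp add: case_prod_unfold)
  have Q2: "((\<lambda>(j, l). AA (-(j+l)) * BB l) has_sum XX) UNIV"
    using has_sum_pair_bij[OF P1 bij_pair_rot2] by (simp add: case_prod_unfold)
  have R1: "((\<lambda>(j, l). AA j * BB (-(j+l))) has_sum XX) UNIV"
    using has_sum_pair_bij[OF P1 bij_pair_rot1] by (simp add: case_prod_unfold)
  have R2: "((\<lambda>(j, l). AA l * BB (-(j+l))) has_sum XX) UNIV"
    using has_sum_pair_bij[OF P1 bij_pair_rot4] by (simp add: case_prod_unfold)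
  have M: "((\<lambda>(j, l). ?C * (AA (-(j+l)) * BB j + AA (-(j+l)) * BB l + AA j * BB l + AA j * BB (-(j+l)) + AA l * BB j + AA l * BB (-(j+l))))
      has_sum (?C * (XX + XX + XX + XX + XX + XX))) UNIV"
    using has_sum_cmult_right[OF has_sum_add[OF has_sum_add[OF has_sum_add[OF has_sum_add[OF has_sum_add[OF Q1 Q2] P1] R1] P2] R2], of ?C]
    by (simp add: case_prod_unfold)
  have "norm (T + T + T) \<le> ?C * (XX + XX + XX + XX + XX + XX)"
  proof (rule norm_infsum_le[OF S3 M])
    fix p :: "int \<times> int"
    obtain j l where p: "p = (j, l)" by force
    define n where "n = - (j + l)"
    have jl: "j + l = - n" "j + l + n = 0" by (auto simp: n_def)
    have "norm ((f (j + l) - f j - f l) * G (j, l)) =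
        \<bar>of_int j * W j + of_int l * W l + of_int n * W n\<bar> * (x j * x l * x n)"
    proof -
      have "f (j + l) - f j - f l = - of_real (of_int j * W j + of_int l * W l + of_int n * W n)"
        unfolding jl by (simp add: f_def g(4))
      moreover have "norm (G (j, l)) = x j * x l * x n"
        by (simp only: G_def prod.case norm_mult x_def n_def)
      ultimately show ?thesis by (simp only: norm_mult norm_minus_cancel norm_of_real)
    qed
    also have "\<dots> \<le> ?C * (AA n * BB j + AA n * BB l + AA j * BB l + AA j * BB n + AA l * BB j + AA l * BB n)"
      unfolding AA_def BB_def
      by (rule symbol_bound[OF W _ jl(2)]) (simp add: x_def)
    finally show "norm (case p of (j, l) \<Rightarrow> (f (j + l) - f j - f l) * G (j, l)) \<le>
       (case p of (j, l) \<Rightarrow> ?C * (AA (-(j+l)) * BB j + AA (-(j+l)) * BB l + AA j * BB l + AA j * BB (-(j+l)) + AA l * BB j + AA l * BB (-(j+l))))"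
      by (simp add: p n_def)
  qed
  moreover have "T + T + T = 3 * T" by simp
  \<comment> \<open>Six rearranged products, each summing to \<open>XX\<close>, carry the factor 1/2
    contained in \<open>?C\<close>; they face three copies of \<open>T\<close>.\<close>
  ultimately have "3 * norm T \<le> 3 * (((1 + K) * D + 1) * XX)"
    by (simp only: norm_mult) (simp add: algebra_simps)
  then have "norm T \<le> ((1 + K) * D + 1) * XX" by simp
  moreover have "(\<lambda>k. p k * conv a a k) = (\<lambda>k. of_int k * of_real (W k) * cnj (a k) * conv a a k)"
    by (simp add: p_def f_def sym)
  ultimately show ?thesis using hs that[of T]
    by (simp add: XX_def AA_def[abs_def] BB_def[abs_def] x_def mult.assoc)
qed

text \<open>Exchanging the frequencies n and -(n + l) of the two factors \<open>z\<close> and adding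
  turns the multiplier into l, the frequency of \<open>c\<close>. This is integration by parts: the
  derivative leaves \<open>z\<close>, so only the square sum of \<open>z\<close> remains on the
  right.\<close>

lemma trilinear_difference_estimate:
  fixes c z :: "int \<Rightarrow> complex"
  assumes sym: "\<And>k. z (- k) = cnj (z k)"
    and A: "(\<lambda>k. \<bar>of_int k\<bar> * norm (c k)) summable_on UNIV"
    and c: "(\<lambda>k. norm (c k)) summable_on UNIV"
    and Z: "(\<lambda>k. \<bar>of_int k\<bar> * norm (z k)) summable_on UNIV"
    and z: "(\<lambda>k. norm (z k)) summable_on UNIV"
    and B: "(\<lambda>k. (norm (z k))\<^sup>2) summable_on UNIV"
  obtains T where "((\<lambda>k. of_int k * cnj (z k) * conv c z k) has_sum T) UNIV"
    "norm T \<le> (\<Sum>\<^sub>\<infinity>k. \<bar>of_int k\<bar> * norm (c k)) * (\<Sum>\<^sub>\<infinity>k. (norm (z k))\<^sup>2)"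
proof -
  define p where "p k = of_int k * z (- k)" for k
  have psum: "(\<lambda>k. norm (p k)) summable_on UNIV"
    using Z by (simp add: p_def norm_mult sym)
  define T where "T = (\<Sum>\<^sub>\<infinity>(k, l). p k * (c l * z (k - l)))"
  have hs: "((\<lambda>k. p k * conv c z k) has_sum T) UNIV"
    unfolding T_def by (rule has_sum_trilinear[OF psum c z])
  have "((\<lambda>(k, l). p k * (c l * z (k - l))) has_sum T) UNIV"
    unfolding T_def by (rule has_sum_infsum[OF summable_trilinear[OF psum c z]])
  from has_sum_pair_bij[OF this bij_pair_neg]
  have S0: "((\<lambda>(n, l). - of_int n * (z n * c l * z (- (n + l)))) has_sum T) UNIV"
    by (simp add: case_prod_unfold p_def algebra_simps)
  from has_sum_pair_bij[OF this bij_pair_rot2]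
  have S1: "((\<lambda>(n, l). of_int (n + l) * (z n * c l * z (- (n + l)))) has_sum T) UNIV"
    by (simp add: case_prod_unfold algebra_simps)
  have S2: "((\<lambda>(n, l). of_int l * (z n * c l * z (- (n + l)))) has_sum (T + T)) UNIV"
    using has_sum_add[OF S0 S1] by (simp add: case_prod_unfold algebra_simps)
  define AA where "AA k = \<bar>of_int k\<bar> * norm (c k)" for k
  define BB where "BB k = (norm (z k))\<^sup>2" for k
  define XX where "XX = infsum AA UNIV * infsum BB UNIV"
  have hA: "(AA has_sum infsum AA UNIV) UNIV" and hB: "(BB has_sum infsum BB UNIV) UNIV"
    using A B by (auto simp: AA_def[abs_def] BB_def[abs_def])
  have nn: "AA k \<ge> 0" "BB k \<ge> 0" for k by (auto simp: AA_def BB_def)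
  have P1: "((\<lambda>(j, l). AA j * BB l) has_sum XX) UNIV"
    unfolding XX_def by (rule has_sum_product_nonneg[OF hA hB nn])
  have P2: "((\<lambda>(j, l). AA l * BB j) has_sum XX) UNIV"
    using has_sum_pair_bij[OF P1 bij_swap] by (simp add: case_prod_unfold)
  have R2: "((\<lambda>(j, l). AA l * BB (-(j+l))) has_sum XX) UNIV"
    using has_sum_pair_bij[OF P1 bij_pair_rot4] by (simp add: case_prod_unfold)
  have M: "((\<lambda>(j, l). AA l * BB j + AA l * BB (-(j+l))) has_sum (XX + XX)) UNIV"
    using has_sum_add[OF P2 R2] by (simp add: case_prod_unfold)
  have "norm (T + T) \<le> XX + XX"
  proof (rule norm_infsum_le[OF S2 M])
    fix p :: "int \<times> int"
    obtain n l where p: "p = (n, l)" by force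
    have "norm (of_int l * (z n * c l * z (- (n + l)))) = AA l * (1 * (norm (z n) * norm (z (- (n + l)))))"
      by (simp add: norm_mult AA_def)
    also have "\<dots> \<le> AA l * ((1 * (norm (z n))\<^sup>2 + 1 * (norm (z (- (n + l))))\<^sup>2) / 2)"
      by (intro mult_left_mono quad_bound nn) auto
    also have "\<dots> \<le> AA l * BB n + AA l * BB (-(n+l))"
      using nn[of l] by (simp add: BB_def field_simps)
    finally show "norm (case p of (n, l) \<Rightarrow> of_int l * (z n * c l * z (- (n + l)))) \<le>
       (case p of (j, l) \<Rightarrow> AA l * BB j + AA l * BB (-(j+l)))"
      by (simp add: p)
  qed
  moreover have "T + T = 2 * T" by simp
  ultimately have "2 * norm T \<le> 2 * XX" by (simp only: norm_mult) simp
  then have "norm T \<le> XX" by simp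
  then show ?thesis using hs that[of T]
    by (simp add: XX_def AA_def[abs_def] BB_def[abs_def] p_def sym mult.assoc)
qed

subsection \<open>Energy estimates\<close>

lemma summable_inverse_squares: "(\<lambda>k::int. 1 / (1 + (real_of_int k)\<^sup>2)) summable_on UNIV"
proof -
  let ?f = "\<lambda>k::int. 1 / (1 + (real_of_int k)\<^sup>2)"
  have "summable (\<lambda>n::nat. 1 / (1 + (real n)\<^sup>2))"
  proof (rule summable_comparison_test'[OF inverse_power_summable[of 2], where N = 1])
    fix n :: nat assume "n \<ge> 1"
    then have "inverse (1 + (real n)\<^sup>2) \<le> inverse ((real n)\<^sup>2)"
      by (intro le_imp_inverse_le) auto
    then show "norm (1 / (1 + (real n)\<^sup>2)) \<le> inverse (real n ^ 2)"
      by (simp add: inverse_eq_divide)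
  qed simp
  then have n: "(\<lambda>n::nat. 1 / (1 + (real n)\<^sup>2)) summable_on UNIV"
    by (intro summable_nonneg_imp_summable_on) auto
  have "?f summable_on range int"
    by (subst summable_on_reindex) (auto simp: o_def n inj_on_def)
  moreover have "?f summable_on range (\<lambda>n. - int n)"
    by (subst summable_on_reindex) (auto simp: o_def n inj_on_def)
  ultimately have "?f summable_on (range int \<union> range (\<lambda>n. - int n))"
    by (rule summable_on_union)
  moreover have "range int \<union> range (\<lambda>n. - int n) = UNIV"
  proof -
    have "k \<in> range int \<union> range (\<lambda>n. - int n)" for k
      by (cases k rule: int_cases2) auto
    then show ?thesis by blast
  qed
  ultimately show ?thesis by simp
qed

lemma has_real_derivative_infsum_int:
  fixes e d :: "int \<Rightarrow> real \<Rightarrow> real"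
  assumes e: "\<And>k t. \<bar>t\<bar> < T \<Longrightarrow> (e k has_real_derivative d k t) (at t)"
    and d: "\<And>k t. \<bar>t\<bar> < T \<Longrightarrow> \<bar>d k t\<bar> \<le> M k" and M: "M summable_on UNIV"
    and s: "\<And>t. \<bar>t\<bar> < T \<Longrightarrow> (\<lambda>k. e k t) summable_on UNIV" and t: "\<bar>t\<bar> < T"
  shows "((\<lambda>t. \<Sum>\<^sub>\<infinity>k. e k t) has_real_derivative (\<Sum>\<^sub>\<infinity>k. d k t)) (at t)"
proof -
  let ?S = "{-T<..<T}"
  have S: "x \<in> ?S \<longleftrightarrow> \<bar>x\<bar> < T" for x by auto
  have nat: "(\<lambda>n. f (int_decode n)) sums infsum f UNIV" if "f summable_on UNIV" for f :: "int \<Rightarrow> real"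
  proof -
    have "((\<lambda>n. f (int_decode n)) has_sum infsum f UNIV) UNIV"
      using has_sum_reindex_bij_betw[OF bij_int_decode, of f "infsum f UNIV"] that by simp
    then show ?thesis by (rule has_sum_imp_sums)
  qed
  have ds: "(\<lambda>k. d k x) summable_on UNIV" if "\<bar>x\<bar> < T" for x
  proof -
    have "(\<lambda>k. norm (d k x)) summable_on UNIV"
      by (rule Infinite_Sum.abs_summable_on_comparison_test'[OF M]) (use d that in auto)
    then show ?thesis by (rule abs_summable_summable)
  qed
  have "((\<lambda>x. \<Sum>n. e (int_decode n) x) has_real_derivative (\<Sum>n. d (int_decode n) t)) (at t)"
  proof (rule has_field_derivative_series'(2)[of ?S _ _ t])
    show "uniformly_convergent_on ?S (\<lambda>n x. \<Sum>i<n. d (int_decode i) x)"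
      by (rule Weierstrass_m_test'[where M = "\<lambda>n. M (int_decode n)"])
         (use d sums_summable[OF nat[OF M]] in \<open>auto simp: S\<close>)
    show "\<And>n x. x \<in> ?S \<Longrightarrow> (e (int_decode n) has_real_derivative d (int_decode n) x) (at x within ?S)"
      by (rule has_field_derivative_at_within) (use e in \<open>auto simp: S\<close>)
    show "summable (\<lambda>n. e (int_decode n) t)" using sums_summable[OF nat[OF s[OF t]]] .
    show "t \<in> interior ?S" using t by auto
  qed (use t in auto)
  moreover have "(\<Sum>n. d (int_decode n) t) = (\<Sum>\<^sub>\<infinity>k. d k t)"
    using nat[OF ds[OF t]] by (simp add: sums_iff)
  ultimately have 1: "((\<lambda>x. \<Sum>n. e (int_decode n) x) has_real_derivative (\<Sum>\<^sub>\<infinity>k. d k t)) (at t)" by simp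
  show ?thesis
    by (rule has_field_derivative_transform_within_open[OF 1, of ?S])
       (use t nat[OF s] in \<open>auto simp: sums_iff\<close>)
qed

text \<open>A bound on |D| makes exp(-C t) E nonincreasing and exp(C t) E nondecreasing; the second
  statement covers times before \<open>t\<close>.\<close>

lemma gronwall_two_sided:
  fixes E :: "real \<Rightarrow> real"
  assumes d: "\<And>t. \<bar>t\<bar> < T \<Longrightarrow> (E has_real_derivative D t) (at t)"
    and b: "\<And>t. \<bar>t\<bar> < T \<Longrightarrow> \<bar>D t\<bar> \<le> C * E t"
    and t: "\<bar>t\<bar> < T" "\<bar>t'\<bar> < T"
  shows "E t' \<le> exp (C * \<bar>t' - t\<bar>) * E t"
proof -
  have e: "exp (c * x) * (exp (- c * x) * z) = z" "exp (c * x) * (exp (- c * y) * z) = exp (c * (x - y)) * z"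
     "exp (- c * x) * (exp (c * x) * z) = z" "exp (- c * x) * (exp (c * y) * z) = exp (c * (y - x)) * z" for c x y z :: real
    by (simp_all add: exp_minus exp_diff right_diff_distrib divide_inverse)
  show ?thesis
  proof (cases "t \<le> t'")
    case True
    have "exp (- C * t') * E t' \<le> exp (- C * t) * E t"
    proof (rule DERIV_nonpos_imp_nonincreasing[OF True])
      fix x assume x: "t \<le> x" "x \<le> t'"
      then have xT: "\<bar>x\<bar> < T" using t by linarith
      have "((\<lambda>x. exp (- C * x) * E x) has_real_derivative (exp (- C * x) * (D x - C * E x))) (at x)"
        by (auto intro!: derivative_eq_intros d[OF xT] simp: algebra_simps)
      moreover have "exp (- C * x) * (D x - C * E x) \<le> 0"
        using b[OF xT] by (intro mult_nonneg_nonpos) auto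
      ultimately show "\<exists>y. ((\<lambda>x. exp (- C * x) * E x) has_real_derivative y) (at x) \<and> y \<le> 0" by blast
    qed
    then have "exp (C * t') * (exp (- C * t') * E t') \<le> exp (C * t') * (exp (- C * t) * E t)"
      by (rule mult_left_mono) simp
    then show ?thesis using True unfolding e by simp
  next
    case False
    then have le: "t' \<le> t" by simp
    have "exp (C * t') * E t' \<le> exp (C * t) * E t"
    proof (rule DERIV_nonneg_imp_nondecreasing[OF le])
      fix x assume x: "t' \<le> x" "x \<le> t"
      then have xT: "\<bar>x\<bar> < T" using t by linarith
      have "((\<lambda>x. exp (C * x) * E x) has_real_derivative (exp (C * x) * (D x + C * E x))) (at x)"
        by (auto intro!: derivative_eq_intros d[OF xT] simp: algebra_simps)
      moreover have "exp (C * x) * (D x + C * E x) \<ge> 0"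
        using b[OF xT] by (intro mult_nonneg_nonneg) auto
      ultimately show "\<exists>y. ((\<lambda>x. exp (C * x) * E x) has_real_derivative y) (at x) \<and> y \<ge> 0" by blast
    qed
    then have "exp (- C * t') * (exp (C * t') * E t') \<le> exp (- C * t') * (exp (C * t) * E t)"
      by (rule mult_left_mono) simp
    then show ?thesis using False unfolding e by simp
  qed
qed

lemma norm_sq_has_derivative:
  assumes "(f has_vector_derivative f') (at t)"
  shows "((\<lambda>t. (cmod (f t))\<^sup>2) has_real_derivative 2 * Re (cnj (f t) * f')) (at t)"
proof -
  have "((\<lambda>t. (R t)\<^sup>2 + (I t)\<^sup>2) has_real_derivative 2 * (R t * R' + I t * I')) (at t)"
    if "(R has_real_derivative R') (at t)" "(I has_real_derivative I') (at t)" for R I R' I'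
    using that by (auto intro!: derivative_eq_intros simp: algebra_simps)
  from this[of "\<lambda>t. Re (f t)" "Re f'" "\<lambda>t. Im (f t)" "Im f'"]
  have "((\<lambda>t. (Re (f t))\<^sup>2 + (Im (f t))\<^sup>2) has_real_derivative 2 * Re (cnj (f t) * f')) (at t)"
    using assms by (simp add: has_vector_derivative_complex_iff)
  then show ?thesis by (simp add: cmod_power2)
qed

section \<open>Absolutely summable coefficients and the energy of the coefficient equation\<close>

lemma abs_summable_of_weighted:
  fixes a :: "int \<Rightarrow> complex"
  assumes "(\<lambda>k. \<bar>of_int k\<bar> * norm (a k)) summable_on UNIV"
  shows "(\<lambda>k. norm (a k)) summable_on UNIV"
proof (rule summable_on_comparison_test)
  \<comment> \<open>The weight |k| vanishes at 0, so that term is added to the majorant by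
    hand.\<close>
  show "(\<lambda>k. \<bar>of_int k\<bar> * norm (a k) + (if k = 0 then norm (a 0) else 0)) summable_on UNIV"
    by (intro summable_on_add assms finite_nonzero_values_imp_summable_on) auto
  fix k :: int
  show "norm (a k) \<le> \<bar>of_int k\<bar> * norm (a k) + (if k = 0 then norm (a 0) else 0)"
  proof (cases "k = 0")
    case False
    then have "1 \<le> \<bar>real_of_int k\<bar>" by linarith
    then show ?thesis using mult_right_mono[of 1 "\<bar>real_of_int k\<bar>" "norm (a k)"] False by simp
  qed simp
qed simp

lemma conv_summable:
  fixes a b :: "int \<Rightarrow> complex"
  assumes a: "(\<lambda>k. norm (a k)) summable_on UNIV" and b: "\<And>k. norm (b k) \<le> s"
  shows "(\<lambda>l. norm (a l * b (k - l))) summable_on UNIV"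
  by (rule Infinite_Sum.abs_summable_on_comparison_test'[OF summable_on_cmult_left[OF a, of s]])
     (auto simp: norm_mult intro!: mult_left_mono b)

text \<open>The Leibniz rule on the Fourier side: |k| is at most |l| + |k - l|.\<close>

lemma conv_derivative_bound:
  fixes a b :: "int \<Rightarrow> complex"
  assumes A: "(\<lambda>k. \<bar>of_int k\<bar> * norm (a k)) summable_on UNIV" and B: "(\<lambda>k. \<bar>of_int k\<bar> * norm (b k)) summable_on UNIV"
    and a: "\<And>k. norm (a k) \<le> s" and b: "\<And>k. norm (b k) \<le> r"
  shows "\<bar>of_int k\<bar> * norm (conv a b k) \<le>
     (\<Sum>\<^sub>\<infinity>k. \<bar>of_int k\<bar> * norm (a k)) * r + s * (\<Sum>\<^sub>\<infinity>k. \<bar>of_int k\<bar> * norm (b k))"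
proof -
  have as: "(\<lambda>k. norm (a k)) summable_on UNIV" by (rule abs_summable_of_weighted[OF A])
  have s0: "s \<ge> 0" using a[of 0] norm_ge_zero order_trans by blast
  have 1: "((\<lambda>l. of_int k * (a l * b (k - l))) has_sum (of_int k * conv a b k)) UNIV"
    unfolding conv_def
    by (intro has_sum_cmult_right has_sum_infsum abs_summable_summable[OF conv_summable[OF as b]])
  have "bij (\<lambda>l. k - l)" by (rule bij_betw_byWitness[where f' = "\<lambda>l. k - l"]) auto
  then have "((\<lambda>l. \<bar>of_int (k - l)\<bar> * norm (b (k - l))) has_sum (\<Sum>\<^sub>\<infinity>k. \<bar>of_int k\<bar> * norm (b k))) UNIV"
    using has_sum_reindex_bij_betw[of "\<lambda>l. k - l" UNIV UNIV "\<lambda>l. \<bar>of_int l\<bar> * norm (b l)"] B by simp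
  then have 2: "((\<lambda>l. \<bar>of_int l\<bar> * norm (a l) * r + s * (\<bar>of_int (k - l)\<bar> * norm (b (k - l)))) has_sum
     ((\<Sum>\<^sub>\<infinity>k. \<bar>of_int k\<bar> * norm (a k)) * r + s * (\<Sum>\<^sub>\<infinity>k. \<bar>of_int k\<bar> * norm (b k)))) UNIV"
    by (intro has_sum_add has_sum_cmult_left has_sum_cmult_right has_sum_infsum A)
  have "norm (of_int k * conv a b k) \<le> (\<Sum>\<^sub>\<infinity>k. \<bar>of_int k\<bar> * norm (a k)) * r + s * (\<Sum>\<^sub>\<infinity>k. \<bar>of_int k\<bar> * norm (b k))"
  proof (rule norm_infsum_le[OF 1 2])
    fix l
    have "norm (of_int k * (a l * b (k - l))) = \<bar>of_int k\<bar> * (norm (a l) * norm (b (k - l)))"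
      by (simp add: norm_mult)
    also have "\<dots> \<le> (\<bar>of_int l\<bar> + \<bar>of_int (k - l)\<bar>) * (norm (a l) * norm (b (k - l)))"
      by (intro mult_right_mono) auto
    also have "\<dots> = (\<bar>of_int l\<bar> * norm (a l)) * norm (b (k - l)) + norm (a l) * (\<bar>of_int (k - l)\<bar> * norm (b (k - l)))"
      by (simp add: algebra_simps)
    also have "\<dots> \<le> (\<bar>of_int l\<bar> * norm (a l)) * r + s * (\<bar>of_int (k - l)\<bar> * norm (b (k - l)))"
      by (intro add_mono mult_left_mono mult_right_mono a b) auto
    finally show "norm (of_int k * (a l * b (k - l))) \<le> \<bar>of_int l\<bar> * norm (a l) * r + s * (\<bar>of_int (k - l)\<bar> * norm (b (k - l)))" .
  qed
  then show ?thesis by (simp add: norm_mult)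
qed

text \<open>The weighted sum is what enters the Gronwall constants. The quadratic decay supplies a
  summable majorant, so that energies may be differentiated term by term.\<close>

definition seq_bound :: "real \<Rightarrow> (int \<Rightarrow> complex) \<Rightarrow> bool" where
  "seq_bound M a \<longleftrightarrow> (\<lambda>k. \<bar>of_int k\<bar> * norm (a k)) summable_on UNIV \<and>
     (\<Sum>\<^sub>\<infinity>k. \<bar>of_int k\<bar> * norm (a k)) \<le> M \<and> (\<forall>k. norm (a k) * (1 + (of_int k)\<^sup>2) \<le> M)"

text \<open>The transport term is written as -(u^2)_x / 2. The symbol \<open>g\<close> of the
  nonlocal term is kept abstract; that it is real is all the energy estimates require of it.\<close>

definition muDP_rhs :: "(int \<Rightarrow> real) \<Rightarrow> (int \<Rightarrow> complex) \<Rightarrow> int \<Rightarrow> complex" where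
  "muDP_rhs g a k = - (dsym k / 2) * conv a a k - \<i> * of_real (g k) * a k"

definition muDP_seq :: "(int \<Rightarrow> real) \<Rightarrow> (real \<Rightarrow> int \<Rightarrow> complex) \<Rightarrow> bool" where
  "muDP_seq g a \<longleftrightarrow> (\<forall>t k. a t (- k) = cnj (a t k)) \<and>
     (\<forall>t k. ((\<lambda>t. a t k) has_vector_derivative muDP_rhs g (a t) k) (at t)) \<and>
     (\<forall>T. \<exists>M. \<forall>t. \<bar>t\<bar> < T \<longrightarrow> seq_bound M (a t))"

lemma seq_boundD:
  assumes "seq_bound M a"
  shows "(\<lambda>k. \<bar>of_int k\<bar> * norm (a k)) summable_on UNIV" "(\<Sum>\<^sub>\<infinity>k. \<bar>of_int k\<bar> * norm (a k)) \<le> M"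
    "norm (a k) \<le> M" "norm (a k) \<le> M / (1 + (of_int k)\<^sup>2)" "M \<ge> 0"
    "(\<lambda>k. norm (a k)) summable_on UNIV"
    "\<bar>of_int k\<bar> * norm (conv a a k) \<le> 2 * M * M"
    "(norm (a k))\<^sup>2 \<le> M * M * (1 / (1 + (of_int k)\<^sup>2))"
proof -
  have p: "1 + (real_of_int k)\<^sup>2 > 0" for k by (simp add: add_pos_nonneg)
  have b: "norm (a k) * (1 + (of_int k)\<^sup>2) \<le> M" for k using assms by (simp add: seq_bound_def)
  show 1: "(\<lambda>k. \<bar>of_int k\<bar> * norm (a k)) summable_on UNIV" and 2: "(\<Sum>\<^sub>\<infinity>k. \<bar>of_int k\<bar> * norm (a k)) \<le> M"
    using assms by (auto simp: seq_bound_def)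
  show 4: "norm (a k) \<le> M / (1 + (of_int k)\<^sup>2)" for k using b p[of k] by (simp add: field_simps)
  show "M \<ge> 0" using b[of 0] norm_ge_zero[of "a 0"] by (simp del: norm_ge_zero)
  note M0 = this
  show 3: "norm (a k) \<le> M" for k
  proof -
    have "norm (a k) * 1 \<le> norm (a k) * (1 + (of_int k)\<^sup>2)" by (intro mult_left_mono) auto
    then show ?thesis using b[of k] by linarith
  qed
  show "(\<lambda>k. norm (a k)) summable_on UNIV" by (rule abs_summable_of_weighted[OF 1])
  have "\<bar>of_int k\<bar> * norm (conv a a k) \<le> (\<Sum>\<^sub>\<infinity>k. \<bar>of_int k\<bar> * norm (a k)) * M + M * (\<Sum>\<^sub>\<infinity>k. \<bar>of_int k\<bar> * norm (a k))"
    by (rule conv_derivative_bound[OF 1 1 3 3])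
  also have "\<dots> \<le> M * M + M * M" by (intro add_mono mult_left_mono mult_right_mono 2 M0)
  finally show "\<bar>of_int k\<bar> * norm (conv a a k) \<le> 2 * M * M" by simp
  have "(norm (a k))\<^sup>2 \<le> M * (M / (1 + (of_int k)\<^sup>2))"
    unfolding power2_eq_square[of "norm (a k)"] by (intro mult_mono 3 4 M0) auto
  then show "(norm (a k))\<^sup>2 \<le> M * M * (1 / (1 + (of_int k)\<^sup>2))" by simp
qed

lemma summable_seq_bound_sq:
  assumes "seq_bound M a" "\<And>k. 0 \<le> W k" "\<And>k. W k \<le> N"
  shows "(\<lambda>k. W k * (norm (a k))\<^sup>2) summable_on UNIV"
proof (rule summable_on_comparison_test[OF summable_on_cmult_right[OF summable_inverse_squares, of "N * (M * M)"]])
  fix k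
  have "W k * (norm (a k))\<^sup>2 \<le> N * (M * M * (1 / (1 + (of_int k)\<^sup>2)))"
    using assms order_trans[OF assms(2,3)] by (intro mult_mono seq_boundD(8)) auto
  then show "W k * (norm (a k))\<^sup>2 \<le> N * (M * M) * (1 / (1 + (of_int k)\<^sup>2))" by simp
qed (use assms in auto)

lemma muDP_energy:
  assumes seq: "muDP_seq g a" and W: "good_weight K D W" and Wb: "\<And>k. W k \<le> N"
    and M: "\<And>t. \<bar>t\<bar> < T \<Longrightarrow> seq_bound M (a t)" and t: "\<bar>t\<bar> < T" "\<bar>t'\<bar> < T"
  shows "(\<Sum>\<^sub>\<infinity>k. W k * (norm (a t' k))\<^sup>2) \<le> exp (2 * pi * (((1 + K) * D + 1) * M) * \<bar>t' - t\<bar>) * (\<Sum>\<^sub>\<infinity>k. W k * (norm (a t k))\<^sup>2)"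
proof -
  note gw = good_weightD[OF W]
  let ?C = "(1 + K) * D + 1"
  have C: "?C \<ge> 0" using gw(1,2) by (intro add_nonneg_nonneg mult_nonneg_nonneg) auto
  define d where "d k t = W k * (2 * Re (cnj (a t k) * muDP_rhs g (a t) k))" for k t
  have d_eq: "d k t = - W k * Re (dsym k * cnj (a t k) * conv (a t) (a t) k)" for k t
  proof -
    \<comment> \<open>\<open>g k\<close> is real, so the nonlocal term only rotates
      \<open>a t k\<close> and does not change its modulus.\<close>
    have "Re (cnj (a t k) * (\<i> * of_real (g k) * a t k)) = 0" by (simp add: algebra_simps)
    then have "2 * Re (cnj (a t k) * muDP_rhs g (a t) k) = - Re (dsym k * cnj (a t k) * conv (a t) (a t) k)"
      unfolding muDP_rhs_def right_diff_distrib by (simp add: field_simps)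
    then show ?thesis unfolding d_def by (simp only: mult_minus_left mult_minus_right)
  qed
  have N: "N \<ge> 0" using gw(3) Wb order_trans by blast
  have der: "((\<lambda>t. W k * (norm (a t k))\<^sup>2) has_real_derivative d k t) (at t)" for k t
    unfolding d_def using seq
    by (intro DERIV_cmult norm_sq_has_derivative) (simp add: muDP_seq_def)
  \<comment> \<open>This majorant depends on \<open>N\<close> but serves only to differentiate the
    sum. The rate of growth comes from \<open>EB\<close>, whose constant is free of
    \<open>N\<close>.\<close>
  have db: "\<bar>d k t\<bar> \<le> N * (2 * pi * (2 * M * M)) * M * (1 / (1 + (of_int k)\<^sup>2))" if "\<bar>t\<bar> < T" for k t
  proof -
    note b = seq_boundD[OF M[OF that]]
    have "\<bar>d k t\<bar> \<le> W k * norm (dsym k * cnj (a t k) * conv (a t) (a t) k)"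
    proof -
      have "\<bar>- w * Re z\<bar> \<le> w * norm z" if "w \<ge> 0" for w z
        using that abs_Re_le_cmod[of z] by (simp add: abs_mult mult_left_mono)
      then show ?thesis unfolding d_eq using gw(3) by blast
    qed
    also have "\<dots> = W k * (2 * pi * (\<bar>of_int k\<bar> * norm (conv (a t) (a t) k)) * norm (a t k))"
      by (simp add: norm_mult norm_dsym)
    also have "\<dots> \<le> N * (2 * pi * (2 * M * M) * (M / (1 + (of_int k)\<^sup>2)))"
      using b(5) gw(3) by (intro mult_mono Wb b(4) b(7) mult_nonneg_nonneg N) auto
    finally show ?thesis by simp
  qed
  have sm: "(\<lambda>k. W k * (norm (a t k))\<^sup>2) summable_on UNIV" if "\<bar>t\<bar> < T" for t
    by (rule summable_seq_bound_sq[OF M[OF that] gw(3) Wb])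
  have E: "((\<lambda>t. \<Sum>\<^sub>\<infinity>k. W k * (norm (a t k))\<^sup>2) has_real_derivative (\<Sum>\<^sub>\<infinity>k. d k t)) (at t)" if "\<bar>t\<bar> < T" for t
    by (rule has_real_derivative_infsum_int[OF der db summable_on_cmult_right[OF summable_inverse_squares] sm that])
  have EB: "\<bar>\<Sum>\<^sub>\<infinity>k. d k t\<bar> \<le> 2 * pi * (?C * M) * (\<Sum>\<^sub>\<infinity>k. W k * (norm (a t k))\<^sup>2)" if tT: "\<bar>t\<bar> < T" for t
  proof -
    note b = seq_boundD[OF M[OF that]]
    have sy: "a t (- k) = cnj (a t k)" for k using seq by (simp add: muDP_seq_def)
    obtain X where X: "((\<lambda>k. of_int k * of_real (W k) * cnj (a t k) * conv (a t) (a t) k) has_sum X) UNIV"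
      "norm X \<le> ?C * (\<Sum>\<^sub>\<infinity>k. \<bar>of_int k\<bar> * norm (a t k)) * (\<Sum>\<^sub>\<infinity>k. W k * (norm (a t k))\<^sup>2)"
      using trilinear_estimate[OF W Wb sy b(1) b(6) sm[OF tT]] by blast
    have "((\<lambda>k. Re (- (2 * of_real pi * \<i>) * (of_int k * of_real (W k) * cnj (a t k) * conv (a t) (a t) k))) has_sum Re (- (2 * of_real pi * \<i>) * X)) UNIV"
      by (intro has_sum_Re has_sum_cmult_right X(1))
    moreover have "Re (- (2 * of_real pi * \<i>) * (of_int k * of_real (W k) * cnj (a t k) * conv (a t) (a t) k)) = d k t" for k
      unfolding d_eq dsym_def by (simp add: algebra_simps)
    ultimately have "((\<lambda>k. d k t) has_sum Re (- (2 * of_real pi * \<i>) * X)) UNIV" by simp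
    then have "(\<Sum>\<^sub>\<infinity>k. d k t) = Re (- (2 * of_real pi * \<i>) * X)" by (rule infsumI)
    then have "\<bar>\<Sum>\<^sub>\<infinity>k. d k t\<bar> \<le> norm (- (2 * of_real pi * \<i>) * X)" by (simp only: abs_Re_le_cmod)
    also have "\<dots> = 2 * pi * norm X" by (simp add: norm_mult)
    also have "\<dots> \<le> 2 * pi * (?C * (\<Sum>\<^sub>\<infinity>k. \<bar>of_int k\<bar> * norm (a t k)) * (\<Sum>\<^sub>\<infinity>k. W k * (norm (a t k))\<^sup>2))"
      by (intro mult_left_mono X(2)) simp
    also have "\<dots> \<le> 2 * pi * (?C * M * (\<Sum>\<^sub>\<infinity>k. W k * (norm (a t k))\<^sup>2))"
      using C gw(3) by (intro mult_left_mono mult_right_mono b(2) infsum_nonneg) auto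
    finally show ?thesis by simp
  qed
  show ?thesis by (rule gronwall_two_sided[OF E EB t])
qed

subsection \<open>Sobolev weights\<close>

lemma sob_weight_ge_1: "s \<ge> 0 \<Longrightarrow> sob_weight s k \<ge> 1"
  unfolding sob_weight_def by (rule ge_one_powr_ge_zero) auto

lemma sob_weight_pos: "sob_weight s k > 0"
proof -
  have "1 + (2 * pi * real_of_int k)\<^sup>2 > 0" by (rule add_pos_nonneg) auto
  then show ?thesis by (simp add: sob_weight_def)
qed

lemma sob_weight_even: "sob_weight s (- k) = sob_weight s k"
  by (simp add: sob_weight_def)

lemma sob_weight_mono:
  assumes "s \<ge> 0" "\<bar>j\<bar> \<le> \<bar>k\<bar>"
  shows "sob_weight s j \<le> sob_weight s k"
proof -
  have "\<bar>2 * pi * real_of_int j\<bar> \<le> \<bar>2 * pi * real_of_int k\<bar>" using assms(2) by (simp add: abs_mult)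
  then have "(2 * pi * real_of_int j)\<^sup>2 \<le> (2 * pi * real_of_int k)\<^sup>2" by (rule abs_le_square_iff[THEN iffD1])
  then show ?thesis unfolding sob_weight_def using assms(1) by (intro powr_mono2) auto
qed

lemma sob_weight_doubling:
  assumes "s \<ge> 0" "\<bar>x\<bar> \<le> 2 * \<bar>y\<bar>"
  shows "sob_weight s x \<le> 4 powr s * sob_weight s y"
proof -
  have "\<bar>2 * pi * real_of_int x\<bar> \<le> \<bar>2 * (2 * pi * real_of_int y)\<bar>" using assms(2) by (simp add: abs_mult)
  then have "(2 * pi * real_of_int x)\<^sup>2 \<le> (2 * (2 * pi * real_of_int y))\<^sup>2" by (rule abs_le_square_iff[THEN iffD1])
  also have "\<dots> = 4 * (2 * pi * real_of_int y)\<^sup>2" by (simp add: power_mult_distrib)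
  finally have "1 + (2 * pi * real_of_int x)\<^sup>2 \<le> 4 * (1 + (2 * pi * real_of_int y)\<^sup>2)"
    unfolding distrib_left by (intro add_mono) auto
  then have "sob_weight s x \<le> (4 * (1 + (2 * pi * real_of_int y)\<^sup>2)) powr s"
    unfolding sob_weight_def using assms(1) by (intro powr_mono2) auto
  also have "\<dots> = 4 powr s * sob_weight s y"
    unfolding sob_weight_def by (rule powr_mult)
  finally show ?thesis .
qed

text \<open>With A >= B the bases of the two powers, exp z >= 1 + z and ln z <= z - 1 give 1 -
  (B/A)^s <= s (A - B) / B. The difference A - B contains the factor X + Y, which is at most 3 Y
  since X <= 2 Y: hence the constant 3 s.\<close>

lemma sob_weight_slow:
  assumes s: "s \<ge> 0" and xy: "\<bar>y\<bar> \<le> \<bar>x\<bar>" "\<bar>x\<bar> \<le> 2 * \<bar>y\<bar>"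
  shows "\<bar>of_int y\<bar> * (sob_weight s x - sob_weight s y) \<le> (3 * s) * \<bar>of_int (x - y)\<bar> * sob_weight s x"
proof (cases "y = 0")
  case True
  then show ?thesis using s sob_weight_pos[of s x] by (simp add: less_imp_le)
next
  case False
  define X Y where "X = \<bar>real_of_int x\<bar>" and "Y = \<bar>real_of_int y\<bar>"
  have XY: "Y > 0" "Y \<le> X" "X \<le> 2 * Y" using False xy unfolding X_def Y_def by linarith+
  define A B where "A = 1 + (2 * pi * real_of_int x)\<^sup>2" and "B = 1 + (2 * pi * real_of_int y)\<^sup>2"
  have AX: "A = 1 + 4 * pi\<^sup>2 * X\<^sup>2" and BY: "B = 1 + 4 * pi\<^sup>2 * Y\<^sup>2"
    by (auto simp: A_def B_def X_def Y_def power_mult_distrib)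
  have AB: "B > 0" "A > 0" "B \<le> A"
  proof -
    show "B > 0" "A > 0" unfolding A_def B_def by (rule add_pos_nonneg; simp)+
    have "4 * pi\<^sup>2 * Y\<^sup>2 \<le> 4 * pi\<^sup>2 * X\<^sup>2" using XY by (intro mult_left_mono power_mono) auto
    then show "B \<le> A" by (simp add: AX BY)
  qed
  have W: "sob_weight s x = A powr s" "sob_weight s y = B powr s"
    by (auto simp: sob_weight_def A_def B_def)
  have "(B / A) powr s \<ge> 1 + s * ln (B / A)"
    using exp_ge_add_one_self[of "s * ln (B / A)"] AB by (simp add: powr_def)
  moreover have "ln (B / A) \<ge> - ((A - B) / B)"
  proof -
    have "ln (A / B) \<le> A / B - 1" by (rule ln_le_minus_one) (use AB in simp)
    moreover have "ln (B / A) = - ln (A / B)" using AB by (simp add: ln_div)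
    moreover have "A / B - 1 = (A - B) / B" using AB by (simp add: field_simps)
    ultimately show ?thesis by linarith
  qed
  then have "s * ln (B / A) \<ge> s * (- ((A - B) / B))" using s by (rule mult_left_mono)
  ultimately have 1: "1 - (B / A) powr s \<le> s * ((A - B) / B)" by simp
  have "Y * ((A - B) / B) \<le> 3 * (X - Y)"
  proof -
    have "Y * (A - B) = 4 * pi\<^sup>2 * Y * (X + Y) * (X - Y)" by (simp add: AX BY power2_eq_square algebra_simps)
    also have "\<dots> \<le> 4 * pi\<^sup>2 * Y * (3 * Y) * (X - Y)"
      using XY by (intro mult_left_mono mult_right_mono) auto
    also have "\<dots> = 3 * (X - Y) * (4 * pi\<^sup>2 * Y\<^sup>2)" by (simp add: power2_eq_square)
    also have "\<dots> \<le> 3 * (X - Y) * B" using XY by (intro mult_left_mono) (auto simp: BY)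
    finally show ?thesis using AB by (simp add: field_simps)
  qed
  then have 2: "s * (Y * ((A - B) / B)) \<le> s * (3 * (X - Y))" using s by (rule mult_left_mono)
  have "Y * (A powr s - B powr s) = Y * (1 - (B / A) powr s) * A powr s"
    using AB by (simp add: powr_divide field_simps)
  also have "\<dots> \<le> Y * (s * ((A - B) / B)) * A powr s"
    using 1 XY by (intro mult_right_mono mult_left_mono) auto
  also have "\<dots> \<le> s * (3 * (X - Y)) * A powr s"
    using 2 by (intro mult_right_mono) (auto simp: ac_simps)
  also have "\<dots> \<le> s * (3 * \<bar>of_int (x - y)\<bar>) * A powr s"
    using s by (intro mult_right_mono mult_left_mono) (auto simp: X_def Y_def)
  finally show ?thesis by (simp add: W Y_def ac_simps)
qed

text \<open>The constants 3 s and 4^s are those of the unclipped weight and do not involve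
  \<open>N\<close>; this makes the energy estimate uniform in the clipping level.\<close>

lemma good_weight_clipped:
  assumes s: "s \<ge> 0" and N: "N > 0"
  shows "good_weight (3 * s) (4 powr s) (\<lambda>k. min (sob_weight s k) N)"
proof -
  have D: "4 powr s \<ge> (1::real)" using s by (rule ge_one_powr_ge_zero[rotated]) simp
  show ?thesis unfolding good_weight_def
  proof (intro conjI allI impI)
    fix k show "0 \<le> min (sob_weight s k) N" using sob_weight_pos[of s k] N by simp
  next
    fix k show "min (sob_weight s (- k)) N = min (sob_weight s k) N" by (simp add: sob_weight_even)
  next
    fix j k :: int assume "\<bar>j\<bar> \<le> \<bar>k\<bar>"
    then show "min (sob_weight s j) N \<le> min (sob_weight s k) N" using sob_weight_mono[OF s, of j k] by simp
  next
    fix x y :: int assume "\<bar>x\<bar> \<le> 2 * \<bar>y\<bar>"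
    then have "sob_weight s x \<le> 4 powr s * sob_weight s y" by (rule sob_weight_doubling[OF s])
    moreover have "N \<le> 4 powr s * N" using D N by simp
    ultimately show "min (sob_weight s x) N \<le> 4 powr s * min (sob_weight s y) N"
      by (auto simp: min_def)
  next
    fix x y :: int assume xy: "\<bar>y\<bar> \<le> \<bar>x\<bar>" "\<bar>x\<bar> \<le> 2 * \<bar>y\<bar>"
    define p q where "p = sob_weight s x" and "q = sob_weight s y"
    have pq: "q \<le> p" "p > 0" "q > 0" unfolding p_def q_def using sob_weight_mono[OF s xy(1)] sob_weight_pos by auto
    \<comment> \<open>Clipping does not increase the relative variation: this is (min p N - min q N)
      / min p N <= (p - q) / p, multiplied out.\<close>
    have 1: "(min p N - min q N) * p \<le> (p - q) * min p N"
    proof -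
      consider "p \<le> N" | "N \<le> q" | "q < N" "N < p" by linarith
      then show ?thesis
      proof cases
        case 3
        then have "q * N \<le> q * p" using pq by (intro mult_left_mono) auto
        then show ?thesis using 3 by (simp add: min_def algebra_simps)
      qed (use pq N in \<open>auto simp: min_def\<close>)
    qed
    have "(\<bar>of_int y\<bar> * (min p N - min q N)) * p = \<bar>of_int y\<bar> * ((min p N - min q N) * p)" by simp
    also have "\<dots> \<le> \<bar>of_int y\<bar> * ((p - q) * min p N)" using 1 by (intro mult_left_mono) auto
    also have "\<dots> = (\<bar>of_int y\<bar> * (p - q)) * min p N" by simp
    also have "\<dots> \<le> ((3 * s) * \<bar>of_int (x - y)\<bar> * p) * min p N"
      using sob_weight_slow[OF s xy] pq N unfolding p_def q_def by (intro mult_right_mono) auto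
    finally have "(\<bar>of_int y\<bar> * (min p N - min q N)) * p \<le> (3 * s * \<bar>of_int (x - y)\<bar> * min p N) * p"
      by (simp add: ac_simps)
    then show "\<bar>of_int y\<bar> * (min (sob_weight s x) N - min (sob_weight s y) N)
       \<le> 3 * s * \<bar>of_int (x - y)\<bar> * min (sob_weight s x) N"
      using pq by (simp add: p_def q_def)
  qed (use s D in auto)
qed

definition hsum :: "real \<Rightarrow> (int \<Rightarrow> complex) \<Rightarrow> bool" where
  "hsum s a \<longleftrightarrow> (\<lambda>k. sob_weight s k * (norm (a k))\<^sup>2) summable_on UNIV"

definition hs2 :: "real \<Rightarrow> (int \<Rightarrow> complex) \<Rightarrow> real" where
  "hs2 s a = (\<Sum>\<^sub>\<infinity>k. sob_weight s k * (norm (a k))\<^sup>2)"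

lemma hs2_nonneg: "hs2 s a \<ge> 0"
  unfolding hs2_def by (intro infsum_nonneg) (simp add: sob_weight_pos less_imp_le)

lemma muDP_persistence:
  assumes seq: "muDP_seq g a" and s: "s \<ge> 0" and h: "hsum s (a t0)"
  shows "hsum s (a t)"
    and "\<exists>C. \<forall>t t'. \<bar>t\<bar> < T \<longrightarrow> \<bar>t'\<bar> < T \<longrightarrow> hs2 s (a t') \<le> exp (C * \<bar>t' - t\<bar>) * hs2 s (a t)"
proof -
  have key: "hsum s (a t') \<and> hs2 s (a t') \<le> exp (2 * pi * (((1 + 3 * s) * 4 powr s + 1) * M) * \<bar>t' - t\<bar>) * hs2 s (a t)"
    if M: "\<And>t. \<bar>t\<bar> < T \<Longrightarrow> seq_bound M (a t)" and t: "\<bar>t\<bar> < T" "\<bar>t'\<bar> < T" and h: "hsum s (a t)"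
    for T M t t'
  proof -
    let ?R = "exp (2 * pi * (((1 + 3 * s) * 4 powr s + 1) * M) * \<bar>t' - t\<bar>) * hs2 s (a t)"
    have fin: "(\<Sum>k\<in>F. sob_weight s k * (norm (a t' k))\<^sup>2) \<le> ?R" if F: "finite F" for F
    proof -
      \<comment> \<open>Clipping above every weight that occurs on \<open>F\<close> leaves this
        partial sum unchanged. The 1 keeps \<open>N\<close> positive when \<open>F\<close> is
        empty.\<close>
      define N where "N = Max (insert 1 (sob_weight s ` F))"
      have N: "N > 0" "\<And>k. k \<in> F \<Longrightarrow> sob_weight s k \<le> N"
      proof -
        have "1 \<le> N" unfolding N_def by (rule Max_ge) (use F in auto)
        then show "N > 0" by simp
        show "\<And>k. k \<in> F \<Longrightarrow> sob_weight s k \<le> N" unfolding N_def by (rule Max_ge) (use F in auto)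
      qed
      let ?W = "\<lambda>k. min (sob_weight s k) N"
      have W0: "?W k \<ge> 0" for k using N(1) sob_weight_pos[of s k] by simp
      note gw = good_weight_clipped[OF s N(1)]
      have "(\<Sum>k\<in>F. sob_weight s k * (norm (a t' k))\<^sup>2) = (\<Sum>k\<in>F. ?W k * (norm (a t' k))\<^sup>2)"
        using N(2) by (intro sum.cong) (auto simp: min_def)
      also have "\<dots> \<le> (\<Sum>\<^sub>\<infinity>k. ?W k * (norm (a t' k))\<^sup>2)"
        by (intro finite_sum_le_infsum summable_seq_bound_sq[OF M[OF t(2)], of _ N] F) (use W0 in auto)
      also have "\<dots> \<le> exp (2 * pi * (((1 + 3 * s) * 4 powr s + 1) * M) * \<bar>t' - t\<bar>) * (\<Sum>\<^sub>\<infinity>k. ?W k * (norm (a t k))\<^sup>2)"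
        by (rule muDP_energy[OF seq gw, where N = N and T = T]) (use M t in auto)
      also have "\<dots> \<le> ?R"
        unfolding hs2_def
      proof (intro mult_left_mono infsum_mono mult_right_mono)
        show "(\<lambda>k. ?W k * (norm (a t k))\<^sup>2) summable_on UNIV"
          by (rule summable_seq_bound_sq[OF M[OF t(1)], of _ N]) (use W0 in auto)
        show "(\<lambda>k. sob_weight s k * (norm (a t k))\<^sup>2) summable_on UNIV" using h by (simp add: hsum_def)
      qed auto
      finally show ?thesis .
    qed
    have nn: "0 \<le> sob_weight s k * (norm (a t' k))\<^sup>2" for k by (simp add: sob_weight_pos less_imp_le)
    have sm: "hsum s (a t')" unfolding hsum_def
      by (rule nonneg_bdd_above_summable_on) (use nn fin in \<open>auto simp: bdd_above_def\<close>)
    moreover have "hs2 s (a t') \<le> ?R"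
      unfolding hs2_def[of s "a t'"] by (rule infsum_le_finite_sums) (use sm fin in \<open>auto simp: hsum_def\<close>)
    ultimately show ?thesis by blast
  qed
  show H: "hsum s (a t)" for t
  proof -
    obtain M where M: "\<And>\<tau>. \<bar>\<tau>\<bar> < \<bar>t\<bar> + \<bar>t0\<bar> + 1 \<Longrightarrow> seq_bound M (a \<tau>)"
      using seq unfolding muDP_seq_def by meson
    show ?thesis using key[of "\<bar>t\<bar> + \<bar>t0\<bar> + 1" M t0 t] M h by simp
  qed
  show "\<exists>C. \<forall>t t'. \<bar>t\<bar> < T \<longrightarrow> \<bar>t'\<bar> < T \<longrightarrow> hs2 s (a t') \<le> exp (C * \<bar>t' - t\<bar>) * hs2 s (a t)"
  proof -
    obtain M where M: "\<And>\<tau>. \<bar>\<tau>\<bar> < T \<Longrightarrow> seq_bound M (a \<tau>)"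
      using seq unfolding muDP_seq_def by meson
    show ?thesis using key[of T M] M H by blast
  qed
qed

subsection \<open>Weighted square-summable sequences\<close>

lemma sq_add_le: "(cmod (x + y))\<^sup>2 \<le> 2 * (cmod x)\<^sup>2 + 2 * (cmod y)\<^sup>2"
proof -
  have "(cmod (x + y))\<^sup>2 \<le> (cmod x + cmod y)\<^sup>2" by (intro power_mono norm_triangle_ineq) auto
  moreover have "0 \<le> (cmod x - cmod y)\<^sup>2" by simp
  ultimately show ?thesis by (simp add: power2_eq_square algebra_simps)
qed

lemma hsum_comparison:
  assumes "hsum s a" "\<And>k. sob_weight s' k * (norm (b k))\<^sup>2 \<le> C * (sob_weight s k * (norm (a k))\<^sup>2)"
  shows "hsum s' b" "hs2 s' b \<le> C * hs2 s a"
proof -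
  have C: "((\<lambda>k. C * (sob_weight s k * (norm (a k))\<^sup>2)) has_sum (C * hs2 s a)) UNIV"
    unfolding hs2_def using assms(1) by (intro has_sum_cmult_right has_sum_infsum) (simp add: hsum_def)
  show h: "hsum s' b" unfolding hsum_def
    by (rule summable_on_comparison_test[OF has_sum_imp_summable[OF C] assms(2)])
       (simp add: sob_weight_pos less_imp_le)
  show "hs2 s' b \<le> C * hs2 s a"
    unfolding hs2_def[of s' b]
    by (rule has_sum_mono[OF has_sum_infsum C assms(2)]) (use h in \<open>simp add: hsum_def\<close>)
qed

lemma hsum_cmult:
  assumes "hsum s a"
  shows "hsum s (\<lambda>k. c * a k)" "hs2 s (\<lambda>k. c * a k) \<le> (norm c)\<^sup>2 * hs2 s a"
  by (rule hsum_comparison[OF assms, of _ _ "(norm c)\<^sup>2"]; simp add: norm_mult power_mult_distrib)+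

lemma hsum_add:
  assumes "hsum s a" "hsum s b"
  shows "hsum s (\<lambda>k. a k + b k)" "hs2 s (\<lambda>k. a k + b k) \<le> 2 * hs2 s a + 2 * hs2 s b"
proof -
  let ?g = "\<lambda>k. 2 * (sob_weight s k * (norm (a k))\<^sup>2) + 2 * (sob_weight s k * (norm (b k))\<^sup>2)"
  have C: "(?g has_sum (2 * hs2 s a + 2 * hs2 s b)) UNIV"
    unfolding hs2_def using assms by (intro has_sum_add has_sum_cmult_right has_sum_infsum) (simp_all add: hsum_def)
  have le: "sob_weight s k * (norm (a k + b k))\<^sup>2 \<le> ?g k" for k
  proof -
    have "sob_weight s k * (norm (a k + b k))\<^sup>2 \<le> sob_weight s k * (2 * (cmod (a k))\<^sup>2 + 2 * (cmod (b k))\<^sup>2)"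
      by (intro mult_left_mono sq_add_le less_imp_le sob_weight_pos)
    then show ?thesis by (simp add: algebra_simps)
  qed
  show h: "hsum s (\<lambda>k. a k + b k)" unfolding hsum_def
    by (rule summable_on_comparison_test[OF has_sum_imp_summable[OF C] le]) (simp add: sob_weight_pos less_imp_le)
  show "hs2 s (\<lambda>k. a k + b k) \<le> 2 * hs2 s a + 2 * hs2 s b"
    unfolding hs2_def[of s "\<lambda>k. a k + b k"]
    by (rule has_sum_mono[OF has_sum_infsum C le]) (use h in \<open>simp add: hsum_def\<close>)
qed

lemma hsum_diff:
  assumes "hsum s a" "hsum s b"
  shows "hsum s (\<lambda>k. a k - b k)" "hs2 s (\<lambda>k. a k - b k) \<le> 2 * hs2 s a + 2 * hs2 s b"
proof -
  have m: "hsum s (\<lambda>k. - b k)" "hs2 s (\<lambda>k. - b k) = hs2 s b"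
    using assms(2) by (auto simp: hsum_def hs2_def)
  show "hsum s (\<lambda>k. a k - b k)" "hs2 s (\<lambda>k. a k - b k) \<le> 2 * hs2 s a + 2 * hs2 s b"
    using hsum_add[OF assms(1) m(1)] m(2) by auto
qed

lemma hsum_mono:
  assumes "s' \<le> s" "hsum s a"
  shows "hsum s' a" "hs2 s' a \<le> hs2 s a"
proof -
  have "sob_weight s' k \<le> sob_weight s k" for k
    unfolding sob_weight_def using assms(1) by (intro powr_mono) auto
  then have "sob_weight s' k * (norm (a k))\<^sup>2 \<le> 1 * (sob_weight s k * (norm (a k))\<^sup>2)" for k
    by (simp add: mult_right_mono)
  from hsum_comparison[OF assms(2) this] show "hsum s' a" "hs2 s' a \<le> hs2 s a" by auto
qed

lemma hs2_coeff_bound: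
  assumes "hsum s a" "s \<ge> 0"
  shows "(norm (a k))\<^sup>2 \<le> hs2 s a"
proof -
  have "1 * (norm (a k))\<^sup>2 \<le> sob_weight s k * (norm (a k))\<^sup>2"
    by (intro mult_right_mono sob_weight_ge_1 assms(2)) auto
  also have "\<dots> \<le> hs2 s a"
    unfolding hs2_def using assms(1)
    by (intro summable_imp_bounded[of "\<lambda>k. sob_weight s k * (norm (a k))\<^sup>2"])
       (auto simp: hsum_def sob_weight_pos less_imp_le)
  finally show ?thesis by simp
qed

lemma sob_weight_ge_power:
  assumes "real n \<le> s"
  shows "(1 + (of_int k)\<^sup>2) ^ n \<le> sob_weight s k"
proof -
  have "1 \<le> (2 * pi)\<^sup>2" using pi_gt3 by (intro one_le_power) auto
  then have "1 * (real_of_int k)\<^sup>2 \<le> (2 * pi)\<^sup>2 * (real_of_int k)\<^sup>2" by (intro mult_right_mono) auto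
  then have le: "1 + (real_of_int k)\<^sup>2 \<le> 1 + (2 * pi * real_of_int k)\<^sup>2" by (simp add: power_mult_distrib)
  have "(1 + (real_of_int k)\<^sup>2) ^ n \<le> (1 + (2 * pi * real_of_int k)\<^sup>2) ^ n"
    by (intro power_mono le) auto
  also have "\<dots> = (1 + (2 * pi * real_of_int k)\<^sup>2) powr real n"
    by (subst powr_realpow) (auto simp: add_pos_nonneg)
  also have "\<dots> \<le> sob_weight s k"
    unfolding sob_weight_def using assms by (intro powr_mono) auto
  finally show ?thesis .
qed

text \<open>With q = 1 + k^2, the inequality q |a_k| <= 1/q + q^3 |a_k|^2 splits the terms into a
  summable sequence and an H^s energy; the power 3 is covered by s >= 3.\<close>

lemma abs_summable_of_hsum:
  assumes h: "hsum s a" and s: "s \<ge> 3"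
  shows "(\<lambda>k. (1 + (of_int k)\<^sup>2) * norm (a k)) summable_on UNIV"
    "(\<Sum>\<^sub>\<infinity>k. (1 + (of_int k)\<^sup>2) * norm (a k)) \<le> (\<Sum>\<^sub>\<infinity>k::int. 1 / (1 + (real_of_int k)\<^sup>2)) + hs2 s a"
proof -
  have C: "((\<lambda>k. 1 / (1 + (real_of_int k)\<^sup>2) + sob_weight s k * (norm (a k))\<^sup>2) has_sum
     ((\<Sum>\<^sub>\<infinity>k::int. 1 / (1 + (real_of_int k)\<^sup>2)) + hs2 s a)) UNIV"
    unfolding hs2_def using h
    by (intro has_sum_add has_sum_infsum summable_inverse_squares) (simp add: hsum_def)
  have le: "(1 + (of_int k)\<^sup>2) * norm (a k) \<le> 1 / (1 + (real_of_int k)\<^sup>2) + sob_weight s k * (norm (a k))\<^sup>2" for k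
  proof -
    define q where "q = 1 + (real_of_int k)\<^sup>2"
    have q: "q \<ge> 1" by (simp add: q_def)
    \<comment> \<open>Chosen so that p <= 1 + p^2, divided by \<open>q\<close>, becomes the claimed
      splitting.\<close>
    define p where "p = q\<^sup>2 * norm (a k)"
    have "0 \<le> (1 - p)\<^sup>2" "0 \<le> p" by (simp_all add: p_def)
    then have "p \<le> 1 + p\<^sup>2" by (simp add: power2_eq_square algebra_simps)
    then have "q\<^sup>2 * norm (a k) \<le> 1 + q ^ 4 * (norm (a k))\<^sup>2"
      by (simp add: p_def power_mult_distrib flip: power_mult)
    then have "q\<^sup>2 * norm (a k) / q \<le> (1 + q ^ 4 * (norm (a k))\<^sup>2) / q" using q by (intro divide_right_mono) auto
    also have "\<dots> = 1 / q + q ^ 3 * (norm (a k))\<^sup>2" using q by (simp add: field_simps power4_eq_xxxx power3_eq_cube)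
    also have "\<dots> \<le> 1 / q + sob_weight s k * (norm (a k))\<^sup>2"
      using sob_weight_ge_power[of 3 s k] s by (intro add_left_mono mult_right_mono) (auto simp: q_def)
    also have "q\<^sup>2 * norm (a k) / q = q * norm (a k)" using q by (simp add: power2_eq_square)
    finally show ?thesis unfolding q_def .
  qed
  show "(\<lambda>k. (1 + (of_int k)\<^sup>2) * norm (a k)) summable_on UNIV"
    by (rule summable_on_comparison_test[OF has_sum_imp_summable[OF C] le]) simp
  then show "(\<Sum>\<^sub>\<infinity>k. (1 + (of_int k)\<^sup>2) * norm (a k)) \<le> (\<Sum>\<^sub>\<infinity>k::int. 1 / (1 + (real_of_int k)\<^sup>2)) + hs2 s a"
    by (intro has_sum_mono[OF has_sum_infsum C le])
qed

lemma abs_int_le_sq: "\<bar>real_of_int k\<bar> \<le> 1 + (real_of_int k)\<^sup>2"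
proof -
  have "0 \<le> (1 - \<bar>real_of_int k\<bar>)\<^sup>2" by simp
  then have "2 * \<bar>real_of_int k\<bar> \<le> 1 + (real_of_int k)\<^sup>2" by (simp add: power2_eq_square algebra_simps)
  then show ?thesis by linarith
qed

lemma seq_bound_of_hsum:
  assumes h: "hsum s a" and s: "s \<ge> 3"
  shows "seq_bound ((\<Sum>\<^sub>\<infinity>k::int. 1 / (1 + (real_of_int k)\<^sup>2)) + hs2 s a) a"
proof -
  note b = abs_summable_of_hsum[OF assms]
  have le: "\<bar>real_of_int k\<bar> * norm (a k) \<le> (1 + (of_int k)\<^sup>2) * norm (a k)" for k
    by (intro mult_right_mono abs_int_le_sq) auto
  have sm: "(\<lambda>k. \<bar>real_of_int k\<bar> * norm (a k)) summable_on UNIV"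
    by (rule summable_on_comparison_test[OF b(1) le]) simp
  have "(\<Sum>\<^sub>\<infinity>k. \<bar>real_of_int k\<bar> * norm (a k)) \<le> (\<Sum>\<^sub>\<infinity>k. (1 + (of_int k)\<^sup>2) * norm (a k))"
    by (rule infsum_mono[OF sm b(1) le])
  moreover have "norm (a k) * (1 + (of_int k)\<^sup>2) \<le> (\<Sum>\<^sub>\<infinity>k. (1 + (of_int k)\<^sup>2) * norm (a k))" for k
    using summable_imp_bounded[OF b(1), of k] by (simp add: mult.commute)
  ultimately show ?thesis unfolding seq_bound_def using sm b(2) by (auto intro: order_trans)
qed

section \<open>Convolution and the quadratic right-hand side on weighted sequence spaces\<close>

lemma cauchy_schwarz_infsum:
  fixes z p q :: "'a \<Rightarrow> real"
  assumes z: "\<And>l. z l \<ge> 0" "\<And>l. (z l)\<^sup>2 \<le> p l * q l" and pq: "\<And>l. p l \<ge> 0" "\<And>l. q l \<ge> 0"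
    "p summable_on UNIV" "q summable_on UNIV"
  shows "z summable_on UNIV" "(infsum z UNIV)\<^sup>2 \<le> infsum p UNIV * infsum q UNIV"
proof -
  have fin: "sum z F \<le> sqrt (infsum p UNIV * infsum q UNIV)" if F: "finite F" for F
  proof (rule real_le_rsqrt)
    have zle: "z l \<le> sqrt (p l) * sqrt (q l)" for l
      using z(2)[of l] by (simp add: real_le_rsqrt flip: real_sqrt_mult)
    have "(sum z F)\<^sup>2 \<le> (\<Sum>l\<in>F. sqrt (p l) * sqrt (q l))\<^sup>2"
      by (intro power_mono sum_mono zle sum_nonneg z)
    also have "\<dots> \<le> (\<Sum>l\<in>F. (sqrt (p l))\<^sup>2) * (\<Sum>l\<in>F. (sqrt (q l))\<^sup>2)"
      by (rule Cauchy_Schwarz_ineq_sum)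
    also have "\<dots> = sum p F * sum q F" by (simp add: pq)
    also have "\<dots> \<le> infsum p UNIV * infsum q UNIV"
      by (intro mult_mono finite_sum_le_infsum F pq infsum_nonneg sum_nonneg) auto
    finally show "(sum z F)\<^sup>2 \<le> infsum p UNIV * infsum q UNIV" .
  qed
  show sm: "z summable_on UNIV"
    by (rule nonneg_bdd_above_summable_on) (use z fin in \<open>auto simp: bdd_above_def\<close>)
  have "infsum z UNIV \<le> sqrt (infsum p UNIV * infsum q UNIV)"
    by (rule infsum_le_finite_sums[OF sm]) (use fin in auto)
  then have "(infsum z UNIV)\<^sup>2 \<le> (sqrt (infsum p UNIV * infsum q UNIV))\<^sup>2"
    by (intro power_mono infsum_nonneg z)
  then show "(infsum z UNIV)\<^sup>2 \<le> infsum p UNIV * infsum q UNIV"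
    by (simp add: infsum_nonneg pq)
qed

lemma bij_minus_int: "bij (\<lambda>l::int. k - l)"
  by (rule bij_betw_byWitness[where f' = "\<lambda>l. k - l"]) auto

lemma has_sum_reflect:
  fixes k :: int
  assumes "(f has_sum S) UNIV"
  shows "((\<lambda>l. f (k - l)) has_sum S) UNIV"
  using has_sum_reindex_bij_betw[OF bij_minus_int[of k]] assms by blast

lemma bij_pair_shear: "bij (\<lambda>(k, l). (l, k - l) :: int \<times> int)"
  by (rule bij_betw_byWitness[where f' = "\<lambda>(j, l). (j + l, j)"]) auto

definition alg_const :: "real \<Rightarrow> real" where
  "alg_const s = 2 * 4 powr s * (\<Sum>\<^sub>\<infinity>k::int. 1 / (1 + (real_of_int k)\<^sup>2))"

lemma alg_const_nonneg: "alg_const s \<ge> 0"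
  unfolding alg_const_def by (intro mult_nonneg_nonneg infsum_nonneg) auto

text \<open>The algebra property of H^s. The larger of |l| and |k - l| is at least |k| / 2, so w(k)
  <= 4^s (w(l) + w(k - l)). The two summands each contribute one sum of inverse squares, which
  explains the factor 2 * 4^s in \<open>alg_const\<close>.\<close>

lemma hsum_conv:
  assumes a: "hsum s a" and b: "hsum s b" and s: "s \<ge> 1"
  shows "hsum s (conv a b)" "hs2 s (conv a b) \<le> alg_const s * hs2 s a * hs2 s b"
proof -
  let ?w = "sob_weight s"
  let ?S = "\<Sum>\<^sub>\<infinity>k::int. 1 / (1 + (real_of_int k)\<^sup>2)"
  have wpos: "?w k > 0" for k by (rule sob_weight_pos)
  define P Q where "P k = ?w k * (norm (a k))\<^sup>2" and "Q k = ?w k * (norm (b k))\<^sup>2" for k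
  have PQ: "(P has_sum hs2 s a) UNIV" "(Q has_sum hs2 s b) UNIV" "\<And>k. P k \<ge> 0" "\<And>k. Q k \<ge> 0"
    using a b by (auto simp: P_def[abs_def] Q_def[abs_def] hs2_def hsum_def sob_weight_pos less_imp_le)
  have iw: "1 / ?w k \<le> 1 / (1 + (real_of_int k)\<^sup>2)" for k
    using sob_weight_ge_power[of 1 s k] s by (intro divide_left_mono) (auto simp: add_pos_nonneg wpos)
  have R: "((\<lambda>(k, l). P l * Q (k - l)) has_sum (hs2 s a * hs2 s b)) UNIV"
    using has_sum_pair_bij[OF has_sum_product_nonneg[OF PQ] bij_pair_shear] by (simp add: case_prod_unfold)
  then have Rs: "(\<lambda>(k, l). P l * Q (k - l)) summable_on UNIV" by (rule has_sum_imp_summable)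
  have Rl: "(\<lambda>l. P l * Q (k - l)) summable_on UNIV" for k
    using summable_on_SigmaD1[of "\<lambda>k l. P l * Q (k - l)" UNIV "\<lambda>_. UNIV" k] Rs PQ(3,4) by simp
  have Rk: "((\<lambda>k. \<Sum>\<^sub>\<infinity>l. P l * Q (k - l)) has_sum (hs2 s a * hs2 s b)) UNIV"
    using infsum_Sigma'_banach[of "\<lambda>k l. P l * Q (k - l)" UNIV "\<lambda>_. UNIV"]
      summable_on_Sigma_banach[of "\<lambda>k l. P l * Q (k - l)" UNIV "\<lambda>_. UNIV"] Rs infsumI[OF R]
    by (simp add: has_sum_iff)
  have key: "?w k * (norm (conv a b k))\<^sup>2 \<le> alg_const s * (\<Sum>\<^sub>\<infinity>l. P l * Q (k - l))" for k
  proof -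
    \<comment> \<open>The Cauchy-Schwarz weight: \<open>P l * Q (k - l)\<close> carries the product
      of the two Sobolev weights, and \<open>?w k\<close> times the sum of \<open>p\<close> stays
      bounded uniformly in \<open>k\<close>.\<close>
    define p where "p l = 1 / (?w l * ?w (k - l))" for l
    define z where "z l = norm (a l) * norm (b (k - l))" for l
    have wp: "?w k * p l \<le> 4 powr s * (1 / (1 + (real_of_int l)\<^sup>2) + 1 / (1 + (real_of_int (k - l))\<^sup>2))" for l
    proof -
      have "?w k \<le> 4 powr s * (?w l + ?w (k - l))"
      proof (cases "\<bar>l\<bar> \<le> \<bar>k - l\<bar>")
        case True
        then have "\<bar>k\<bar> \<le> 2 * \<bar>k - l\<bar>" by presburger
        then have "?w k \<le> 4 powr s * ?w (k - l)" using s by (intro sob_weight_doubling) auto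
        also have "\<dots> \<le> 4 powr s * (?w l + ?w (k - l))" using wpos[of l] by (intro mult_left_mono) auto
        finally show ?thesis .
      next
        case False
        then have "\<bar>k\<bar> \<le> 2 * \<bar>l\<bar>" by presburger
        then have "?w k \<le> 4 powr s * ?w l" using s by (intro sob_weight_doubling) auto
        also have "\<dots> \<le> 4 powr s * (?w l + ?w (k - l))" using wpos[of "k - l"] by (intro mult_left_mono) auto
        finally show ?thesis .
      qed
      then have "?w k * p l \<le> 4 powr s * (?w l + ?w (k - l)) * p l"
        using wpos[of l] wpos[of "k - l"] by (intro mult_right_mono) (auto simp: p_def less_imp_le)
      also have "\<dots> = 4 powr s * (1 / ?w (k - l) + 1 / ?w l)"
        using wpos[of l] wpos[of "k - l"] by (simp add: p_def field_simps)
      also have "\<dots> \<le> 4 powr s * (1 / (1 + (real_of_int (k - l))\<^sup>2) + 1 / (1 + (real_of_int l)\<^sup>2))"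
        by (intro mult_left_mono add_mono iw) auto
      finally show ?thesis by (simp add: add.commute)
    qed
    have B: "((\<lambda>l. 4 powr s * (1 / (1 + (real_of_int l)\<^sup>2) + 1 / (1 + (real_of_int (k - l))\<^sup>2))) has_sum (4 powr s * (?S + ?S))) UNIV"
      by (intro has_sum_cmult_right has_sum_add has_sum_reflect[where f = "\<lambda>l. 1 / (1 + (real_of_int l)\<^sup>2)"]
           has_sum_infsum summable_inverse_squares)
    have p0: "p l \<ge> 0" for l by (simp add: p_def wpos less_imp_le)
    have wps: "(\<lambda>l. ?w k * p l) summable_on UNIV"
      by (rule summable_on_comparison_test[OF has_sum_imp_summable[OF B] wp]) (simp add: p0 wpos less_imp_le)
    then have ps: "p summable_on UNIV"
      using summable_on_cmult_right[OF wps, of "1 / ?w k"] wpos[of k] by simp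
    have wpS: "?w k * infsum p UNIV \<le> alg_const s"
    proof -
      have "(\<Sum>\<^sub>\<infinity>l. ?w k * p l) \<le> 4 powr s * (?S + ?S)"
        by (rule has_sum_mono[OF has_sum_infsum[OF wps] B wp])
      then show ?thesis by (simp add: infsum_cmult_right' alg_const_def)
    qed
    have zsq: "(z l)\<^sup>2 \<le> p l * (P l * Q (k - l))" for l
      using wpos[of l] wpos[of "k - l"] by (simp add: z_def p_def P_def Q_def power_mult_distrib)
    have z0: "z l \<ge> 0" for l by (simp add: z_def)
    note cs = cauchy_schwarz_infsum[OF z0 zsq p0 _ ps Rl]
    have "norm (conv a b k) \<le> infsum z UNIV"
      unfolding conv_def
      by (rule order_trans[OF norm_infsum_bound]) (use cs(1) PQ in \<open>auto simp: z_def[abs_def] norm_mult\<close>)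
    then have "(norm (conv a b k))\<^sup>2 \<le> (infsum z UNIV)\<^sup>2" by (intro power_mono) auto
    also have "\<dots> \<le> infsum p UNIV * (\<Sum>\<^sub>\<infinity>l. P l * Q (k - l))" using cs(2) PQ by simp
    finally have "?w k * (norm (conv a b k))\<^sup>2 \<le> ?w k * (infsum p UNIV * (\<Sum>\<^sub>\<infinity>l. P l * Q (k - l)))"
      by (rule mult_left_mono) (simp add: wpos less_imp_le)
    also have "\<dots> = (?w k * infsum p UNIV) * (\<Sum>\<^sub>\<infinity>l. P l * Q (k - l))" by simp
    also have "\<dots> \<le> alg_const s * (\<Sum>\<^sub>\<infinity>l. P l * Q (k - l))"
      by (intro mult_right_mono wpS infsum_nonneg) (simp add: PQ)
    finally show ?thesis .
  qed
  have C: "((\<lambda>k. alg_const s * (\<Sum>\<^sub>\<infinity>l. P l * Q (k - l))) has_sum (alg_const s * (hs2 s a * hs2 s b))) UNIV"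
    by (rule has_sum_cmult_right[OF Rk])
  show h: "hsum s (conv a b)" unfolding hsum_def
    by (rule summable_on_comparison_test[OF has_sum_imp_summable[OF C] key]) (simp add: wpos less_imp_le)
  show "hs2 s (conv a b) \<le> alg_const s * hs2 s a * hs2 s b"
    using has_sum_mono[OF has_sum_infsum C key] h by (simp add: hs2_def hsum_def mult.assoc)
qed

text \<open>The right-hand side is quadratic, and the difference of its values at \<open>a\<close> and \<open>b\<close> is
  \<open>bil g (a + b) (a - b)\<close>.\<close>

definition bil :: "(int \<Rightarrow> real) \<Rightarrow> (int \<Rightarrow> complex) \<Rightarrow> (int \<Rightarrow> complex) \<Rightarrow> int \<Rightarrow> complex" where
  "bil g c z k = - (dsym k / 2) * conv c z k - \<i> * of_real (g k) * z k"

lemma muDP_rhs_eq_bil: "muDP_rhs g a = bil g a a"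
  by (auto simp: muDP_rhs_def bil_def)

lemma conv_commute: "conv a b k = conv b a k"
proof -
  have "conv b a k = (\<Sum>\<^sub>\<infinity>l. b (k - l) * a (k - (k - l)))"
    unfolding conv_def
    using infsum_reindex_bij_betw[OF bij_minus_int, of "\<lambda>l. b l * a (k - l)" k] by simp
  then show ?thesis by (simp add: conv_def mult.commute)
qed

lemma bil_diff:
  assumes a: "(\<lambda>k. norm (a k)) summable_on UNIV" and b: "(\<lambda>k. norm (b k)) summable_on UNIV"
  shows "bil g a a k - bil g b b k = bil g (\<lambda>k. a k + b k) (\<lambda>k. a k - b k) k"
proof -
  have sm: "((\<lambda>l. x l * y (k - l)) has_sum conv x y k) UNIV"
    if x: "(\<lambda>k. norm (x k)) summable_on UNIV" and y: "(\<lambda>k. norm (y k)) summable_on UNIV" for x y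
    unfolding conv_def
    by (intro has_sum_infsum abs_summable_summable[OF conv_summable[OF x, of y "infsum (\<lambda>k. norm (y k)) UNIV"]]
        summable_imp_bounded[OF y]) simp
  have "((\<lambda>l. a l * a (k - l) - a l * b (k - l) + (b l * a (k - l) - b l * b (k - l))) has_sum
      (conv a a k - conv a b k + (conv b a k - conv b b k))) UNIV"
    by (intro has_sum_add has_sum_minus sm a b)
  then have "conv (\<lambda>k. a k + b k) (\<lambda>k. a k - b k) k = conv a a k - conv b b k"
    unfolding conv_def[of "\<lambda>k. a k + b k"]
    by (intro infsumI) (simp add: algebra_simps conv_commute[of b a])
  note e = this
  show ?thesis unfolding bil_def e by (simp add: algebra_simps)
qed

lemma hsum_bil:
  assumes c: "hsum s c" and z: "hsum s z" and s: "s \<ge> 1" and g: "\<And>k. \<bar>g k\<bar> \<le> G"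
  shows "hsum (s - 1) (bil g c z)"
    "hs2 (s - 1) (bil g c z) \<le> (alg_const s * hs2 s c + 2 * G\<^sup>2) * hs2 s z"
proof -
  have w: "sob_weight (s - 1) k * (2 * pi * real_of_int k)\<^sup>2 \<le> sob_weight s k" for k
  proof -
    define q where "q = 1 + (2 * pi * real_of_int k)\<^sup>2"
    have q: "q > 0" unfolding q_def by (rule add_pos_nonneg) auto
    have "q powr (s - 1) * (2 * pi * real_of_int k)\<^sup>2 \<le> q powr (s - 1) * q"
      by (intro mult_left_mono) (auto simp: q_def)
    also have "\<dots> = q powr s" using q by (simp add: powr_diff)
    finally show ?thesis by (simp add: sob_weight_def q_def)
  qed
  have 1: "hsum (s - 1) (\<lambda>k. - (dsym k / 2) * conv c z k)"
    "hs2 (s - 1) (\<lambda>k. - (dsym k / 2) * conv c z k) \<le> 1 / 4 * hs2 s (conv c z)"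
  proof -
    have "sob_weight (s - 1) k * (norm (- (dsym k / 2) * conv c z k))\<^sup>2 \<le> 1 / 4 * (sob_weight s k * (norm (conv c z k))\<^sup>2)" for k
    proof -
      have "(norm (- (dsym k / 2) * conv c z k))\<^sup>2 = 1 / 4 * ((2 * pi * real_of_int k)\<^sup>2 * (norm (conv c z k))\<^sup>2)"
        by (simp add: norm_mult norm_divide norm_dsym power_mult_distrib power_divide)
      then have "sob_weight (s - 1) k * (norm (- (dsym k / 2) * conv c z k))\<^sup>2 =
          1 / 4 * ((sob_weight (s - 1) k * (2 * pi * real_of_int k)\<^sup>2) * (norm (conv c z k))\<^sup>2)"
        by (simp only: ac_simps)
      also have "\<dots> \<le> 1 / 4 * (sob_weight s k * (norm (conv c z k))\<^sup>2)"
        by (intro mult_left_mono mult_right_mono w) auto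
      finally show ?thesis .
    qed
    from hsum_comparison[OF hsum_conv(1)[OF c z s] this]
    show "hsum (s - 1) (\<lambda>k. - (dsym k / 2) * conv c z k)"
      "hs2 (s - 1) (\<lambda>k. - (dsym k / 2) * conv c z k) \<le> 1 / 4 * hs2 s (conv c z)" by auto
  qed
  have 2: "hsum (s - 1) (\<lambda>k. \<i> * of_real (g k) * z k)" "hs2 (s - 1) (\<lambda>k. \<i> * of_real (g k) * z k) \<le> G\<^sup>2 * hs2 (s - 1) z"
  proof -
    have "sob_weight (s - 1) k * (norm (\<i> * of_real (g k) * z k))\<^sup>2 \<le> G\<^sup>2 * (sob_weight (s - 1) k * (norm (z k))\<^sup>2)" for k
    proof -
      have "(norm (\<i> * of_real (g k) * z k))\<^sup>2 = \<bar>g k\<bar>\<^sup>2 * (norm (z k))\<^sup>2" by (simp add: norm_mult power_mult_distrib)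
      also have "\<dots> \<le> G\<^sup>2 * (norm (z k))\<^sup>2" by (intro mult_right_mono power_mono g) auto
      finally have "sob_weight (s - 1) k * (norm (\<i> * of_real (g k) * z k))\<^sup>2 \<le> sob_weight (s - 1) k * (G\<^sup>2 * (norm (z k))\<^sup>2)"
        by (intro mult_left_mono) (simp_all add: sob_weight_pos less_imp_le)
      then show ?thesis by (simp only: ac_simps)
    qed
    from hsum_comparison[OF hsum_mono(1)[OF _ z] this]
    show "hsum (s - 1) (\<lambda>k. \<i> * of_real (g k) * z k)" "hs2 (s - 1) (\<lambda>k. \<i> * of_real (g k) * z k) \<le> G\<^sup>2 * hs2 (s - 1) z" by auto
  qed
  have e: "bil g c z = (\<lambda>k. - (dsym k / 2) * conv c z k - \<i> * of_real (g k) * z k)" by (auto simp: bil_def)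
  show "hsum (s - 1) (bil g c z)" unfolding e by (rule hsum_diff(1)[OF 1(1) 2(1)])
  have "hs2 (s - 1) (bil g c z) \<le> 2 * (1 / 4 * hs2 s (conv c z)) + 2 * (G\<^sup>2 * hs2 (s - 1) z)"
    unfolding e using hsum_diff(2)[OF 1(1) 2(1)] 1(2) 2(2) by linarith
  also have "\<dots> \<le> 2 * (1 / 2 * (alg_const s * hs2 s c * hs2 s z)) + 2 * (G\<^sup>2 * hs2 s z)"
    using hsum_conv(2)[OF c z s] hs2_nonneg[of s "conv c z"] hsum_mono(2)[of "s - 1" s, OF _ z]
    by (intro add_mono mult_left_mono) auto
  finally show "hs2 (s - 1) (bil g c z) \<le> (alg_const s * hs2 s c + 2 * G\<^sup>2) * hs2 s z"
    by (simp add: algebra_simps)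
qed

subsection \<open>Continuity and differentiability in time\<close>

text \<open>Weak convergence together with an upper bound on the norms gives strong convergence. The
  terms 2|b|^2 + 2|b0|^2 - |b - b0|^2 are nonnegative, so a finite partial sum bounds their total
  from below; this controls the tail of b - b0 without uniform summability.\<close>

lemma hs2_tendsto_zeroI:
  assumes b: "\<And>\<tau>. hsum s (b \<tau>)" and b0: "hsum s b0"
    and lim: "\<And>k. ((\<lambda>\<tau>. b \<tau> k) \<longlongrightarrow> b0 k) F"
    and up: "\<And>e. e > 0 \<Longrightarrow> eventually (\<lambda>\<tau>. hs2 s (b \<tau>) \<le> hs2 s b0 + e) F"
  shows "((\<lambda>\<tau>. hs2 s (\<lambda>k. b \<tau> k - b0 k)) \<longlongrightarrow> 0) F"
proof (rule tendstoI)
  fix e :: real assume "e > 0"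
  \<comment> \<open>The error budget is 6 d from the tail of \<open>b \<tau>\<close>, 2 d from the
    tail of \<open>b0\<close> and d from the finite part of the difference.\<close>
  define d where "d = e / 10"
  have d: "d > 0" using \<open>e > 0\<close> by (simp add: d_def)
  let ?w = "sob_weight s"
  define S where "S c A = (\<Sum>k\<in>A. ?w k * (norm (c k))\<^sup>2)" for c :: "int \<Rightarrow> complex" and A
  have hs: "((\<lambda>k. ?w k * (norm (c k))\<^sup>2) has_sum hs2 s c) UNIV" if "hsum s c" for c
    using that by (simp add: hsum_def hs2_def)
  have "eventually (\<lambda>A. dist (S b0 A) (hs2 s b0) < d) (finite_subsets_at_top UNIV)"
    using hs[OF b0] d unfolding has_sum_def S_def by (rule tendstoD)
  then obtain A where A: "finite A" "dist (S b0 A) (hs2 s b0) < d"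
    unfolding eventually_finite_subsets_at_top by auto
  have l1: "((\<lambda>\<tau>. S (b \<tau>) A) \<longlongrightarrow> S b0 A) F"
    unfolding S_def by (intro tendsto_intros lim)
  have l2: "((\<lambda>\<tau>. S (\<lambda>k. b \<tau> k - b0 k) A) \<longlongrightarrow> S (\<lambda>k. b0 k - b0 k) A) F"
    unfolding S_def by (intro tendsto_intros lim)
  have "S (\<lambda>k. b0 k - b0 k) A = 0" by (simp add: S_def)
  note l2 = l2[unfolded this]
  show "eventually (\<lambda>\<tau>. dist (hs2 s (\<lambda>k. b \<tau> k - b0 k)) 0 < e) F"
    using tendstoD[OF l1 d] tendstoD[OF l2 d] up[OF d]
  proof eventually_elim
    case (elim \<tau>)
    let ?x = "\<lambda>k. ?w k * (norm (b \<tau> k - b0 k))\<^sup>2"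
    let ?y = "\<lambda>k. 2 * (?w k * (norm (b \<tau> k))\<^sup>2) + 2 * (?w k * (norm (b0 k))\<^sup>2)"
    have hx: "(?x has_sum hs2 s (\<lambda>k. b \<tau> k - b0 k)) UNIV" by (rule hs[OF hsum_diff(1)[OF b b0]])
    have hy: "(?y has_sum (2 * hs2 s (b \<tau>) + 2 * hs2 s b0)) UNIV"
      by (intro has_sum_add has_sum_cmult_right hs b b0)
    have le: "?x k \<le> ?y k" for k
    proof -
      have "(norm (b \<tau> k - b0 k))\<^sup>2 \<le> 2 * (norm (b \<tau> k))\<^sup>2 + 2 * (norm (b0 k))\<^sup>2"
        using sq_add_le[of "b \<tau> k" "- b0 k"] by simp
      then have "?x k \<le> ?w k * (2 * (norm (b \<tau> k))\<^sup>2 + 2 * (norm (b0 k))\<^sup>2)"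
        by (intro mult_left_mono) (simp_all add: sob_weight_pos less_imp_le)
      then show ?thesis by (simp add: algebra_simps)
    qed
    have 1: "(\<Sum>k\<in>A. ?y k - ?x k) \<le> (2 * hs2 s (b \<tau>) + 2 * hs2 s b0) - hs2 s (\<lambda>k. b \<tau> k - b0 k)"
      by (rule finite_sum_le_has_sum[OF has_sum_minus[OF hy hx] A(1)]) (use le in auto)
    have 2: "(\<Sum>k\<in>A. ?y k - ?x k) = 2 * S (b \<tau>) A + 2 * S b0 A - S (\<lambda>k. b \<tau> k - b0 k) A"
      by (simp add: S_def sum_subtractf sum.distrib sum_distrib_left)
    have "hs2 s (\<lambda>k. b \<tau> k - b0 k) \<le> 2 * (hs2 s (b \<tau>) - S (b \<tau>) A) + 2 * (hs2 s b0 - S b0 A) + S (\<lambda>k. b \<tau> k - b0 k) A"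
      using 1 unfolding 2 by (simp add: algebra_simps)
    moreover have "S b0 A > hs2 s b0 - d" "S (b \<tau>) A > S b0 A - d" "S (\<lambda>k. b \<tau> k - b0 k) A < d"
      using A(2) elim(1,2) by (auto simp: dist_real_def)
    ultimately have "hs2 s (\<lambda>k. b \<tau> k - b0 k) < e" using elim(3) \<open>e > 0\<close> unfolding d_def right_diff_distrib by linarith
    then show ?case by (simp add: hs2_nonneg)
  qed
qed

text \<open>A mean value argument by duality. On a finite set of frequencies the error of the
  difference quotient is paired with itself, held fixed as \<open>c\<close>. The scalar function
  \<open>D\<close> then rises from 0 at t to h S at t + h, where \<open>S\<close> is the squared
  error, while its derivative is at most (S + e/2) / 2.\<close>

lemma hs2_difference_quotient:
  fixes a a' :: "real \<Rightarrow> int \<Rightarrow> complex"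
  assumes der: "\<And>\<tau> k. ((\<lambda>t. a t k) has_vector_derivative a' \<tau> k) (at \<tau>)"
    and h': "\<And>\<tau>. hsum s (a' \<tau>)"
    and cont: "((\<lambda>\<tau>. hs2 s (\<lambda>k. a' \<tau> k - a' t k)) \<longlongrightarrow> 0) (at t)"
  shows "((\<lambda>h. hs2 s (\<lambda>k. (a (t + h) k - a t k) / of_real h - a' t k)) \<longlongrightarrow> 0) (at 0)"
proof (rule tendstoI)
  fix e :: real assume e: "e > 0"
  let ?w = "sob_weight s"
  have "eventually (\<lambda>\<tau>. dist (hs2 s (\<lambda>k. a' \<tau> k - a' t k)) 0 < e / 2) (at t)"
    using tendstoD[OF cont, of "e / 2"] e by simp
  then obtain d where d: "d > 0" "\<And>\<tau>. \<tau> \<noteq> t \<Longrightarrow> dist \<tau> t < d \<Longrightarrow> hs2 s (\<lambda>k. a' \<tau> k - a' t k) < e / 2"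
    unfolding eventually_at by (auto simp: hs2_nonneg)
  have d2: "hs2 s (\<lambda>k. a' \<tau> k - a' t k) \<le> e / 2" if "dist \<tau> t < d" for \<tau>
    using d(2)[of \<tau>] that e by (cases "\<tau> = t") (auto simp: hs2_def)
  have main: "hs2 s (\<lambda>k. (a (t + h) k - a t k) / of_real h - a' t k) \<le> e / 2" if h: "h \<noteq> 0" "\<bar>h\<bar> < d" for h
  proof -
    define c where "c k = (a (t + h) k - a t k) / of_real h - a' t k" for k
    have fin: "(\<Sum>k\<in>A. ?w k * (norm (c k))\<^sup>2) \<le> e / 2" if A: "finite A" for A
    proof -
      define S where "S = (\<Sum>k\<in>A. ?w k * (norm (c k))\<^sup>2)"
      define D where "D \<tau> = (\<Sum>k\<in>A. ?w k * Re (cnj (c k) * (a \<tau> k - a t k - of_real (\<tau> - t) * a' t k)))" for \<tau>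
      define D' where "D' \<tau> = (\<Sum>k\<in>A. ?w k * Re (cnj (c k) * (a' \<tau> k - a' t k)))" for \<tau>
      have "D (t + h) = h * S"
        unfolding D_def S_def sum_distrib_left
      proof (intro sum.cong refl)
        fix k
        have "a (t + h) k - a t k - of_real h * a' t k = of_real h * c k"
          using h by (simp add: c_def field_simps)
        then have "Re (cnj (c k) * (a (t + h) k - a t k - of_real (t + h - t) * a' t k)) = h * (norm (c k))\<^sup>2"
          unfolding cmod_power2 by (simp add: power2_eq_square algebra_simps)
        then show "?w k * Re (cnj (c k) * (a (t + h) k - a t k - of_real (t + h - t) * a' t k)) = h * (?w k * (norm (c k))\<^sup>2)"
          by (simp only: ac_simps)
      qed
      moreover have "D t = 0" by (simp add: D_def)
      moreover have "norm (D (t + h) - D t) \<le> (S + e / 2) / 2 * norm (t + h - t)"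
      proof (rule field_differentiable_bound[of "ball t d" D D'])
        fix \<tau> assume tau: "\<tau> \<in> ball t d"
        have "((\<lambda>\<tau>. ?w k * Re (cnj (c k) * (a \<tau> k - a t k - of_real (\<tau> - t) * a' t k))) has_real_derivative
            ?w k * Re (cnj (c k) * (a' \<tau> k - a' t k))) (at \<tau>)" for k
        proof -
          have "((\<lambda>\<tau>. cnj (c k) * (a \<tau> k - a t k - (\<tau> - t) *\<^sub>R a' t k)) has_vector_derivative
             cnj (c k) * (a' \<tau> k - 0 - (1 *\<^sub>R a' t k + (\<tau> - t) *\<^sub>R 0))) (at \<tau>)"
            by (intro has_vector_derivative_mult_right has_vector_derivative_diff der has_vector_derivative_const)
               (auto intro!: derivative_eq_intros)
          then have "((\<lambda>\<tau>. Re (cnj (c k) * (a \<tau> k - a t k - (\<tau> - t) *\<^sub>R a' t k))) has_real_derivative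
             Re (cnj (c k) * (a' \<tau> k - 0 - (1 *\<^sub>R a' t k + (\<tau> - t) *\<^sub>R 0)))) (at \<tau>)"
            unfolding has_vector_derivative_complex_iff by blast
          from DERIV_cmult[OF this, of "?w k"] show ?thesis by (simp only: scaleR_conv_of_real) simp
        qed
        then have "(D has_real_derivative D' \<tau>) (at \<tau>)"
          unfolding D_def[abs_def] D'_def by (intro DERIV_sum)
        then show "(D has_field_derivative D' \<tau>) (at \<tau> within ball t d)"
          by (rule has_field_derivative_at_within)
        have "\<bar>D' \<tau>\<bar> \<le> (\<Sum>k\<in>A. ?w k * ((1 * (norm (c k))\<^sup>2 + 1 * (norm (a' \<tau> k - a' t k))\<^sup>2) / 2))"
          unfolding D'_def
        proof (rule order_trans[OF sum_abs], rule sum_mono)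
          fix k
          have "\<bar>?w k * Re (cnj (c k) * (a' \<tau> k - a' t k))\<bar> \<le> ?w k * (1 * (norm (c k) * norm (a' \<tau> k - a' t k)))"
            using abs_Re_le_cmod[of "cnj (c k) * (a' \<tau> k - a' t k)"] sob_weight_pos[of s k]
            unfolding abs_mult by (simp only: norm_mult complex_mod_cnj mult_1) (simp add: mult_left_mono)
          also have "\<dots> \<le> ?w k * ((1 * (norm (c k))\<^sup>2 + 1 * (norm (a' \<tau> k - a' t k))\<^sup>2) / 2)"
            by (intro mult_left_mono quad_bound) (auto simp: sob_weight_pos less_imp_le)
          finally show "\<bar>?w k * Re (cnj (c k) * (a' \<tau> k - a' t k))\<bar> \<le> \<dots>" .
        qed
        also have "\<dots> = (S + (\<Sum>k\<in>A. ?w k * (norm (a' \<tau> k - a' t k))\<^sup>2)) / 2"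
          unfolding S_def sum.distrib[symmetric] sum_divide_distrib by (intro sum.cong) (auto simp: field_simps)
        also have "(\<Sum>k\<in>A. ?w k * (norm (a' \<tau> k - a' t k))\<^sup>2) \<le> hs2 s (\<lambda>k. a' \<tau> k - a' t k)"
          unfolding hs2_def using hsum_diff(1)[OF h' h', of \<tau> t]
          by (intro finite_sum_le_infsum A) (auto simp: hsum_def sob_weight_pos less_imp_le)
        also have "\<dots> \<le> e / 2" using d2[of \<tau>] tau by (simp add: dist_commute)
        finally show "norm (D' \<tau>) \<le> (S + e / 2) / 2" by simp
      qed (use h d in \<open>auto simp: dist_real_def\<close>)
      moreover have S0: "S \<ge> 0" unfolding S_def by (intro sum_nonneg) (simp add: sob_weight_pos less_imp_le)
      ultimately have "\<bar>h\<bar> * S \<le> \<bar>h\<bar> * ((S + e / 2) / 2)" by (simp add: abs_mult mult.commute)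
      \<comment> \<open>Half of \<open>S\<close> is absorbed on the left, which leaves S <= e / 2
        independently of the finite set.\<close>
      then have "S \<le> (S + e / 2) / 2" using h by simp
      then show ?thesis unfolding S_def by simp
    qed
    have "(\<lambda>k. ?w k * (norm (c k))\<^sup>2) summable_on UNIV"
    proof (rule nonneg_bdd_above_summable_on)
      show "bdd_above (sum (\<lambda>k. ?w k * (norm (c k))\<^sup>2) ` {F. F \<subseteq> UNIV \<and> finite F})"
        by (rule bdd_aboveI2[where M = "e / 2"]) (use fin in auto)
    qed (simp add: sob_weight_pos less_imp_le)
    then show ?thesis unfolding c_def[symmetric] hs2_def by (rule infsum_le_finite_sums) (use fin in auto)
  qed
  show "eventually (\<lambda>h. dist (hs2 s (\<lambda>k. (a (t + h) k - a t k) / of_real h - a' t k)) 0 < e) (at 0)"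
    unfolding eventually_at using d(1) main e
    by (intro exI[of _ d]) (force simp: hs2_nonneg dist_real_def)
qed

subsection \<open>Uniqueness\<close>

text \<open>The difference z = a - b solves a linear equation whose transport coefficient is c = a +
  b. By \<open>trilinear_difference_estimate\<close> no derivative of \<open>z\<close> enters the
  growth of its square sum, so Gronwall starting from 0 closes.\<close>

lemma muDP_uniqueness:
  assumes a: "muDP_seq g a" and b: "muDP_seq g b" and eq: "a 0 = b 0"
  shows "a t = b t"
proof -
  define T where "T = \<bar>t\<bar> + 1"
  obtain M1 M2 where M1: "\<And>t. \<bar>t\<bar> < T \<Longrightarrow> seq_bound M1 (a t)" and M2: "\<And>t. \<bar>t\<bar> < T \<Longrightarrow> seq_bound M2 (b t)"
    using a b unfolding muDP_seq_def by meson
  define M where "M = M1 + M2"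
  define z where "z t k = a t k - b t k" for t k
  define c where "c t k = a t k + b t k" for t k
  have pm: "seq_bound M (\<lambda>k. x k + y k)" if x: "seq_bound M1 x" and y: "seq_bound M2 y" for x y
  proof -
    note bx = seq_boundD[OF x] and by' = seq_boundD[OF y]
    have hs: "((\<lambda>k. \<bar>of_int k\<bar> * norm (x k) + \<bar>of_int k\<bar> * norm (y k)) has_sum
       ((\<Sum>\<^sub>\<infinity>k. \<bar>of_int k\<bar> * norm (x k)) + (\<Sum>\<^sub>\<infinity>k. \<bar>of_int k\<bar> * norm (y k)))) UNIV"
      by (intro has_sum_add has_sum_infsum bx by')
    have le: "\<bar>of_int k\<bar> * norm (x k + y k) \<le> \<bar>of_int k\<bar> * norm (x k) + \<bar>of_int k\<bar> * norm (y k)" for k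
      unfolding distrib_left[symmetric] by (intro mult_left_mono norm_triangle_ineq) auto
    have sm: "(\<lambda>k. \<bar>of_int k\<bar> * norm (x k + y k)) summable_on UNIV"
      by (rule summable_on_comparison_test[OF has_sum_imp_summable[OF hs] le]) simp
    have "(\<Sum>\<^sub>\<infinity>k. \<bar>of_int k\<bar> * norm (x k + y k)) \<le> M"
      using has_sum_mono[OF has_sum_infsum[OF sm] hs le] bx(2) by'(2) by (simp add: M_def)
    moreover have "norm (x k + y k) * (1 + (of_int k)\<^sup>2) \<le> M" for k
    proof -
      have "norm (x k + y k) * (1 + (of_int k)\<^sup>2) \<le> (norm (x k) + norm (y k)) * (1 + (of_int k)\<^sup>2)"
        by (intro mult_right_mono norm_triangle_ineq) auto
      also have "\<dots> \<le> M" using x y by (simp add: seq_bound_def M_def distrib_right add_mono)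
      finally show ?thesis .
    qed
    ultimately show ?thesis using sm by (simp add: seq_bound_def)
  qed
  have cb: "seq_bound M (c t)" and zb: "seq_bound M (z t)" if "\<bar>t\<bar> < T" for t
  proof -
    show "seq_bound M (c t)" using pm[OF M1[OF that] M2[OF that]] by (simp add: c_def[abs_def])
    have "seq_bound M2 (\<lambda>k. - b t k)" using M2[OF that] by (simp add: seq_bound_def)
    from pm[OF M1[OF that] this] show "seq_bound M (z t)" by (simp add: z_def[abs_def])
  qed
  have zder: "((\<lambda>t. z t k) has_vector_derivative bil g (c t) (z t) k) (at t)" if "\<bar>t\<bar> < T" for t k
  proof -
    have "((\<lambda>t. z t k) has_vector_derivative (bil g (a t) (a t) k - bil g (b t) (b t) k)) (at t)"
      unfolding z_def using a b by (intro has_vector_derivative_diff) (auto simp: muDP_seq_def muDP_rhs_eq_bil)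
    also have "bil g (a t) (a t) k - bil g (b t) (b t) k = bil g (c t) (z t) k"
      unfolding c_def z_def by (intro bil_diff seq_boundD(6)[OF M1[OF that]] seq_boundD(6)[OF M2[OF that]])
    finally show ?thesis .
  qed
  define d where "d k t = 2 * Re (cnj (z t k) * bil g (c t) (z t) k)" for k t
  have d_eq: "d k t = - Re (dsym k * cnj (z t k) * conv (c t) (z t) k)" for k t
  proof -
    have "Re (cnj (z t k) * (\<i> * of_real (g k) * z t k)) = 0" by (simp add: algebra_simps)
    then show ?thesis
      unfolding d_def bil_def right_diff_distrib by (simp add: field_simps)
  qed
  have der: "((\<lambda>t. (norm (z t k))\<^sup>2) has_real_derivative d k t) (at t)" if "\<bar>t\<bar> < T" for k t
    unfolding d_def by (intro norm_sq_has_derivative zder that)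
  have db: "\<bar>d k t\<bar> \<le> (2 * pi * (2 * M * M)) * M * (1 / (1 + (of_int k)\<^sup>2))" if tT: "\<bar>t\<bar> < T" for k t
  proof -
    note bc = seq_boundD[OF cb[OF that]] and bz = seq_boundD[OF zb[OF that]]
    have cv: "\<bar>of_int k\<bar> * norm (conv (c t) (z t) k) \<le> 2 * M * M"
    proof -
      have "\<bar>of_int k\<bar> * norm (conv (c t) (z t) k) \<le> (\<Sum>\<^sub>\<infinity>k. \<bar>of_int k\<bar> * norm (c t k)) * M + M * (\<Sum>\<^sub>\<infinity>k. \<bar>of_int k\<bar> * norm (z t k))"
        by (rule conv_derivative_bound[OF bc(1) bz(1) bc(3) bz(3)])
      also have "\<dots> \<le> M * M + M * M" by (intro add_mono mult_left_mono mult_right_mono bc(2) bz(2) bc(5))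
      finally show ?thesis by simp
    qed
    have "\<bar>d k t\<bar> \<le> norm (dsym k * cnj (z t k) * conv (c t) (z t) k)"
      unfolding d_eq abs_minus_cancel by (rule abs_Re_le_cmod)
    also have "\<dots> = (2 * pi * (\<bar>of_int k\<bar> * norm (conv (c t) (z t) k)) * norm (z t k))"
      by (simp add: norm_mult norm_dsym)
    also have "\<dots> \<le> (2 * pi * (2 * M * M) * (M / (1 + (of_int k)\<^sup>2)))"
      using bz(5) by (intro mult_mono bz(4) cv mult_nonneg_nonneg) auto
    finally show ?thesis by simp
  qed
  have sm: "(\<lambda>k. (norm (z t k))\<^sup>2) summable_on UNIV" if "\<bar>t\<bar> < T" for t
    using summable_seq_bound_sq[OF zb[OF that], of "\<lambda>_. 1" 1] by simp
  have E: "((\<lambda>t. \<Sum>\<^sub>\<infinity>k. (norm (z t k))\<^sup>2) has_real_derivative (\<Sum>\<^sub>\<infinity>k. d k t)) (at t)" if "\<bar>t\<bar> < T" for t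
    by (rule has_real_derivative_infsum_int[OF der db summable_on_cmult_right[OF summable_inverse_squares] sm that])
  have EB: "\<bar>\<Sum>\<^sub>\<infinity>k. d k t\<bar> \<le> 2 * pi * M * (\<Sum>\<^sub>\<infinity>k. (norm (z t k))\<^sup>2)" if tT: "\<bar>t\<bar> < T" for t
  proof -
    note bc = seq_boundD[OF cb[OF that]] and bz = seq_boundD[OF zb[OF that]]
    have sy: "z t (- k) = cnj (z t k)" for k using a b by (simp add: muDP_seq_def z_def)
    obtain X where X: "((\<lambda>k. of_int k * cnj (z t k) * conv (c t) (z t) k) has_sum X) UNIV"
      "norm X \<le> (\<Sum>\<^sub>\<infinity>k. \<bar>of_int k\<bar> * norm (c t k)) * (\<Sum>\<^sub>\<infinity>k. (norm (z t k))\<^sup>2)"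
      using trilinear_difference_estimate[OF sy bc(1) bc(6) bz(1) bz(6) sm[OF tT]] by blast
    have "((\<lambda>k. Re (- (2 * of_real pi * \<i>) * (of_int k * cnj (z t k) * conv (c t) (z t) k))) has_sum Re (- (2 * of_real pi * \<i>) * X)) UNIV"
      by (intro has_sum_Re has_sum_cmult_right X(1))
    moreover have "Re (- (2 * of_real pi * \<i>) * (of_int k * cnj (z t k) * conv (c t) (z t) k)) = d k t" for k
      unfolding d_eq dsym_def by (simp add: algebra_simps)
    ultimately have "((\<lambda>k. d k t) has_sum Re (- (2 * of_real pi * \<i>) * X)) UNIV" by simp
    then have "(\<Sum>\<^sub>\<infinity>k. d k t) = Re (- (2 * of_real pi * \<i>) * X)" by (rule infsumI)
    then have "\<bar>\<Sum>\<^sub>\<infinity>k. d k t\<bar> \<le> norm (- (2 * of_real pi * \<i>) * X)" by (simp only: abs_Re_le_cmod)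
    also have "\<dots> = 2 * pi * norm X" by (simp add: norm_mult)
    also have "\<dots> \<le> 2 * pi * ((\<Sum>\<^sub>\<infinity>k. \<bar>of_int k\<bar> * norm (c t k)) * (\<Sum>\<^sub>\<infinity>k. (norm (z t k))\<^sup>2))"
      by (intro mult_left_mono X(2)) simp
    also have "\<dots> \<le> 2 * pi * (M * (\<Sum>\<^sub>\<infinity>k. (norm (z t k))\<^sup>2))"
      by (intro mult_left_mono mult_right_mono bc(2) infsum_nonneg) auto
    finally show ?thesis by simp
  qed
  have T: "\<bar>0\<bar> < T" "\<bar>t\<bar> < T" by (auto simp: T_def)
  have "(\<Sum>\<^sub>\<infinity>k. (norm (z t k))\<^sup>2) \<le> exp (2 * pi * M * \<bar>t - 0\<bar>) * (\<Sum>\<^sub>\<infinity>k. (norm (z 0 k))\<^sup>2)"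
    by (rule gronwall_two_sided[OF E EB T])
  then have "(\<Sum>\<^sub>\<infinity>k. (norm (z t k))\<^sup>2) \<le> 0" by (simp add: z_def eq)
  then have "(norm (z t k))\<^sup>2 \<le> 0" for k
    by (rule order_trans[rotated]) (rule summable_imp_bounded[OF sm[OF T(2)]], simp)
  then have "z t k = 0" for k by simp
  then show ?thesis by (auto simp: z_def fun_eq_iff)
qed

section \<open>Lagrangian coordinates\<close>

subsection \<open>Signed antiderivatives\<close>

text \<open>For every \<open>x\<close> at least one of the two intervals is empty or a point, so
  this is the integral from 0 to \<open>x\<close> with its sign.\<close>

definition antider :: "(real \<Rightarrow> 'a::banach) \<Rightarrow> real \<Rightarrow> 'a" where
  "antider g x = integral {0..x} g - integral {x..0} g"

lemma integral_degenerate: "b \<le> a \<Longrightarrow> integral {a..b} g = (0 :: 'a::banach)" for a b :: real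
  by (cases "a = b") auto

lemma antider_nonneg: "x \<ge> 0 \<Longrightarrow> antider g x = integral {0..x} g"
  by (simp add: antider_def integral_degenerate)

lemma antider_nonpos: "x \<le> 0 \<Longrightarrow> antider g x = - integral {x..0} g"
  by (simp add: antider_def integral_degenerate)

lemma antider_0 [simp]: "antider g 0 = 0"
  by (simp add: antider_nonneg)

lemma antider_has_vderiv:
  fixes g :: "real \<Rightarrow> 'a::banach"
  assumes g: "continuous_on UNIV g"
  shows "(antider g has_vector_derivative g x) (at x)"
proof -
  define p where "p = - \<bar>x\<bar> - 1"
  have p: "p < x" "p < 0" by (auto simp: p_def)
  have gi: "g integrable_on {a..b}" for a b
    by (rule integrable_continuous_real, rule continuous_on_subset[OF g]) auto
  have eq: "integral {p..y} g - integral {p..0} g = antider g y" if "p < y" for y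
  proof (cases "y \<ge> 0")
    case True
    then show ?thesis
      using Henstock_Kurzweil_Integration.integral_combine[of p 0 y g] gi p
      by (simp add: antider_nonneg algebra_simps)
  next
    case False
    then show ?thesis
      using Henstock_Kurzweil_Integration.integral_combine[of p y 0 g] gi that
      by (simp add: antider_nonpos algebra_simps)
  qed
  have "((\<lambda>y. integral {p..y} g) has_vector_derivative g x) (at x within {p..x+1})"
    by (rule integral_has_vector_derivative[OF continuous_on_subset[OF g]]) (use p in auto)
  moreover have "x \<in> interior {p..x+1}" using p by simp
  ultimately have "((\<lambda>y. integral {p..y} g) has_vector_derivative g x) (at x)"
    by (metis at_within_interior)
  then have "((\<lambda>y. integral {p..y} g - integral {p..0} g) has_vector_derivative g x) (at x)"
    by (auto intro!: derivative_eq_intros)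
  then show ?thesis
    by (rule has_vector_derivative_transform_within_open[where S = "{p<..}"]) (use p eq in auto)
qed

lemma continuous_on_antider:
  fixes g :: "real \<Rightarrow> 'a::banach"
  assumes "continuous_on UNIV g"
  shows "continuous_on S (antider g)"
  using antider_has_vderiv[OF assms] has_vector_derivative_continuous
  by (meson continuous_at_imp_continuous_on)

text \<open>Exponential growth of rate \<open>c\<close> is reproduced with the gain 1/c; this is the
  estimate behind the contraction in \<open>lipschitz_ode_global\<close>.\<close>

lemma norm_antider_le:
  fixes g :: "real \<Rightarrow> 'a::banach"
  assumes g: "continuous_on UNIV g" and c: "c > 0"
    and b: "\<And>s. norm (g s) \<le> K * exp (c * \<bar>s\<bar>)"
  shows "norm (antider g t) \<le> K / c * (exp (c * \<bar>t\<bar>) - 1)"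
proof (cases "t \<ge> 0")
  case True
  have I: "((\<lambda>s. K * exp (c * s)) has_integral (K / c * exp (c * t) - K / c * exp (c * 0))) {0..t}"
    by (rule fundamental_theorem_of_calculus[OF True])
       (use c in \<open>auto simp: has_real_derivative_iff_has_vector_derivative[symmetric] intro!: derivative_eq_intros\<close>)
  have "norm (integral {0..t} g) \<le> integral {0..t} (\<lambda>s. K * exp (c * s))"
  proof (rule integral_norm_bound_integral)
    show "g integrable_on {0..t}" by (intro integrable_continuous_real continuous_on_subset[OF g]) auto
    show "(\<lambda>s. K * exp (c * s)) integrable_on {0..t}" using I by (rule has_integral_integrable)
    show "\<And>x. x \<in> {0..t} \<Longrightarrow> norm (g x) \<le> K * exp (c * x)" by (metis abs_of_nonneg atLeastAtMost_iff b)
  qed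
  also have "\<dots> = K / c * (exp (c * \<bar>t\<bar>) - 1)" using integral_unique[OF I] True by (simp add: right_diff_distrib)
  finally show ?thesis using True by (simp add: antider_nonneg)
next
  case False
  then have t: "t \<le> 0" by simp
  have I: "((\<lambda>s. K * exp (- c * s)) has_integral (- K / c * exp (- c * 0) - (- K / c * exp (- c * t)))) {t..0}"
    by (rule fundamental_theorem_of_calculus[OF t])
       (use c in \<open>auto simp: has_real_derivative_iff_has_vector_derivative[symmetric] intro!: derivative_eq_intros\<close>)
  have "norm (integral {t..0} g) \<le> integral {t..0} (\<lambda>s. K * exp (- c * s))"
  proof (rule integral_norm_bound_integral)
    show "g integrable_on {t..0}" by (intro integrable_continuous_real continuous_on_subset[OF g]) auto
    show "(\<lambda>s. K * exp (- c * s)) integrable_on {t..0}" using I by (rule has_integral_integrable)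
    show "norm (g x) \<le> K * exp (- c * x)" if "x \<in> {t..0}" for x using b[of x] that by simp
  qed
  also have "\<dots> = K / c * (exp (c * \<bar>t\<bar>) - 1)" using integral_unique[OF I] t by (simp add: right_diff_distrib)
  finally show ?thesis using t by (simp add: antider_nonpos)
qed

lemma vderiv_zero_imp_const:
  fixes f :: "real \<Rightarrow> 'a::real_normed_vector"
  assumes "\<And>x. (f has_vector_derivative 0) (at x)"
  shows "f x = f y"
proof -
  have "\<exists>c. \<forall>x\<in>UNIV. f x = c"
    by (rule has_vector_derivative_zero_constant[OF convex_UNIV]) (use assms in auto)
  then show ?thesis by auto
qed

lemma antider_shift:
  fixes g :: "real \<Rightarrow> 'a::banach"
  assumes g: "continuous_on UNIV g" and p: "\<And>x. g (x + 1) = g x"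
  shows "antider g (x + 1) = antider g x + integral {0..1} g"
proof -
  have "((\<lambda>x. antider g (x + 1) - antider g x) has_vector_derivative 0) (at x)" for x
  proof -
    have "((\<lambda>x::real. x + 1) has_vector_derivative 1) (at x)"
      by (auto simp: has_real_derivative_iff_has_vector_derivative[symmetric] intro!: derivative_eq_intros)
    then have "((\<lambda>x. antider g (x + 1)) has_vector_derivative g (x + 1)) (at x)"
      using vector_diff_chain_at[of "\<lambda>x. x + 1" 1 x "antider g" "g (x + 1)"] antider_has_vderiv[OF g]
      by (simp add: o_def)
    from has_vector_derivative_diff[OF this antider_has_vderiv[OF g]] show ?thesis by (simp add: p)
  qed
  from vderiv_zero_imp_const[OF this, of x 0] show ?thesis
    by (simp add: antider_nonneg[of 1] algebra_simps)
qed

lemma antider_unique: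
  fixes g :: "real \<Rightarrow> 'a::banach"
  assumes g: "continuous_on UNIV g" and f: "\<And>x. (f has_vector_derivative g x) (at x)"
  shows "f x = f 0 + antider g x"
proof -
  have "((\<lambda>x. f x - antider g x) has_vector_derivative 0) (at x)" for x
    using has_vector_derivative_diff[OF f[of x] antider_has_vderiv[OF g, of x]] by simp
  from vderiv_zero_imp_const[OF this, of x 0] show ?thesis by (simp add: algebra_simps)
qed

subsection \<open>Global solutions of Lipschitz differential equations\<close>

theorem lipschitz_ode_global:
  fixes F :: "'a::banach \<Rightarrow> 'a"
  assumes L: "L > 0" "\<And>x y. norm (F x - F y) \<le> L * norm (x - y)"
  obtains r where "r 0 = x0" "\<And>t. (r has_vector_derivative F (r t)) (at t)"
proof -
  \<comment> \<open>The weight \<open>exp (- 2 L \<bar>t\<bar>)\<close> makes the Picard map a contraction on the whole line.\<close>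
  define c where "c = 2 * L"
  have c: "c > 0" using L by (simp add: c_def)
  have Fc: "continuous_on UNIV F"
  proof -
    have "L-lipschitz_on UNIV F"
      by (rule lipschitz_onI) (use L in \<open>auto simp: dist_norm\<close>)
    then show ?thesis by (rule lipschitz_on_continuous_on)
  qed
  \<comment> \<open>The fixed point variable \<open>y\<close> represents exp(-c |t|) r(t), which is
    bounded although the solution \<open>r\<close> may grow exponentially.\<close>
  define g where "g y s = F (exp (c * \<bar>s\<bar>) *\<^sub>R apply_bcontfun y s)" for y :: "real \<Rightarrow>\<^sub>C 'a" and s
  have gc: "continuous_on UNIV (g y)" for y
    unfolding g_def by (rule continuous_on_compose2[OF Fc]) (auto intro!: continuous_intros)
  define G where "G y t = exp (- c * \<bar>t\<bar>) *\<^sub>R (x0 + antider (g y) t)" for y t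
  have e1: "exp (- c * \<bar>t\<bar>) * (K / c * (exp (c * \<bar>t\<bar>) - 1)) \<le> K / c" if "K \<ge> 0" for K t
  proof -
    have "exp (- c * \<bar>t\<bar>) * (K / c * (exp (c * \<bar>t\<bar>) - 1)) = K / c * (1 - exp (- c * \<bar>t\<bar>))"
      by (simp add: exp_minus field_simps)
    also have "\<dots> \<le> K / c * 1" using that c by (intro mult_left_mono) auto
    finally show ?thesis by simp
  qed
  have Gb: "G y \<in> bcontfun" for y
  proof (rule bcontfun_normI)
    show "continuous_on UNIV (G y)" unfolding G_def
      by (intro continuous_intros continuous_on_antider gc)
    fix t
    define K where "K = norm (F 0) + L * norm y"
    have K: "K \<ge> 0" using L by (simp add: K_def)
    have "norm (g y s) \<le> K * exp (c * \<bar>s\<bar>)" for s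
    proof -
      have "norm (g y s) \<le> norm (F 0) + norm (F (exp (c * \<bar>s\<bar>) *\<^sub>R apply_bcontfun y s) - F 0)"
        unfolding g_def by (metis add.commute diff_add_cancel norm_triangle_ineq)
      also have "\<dots> \<le> norm (F 0) + L * (exp (c * \<bar>s\<bar>) * norm (apply_bcontfun y s))"
        using L(2)[of "exp (c * \<bar>s\<bar>) *\<^sub>R apply_bcontfun y s" 0] by simp
      also have "\<dots> \<le> norm (F 0) * exp (c * \<bar>s\<bar>) + L * (exp (c * \<bar>s\<bar>) * norm y)"
        using L(1) c norm_bounded[of y s] by (intro add_mono mult_left_mono) (auto simp: mult_le_cancel_left1)
      finally show ?thesis by (simp add: K_def algebra_simps)
    qed
    then have "norm (antider (g y) t) \<le> K / c * (exp (c * \<bar>t\<bar>) - 1)"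
      by (intro norm_antider_le gc c)
    then have "exp (- c * \<bar>t\<bar>) * norm (antider (g y) t) \<le> exp (- c * \<bar>t\<bar>) * (K / c * (exp (c * \<bar>t\<bar>) - 1))"
      by (intro mult_left_mono) auto
    also have "\<dots> \<le> K / c" by (rule e1[OF K])
    finally have 1: "exp (- c * \<bar>t\<bar>) * norm (antider (g y) t) \<le> K / c" .
    have 2: "exp (- c * \<bar>t\<bar>) * norm x0 \<le> 1 * norm x0" using c by (intro mult_right_mono) auto
    have "norm (G y t) \<le> exp (- c * \<bar>t\<bar>) * (norm x0 + norm (antider (g y) t))"
      unfolding G_def by (simp add: norm_triangle_ineq)
    also have "\<dots> \<le> norm x0 + K / c" using 1 2 by (simp add: distrib_left)
    finally show "norm (G y t) \<le> norm x0 + (norm (F 0) + L * norm y) / c" by (simp add: K_def)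
  qed
  define GG where "GG y = Bcontfun (G y)" for y
  have GG: "apply_bcontfun (GG y) = G y" for y
    unfolding GG_def by (rule Bcontfun_inverse[OF Gb])
  have contr: "dist (GG y) (GG z) \<le> 1 / 2 * dist y z" for y z
  proof (rule dist_bound)
    fix t
    let ?D = "L * dist y z"
    have D: "?D \<ge> 0" using L by simp
    have "((\<lambda>t. antider (g y) t - antider (g z) t) has_vector_derivative (g y t - g z t)) (at t)" for t
      by (intro has_vector_derivative_diff antider_has_vderiv gc)
    from antider_unique[OF _ this, of t]
    have ad: "antider (g y) t - antider (g z) t = antider (\<lambda>s. g y s - g z s) t"
      by (simp add: continuous_on_diff gc)
    have "norm (g y s - g z s) \<le> ?D * exp (c * \<bar>s\<bar>)" for s
    proof -
      have "norm (g y s - g z s) \<le> L * norm (exp (c * \<bar>s\<bar>) *\<^sub>R apply_bcontfun y s - exp (c * \<bar>s\<bar>) *\<^sub>R apply_bcontfun z s)"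
        unfolding g_def by (rule L)
      also have "\<dots> = L * (exp (c * \<bar>s\<bar>) * dist (apply_bcontfun y s) (apply_bcontfun z s))"
        by (simp add: dist_norm scaleR_diff_right[symmetric] del: scaleR_diff_right)
      also have "\<dots> \<le> L * (exp (c * \<bar>s\<bar>) * dist y z)"
        using L(1) by (intro mult_left_mono dist_bounded) auto
      finally show ?thesis by (simp add: ac_simps)
    qed
    then have "norm (antider (\<lambda>s. g y s - g z s) t) \<le> ?D / c * (exp (c * \<bar>t\<bar>) - 1)"
      by (intro norm_antider_le continuous_on_diff gc c)
    then have "exp (- c * \<bar>t\<bar>) * norm (antider (\<lambda>s. g y s - g z s) t) \<le> exp (- c * \<bar>t\<bar>) * (?D / c * (exp (c * \<bar>t\<bar>) - 1))"
      by (intro mult_left_mono) auto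
    also have "\<dots> \<le> ?D / c" by (rule e1[OF D])
    also have "\<dots> = 1 / 2 * dist y z" using L by (simp add: c_def)
    finally have "exp (- c * \<bar>t\<bar>) * norm (antider (\<lambda>s. g y s - g z s) t) \<le> 1 / 2 * dist y z" .
    moreover have "dist (G y t) (G z t) = exp (- c * \<bar>t\<bar>) * norm (antider (\<lambda>s. g y s - g z s) t)"
      unfolding dist_norm G_def scaleR_diff_right[symmetric] ad[symmetric] by simp
    ultimately show "dist (apply_bcontfun (GG y) t) (apply_bcontfun (GG z) t) \<le> 1 / 2 * dist y z"
      by (simp add: GG)
  qed
  have "\<exists>!y. GG y = y"
    by (rule banach_fix_type[of "1/2"]) (use contr in auto)
  then obtain y where y: "GG y = y" by blast
  define r where "r t = exp (c * \<bar>t\<bar>) *\<^sub>R apply_bcontfun y t" for t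
  have r: "r t = x0 + antider (g y) t" for t
  proof -
    have "apply_bcontfun y t = G y t" using GG[of y] y by simp
    then show ?thesis unfolding r_def G_def by (simp add: exp_minus)
  qed
  show ?thesis
  proof
    show "r 0 = x0" by (simp add: r)
    fix t
    have "((\<lambda>t. x0 + antider (g y) t) has_vector_derivative 0 + g y t) (at t)"
      by (intro has_vector_derivative_add has_vector_derivative_const antider_has_vderiv gc)
    moreover have "g y t = F (r t)" by (simp add: g_def r_def)
    ultimately show "(r has_vector_derivative F (r t)) (at t)" by (simp add: r[abs_def])
  qed
qed

subsection \<open>Normalised densities\<close>

definition normalised :: "(real \<Rightarrow> real) \<Rightarrow> real \<Rightarrow> real" where
  "normalised f x = f x / integral {0..1} f"

lemma normalised_props:
  assumes f: "continuous_on {0..1} f" "\<And>x. x \<in> {0..1} \<Longrightarrow> f x \<ge> 0" and i: "integral {0..1} f > 0"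
  shows "continuous_on {0..1} (normalised f)" "\<And>x. x \<in> {0..1} \<Longrightarrow> normalised f x \<ge> 0"
    "integral {0..1} (normalised f) = 1"
  using assms by (auto simp: normalised_def[abs_def] intro!: continuous_intros)

text \<open>The numerator and the normalising integral each change by a factor of at most exp c,
  hence the quotient by exp (2 c). The error is measured relative to the density itself, so its
  integral is small however large the density is.\<close>

lemma normalised_perturbation:
  assumes f: "continuous_on {0..1} f" "\<And>x. x \<in> {0..1} \<Longrightarrow> f x \<ge> 0" "integral {0..1} f > 0"
    and g: "continuous_on {0..1} g" "integral {0..1} g > 0"
    and le: "\<And>x. x \<in> {0..1} \<Longrightarrow> g x \<le> exp c * f x" "\<And>x. x \<in> {0..1} \<Longrightarrow> f x \<le> exp c * g x"
    and x: "x \<in> {0..1}"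
  shows "\<bar>normalised g x - normalised f x\<bar> \<le> (exp (2 * c) - 1) * normalised f x"
proof -
  let ?I = "integral {0..1} f" and ?J = "integral {0..1} g"
  have J1: "?J \<le> exp c * ?I"
    unfolding integral_mult_right[symmetric]
    by (rule integral_le) (auto intro!: integrable_continuous_real continuous_intros f g le)
  have J2: "?I \<le> exp c * ?J"
    unfolding integral_mult_right[symmetric]
    by (rule integral_le) (auto intro!: integrable_continuous_real continuous_intros f g le)
  define E where "E = exp (2 * c)"
  have ee: "exp c * exp c = E" by (simp add: E_def flip: exp_add)
  have conv: "p / J \<le> E * (q / I)" if "p * I \<le> (exp c * q) * (exp c * J)" "I > 0" "J > 0" for p q I J
  proof -
    have "p * I \<le> (exp c * exp c) * q * J" using that(1) by (simp only: ac_simps)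
    then show ?thesis using that(2,3) unfolding ee by (simp add: field_simps)
  qed
  have "g x * ?I \<le> (exp c * f x) * (exp c * ?J)"
    using f g le x J2 by (intro mult_mono) auto
  then have up: "normalised g x \<le> E * normalised f x"
    unfolding normalised_def by (rule conv[OF _ f(3) g(2)])
  have gx: "g x \<ge> 0" using le(2)[OF x] f(2)[OF x] by (metis exp_gt_zero order_trans zero_le_mult_iff not_less)
  have "f x * ?J \<le> (exp c * g x) * (exp c * ?I)"
    using f g le x J1 gx by (intro mult_mono) auto
  then have lo: "normalised f x \<le> E * normalised g x"
    unfolding normalised_def by (rule conv[OF _ g(2) f(3)])
  have d0: "normalised f x \<ge> 0" using f x by (simp add: normalised_def)
  have "normalised f x - normalised g x \<le> (E - 1) * normalised f x"
  proof -
    have E: "E > 0" "normalised f x \<le> E * normalised g x" using lo by (auto simp: E_def)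
    \<comment> \<open>This encodes 1 - 1/E <= E - 1: the possible decrease is no larger than the
      possible increase.\<close>
    have "0 \<le> (E - 1)\<^sup>2 * normalised f x" using d0 by simp
    then have "(2 * E - E * E) * normalised f x \<le> normalised f x" by (simp add: power2_eq_square algebra_simps)
    also have "\<dots> \<le> E * normalised g x" by (rule E)
    finally have "E * ((2 - E) * normalised f x) \<le> E * normalised g x" by (simp add: algebra_simps)
    then have "(2 - E) * normalised f x \<le> normalised g x" using E(1) by simp
    then show ?thesis by (simp add: algebra_simps)
  qed
  then show ?thesis using up unfolding E_def[symmetric] by (simp add: abs_le_iff algebra_simps)
qed

text \<open>The range up to 4 covers the exponents 2 e and 4 e of \<open>PQ_perturb\<close>, where e
  is at most 1.\<close>

lemma exp_minus_one_le:
  assumes "0 \<le> x" "x \<le> (4::real)"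
  shows "exp x - 1 \<le> exp 4 * x"
proof -
  have "1 - x \<le> exp (- x)" using exp_ge_add_one_self[of "- x"] by simp
  then have "exp x * (1 - x) \<le> exp x * exp (- x)" by (intro mult_left_mono) auto
  then have "exp x - 1 \<le> exp x * x" by (simp add: right_diff_distrib flip: exp_add)
  also have "\<dots> \<le> exp 4 * x" using assms by (intro mult_right_mono) auto
  finally show ?thesis .
qed

subsection \<open>The Lagrangian vector field\<close>

instance bcontfun :: (metric_space, banach) banach ..

lemma part_integral_bound:
  fixes f :: "real \<Rightarrow> real"
  assumes f: "continuous_on {0..1} f" "\<And>x. x \<in> {0..1} \<Longrightarrow> f x \<ge> 0" and x: "x \<in> {0..1}"
  shows "0 \<le> integral {0..x} f" "integral {0..x} f \<le> integral {0..1} f"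
proof -
  have i: "f integrable_on {0..x}" by (rule integrable_continuous_real, rule continuous_on_subset[OF f(1)]) (use x in auto)
  show "0 \<le> integral {0..x} f" by (rule integral_nonneg[OF i]) (use f x in auto)
  show "integral {0..x} f \<le> integral {0..1} f"
    by (rule integral_subset_le) (use f x i in \<open>auto intro!: integrable_continuous_real\<close>)
qed

text \<open>The initial momentum is \<open>m * h\<close> and has mean \<open>m\<close>. For \<open>r = ln \<phi>\<^sub>x\<close>, the function \<open>W r\<close> is \<open>u\<^sub>x\<close> in
  Lagrangian coordinates. The integrals by which \<open>P r\<close> and \<open>Q r\<close> are normalised are conserved and equal
  to 1 along the flow, but normalising makes \<open>W\<close> bounded and globally Lipschitz.\<close>

locale lagrange =
  fixes h :: "real \<Rightarrow> real" and m :: real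
  assumes h_cont: "continuous_on UNIV h" and h_per: "\<And>x. h (x + 1) = h x"
    and h_nonneg: "\<And>x. h x \<ge> 0" and h_int: "integral {0..1} h = 1" and m_nz: "m \<noteq> 0"
begin

definition P :: "(real \<Rightarrow> real) \<Rightarrow> real \<Rightarrow> real" where
  "P r = normalised (\<lambda>x. exp (r x))"

text \<open>Conservation says that (q o phi) phi_x^3 is m h for the momentum q, so
  \<open>h x * exp (- 2 * r x)\<close> is (q o phi) phi_x divided by m.\<close>

definition Q :: "(real \<Rightarrow> real) \<Rightarrow> real \<Rightarrow> real" where
  "Q r = normalised (\<lambda>x. h x * exp (- 2 * r x))"

definition B :: "(real \<Rightarrow> real) \<Rightarrow> real \<Rightarrow> real" where
  "B r x = m * integral {0..x} (\<lambda>y. P r y - Q r y)"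

text \<open>The derivative of u_x o phi is (m - q o phi) phi_x, which is the derivative of
  \<open>B\<close> when both normalising integrals are 1. The subtracted constant enforces that u_x
  has mean zero in Eulerian coordinates.\<close>

definition W :: "(real \<Rightarrow> real) \<Rightarrow> real \<Rightarrow> real" where
  "W r x = B r x - integral {0..1} (\<lambda>x. B r x * P r x)"

lemma h_cont_on: "continuous_on S h"
  using h_cont continuous_on_subset by blast

context
  fixes r :: "real \<Rightarrow> real"
  assumes r: "continuous_on {0..1} r"
begin

lemma bounds_r: obtains R where "\<And>x. x \<in> {0..1} \<Longrightarrow> \<bar>r x\<bar> \<le> R"
proof -
  have "bounded (r ` {0..1})" using r compact_continuous_image compact_imp_bounded by blast
  then obtain b where "\<forall>y\<in>r ` {0..1}. norm y \<le> b" by (auto simp: bounded_iff)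
  then show ?thesis using that[of b] by auto
qed

lemma int_exp_pos: "integral {0..1} (\<lambda>x. exp (r x)) > 0"
proof -
  obtain R where R: "\<And>x. x \<in> {0..1} \<Longrightarrow> \<bar>r x\<bar> \<le> R" using bounds_r by blast
  have "exp (- R) = integral {0..1} (\<lambda>x::real. exp (- R))" by simp
  also have "\<dots> \<le> integral {0..1} (\<lambda>x. exp (r x))"
    by (rule integral_le) (use R in \<open>force intro!: integrable_continuous_real continuous_intros r simp: abs_le_iff\<close>)+
  finally show ?thesis using exp_gt_zero[of "- R"] by linarith
qed

lemma int_h_exp_pos: "integral {0..1} (\<lambda>x. h x * exp (- 2 * r x)) > 0"
proof -
  obtain R where R: "\<And>x. x \<in> {0..1} \<Longrightarrow> \<bar>r x\<bar> \<le> R" using bounds_r by blast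
  have "exp (- 2 * R) = integral {0..1} (\<lambda>x. h x * exp (- 2 * R))" using h_int by simp
  also have "\<dots> \<le> integral {0..1} (\<lambda>x. h x * exp (- 2 * r x))"
  proof (rule integral_le)
    show "h x * exp (- 2 * R) \<le> h x * exp (- 2 * r x)" if "x \<in> {0..1}" for x
      using R[OF that] h_nonneg by (intro mult_left_mono) auto
  qed (auto intro!: integrable_continuous_real continuous_intros r h_cont_on)
  finally show ?thesis using exp_gt_zero[of "- 2 * R"] by linarith
qed

lemma P_props: "continuous_on {0..1} (P r)" "\<And>x. x \<in> {0..1} \<Longrightarrow> P r x \<ge> 0" "integral {0..1} (P r) = 1"
  unfolding P_def by (rule normalised_props; auto intro!: continuous_intros r int_exp_pos)+

lemma Q_props: "continuous_on {0..1} (Q r)" "\<And>x. x \<in> {0..1} \<Longrightarrow> Q r x \<ge> 0" "integral {0..1} (Q r) = 1"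
proof -
  have c: "continuous_on {0..1} (\<lambda>x. h x * exp (- 2 * r x))" by (intro continuous_intros r h_cont_on)
  have p: "h x * exp (- 2 * r x) \<ge> 0" for x by (simp add: h_nonneg)
  show "continuous_on {0..1} (Q r)" "\<And>x. x \<in> {0..1} \<Longrightarrow> Q r x \<ge> 0" "integral {0..1} (Q r) = 1"
    unfolding Q_def using normalised_props[OF c p int_h_exp_pos] by auto
qed

lemma PQ_integrable: "x \<in> {0..1} \<Longrightarrow> P r integrable_on {0..x}" "x \<in> {0..1} \<Longrightarrow> Q r integrable_on {0..x}"
  by (rule integrable_continuous_real, rule continuous_on_subset[OF P_props(1)], force)
     (rule integrable_continuous_real, rule continuous_on_subset[OF Q_props(1)], force)

lemma B_0: "B r 0 = 0"
  by (simp add: B_def)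

lemma B_1: "B r 1 = 0"
  using P_props Q_props by (simp add: B_def integral_diff integrable_continuous_real)

text \<open>\<open>P r\<close> and \<open>Q r\<close> are probability densities, so their
  distribution functions lie between 0 and 1 and differ by at most 1. For \<open>Q r\<close> this
  rests on h >= 0, that is, on the sign of the momentum.\<close>

lemma B_bound: "x \<in> {0..1} \<Longrightarrow> \<bar>B r x\<bar> \<le> \<bar>m\<bar>"
proof -
  assume x: "x \<in> {0..1}"
  have "integral {0..x} (\<lambda>y. P r y - Q r y) = integral {0..x} (P r) - integral {0..x} (Q r)"
    by (rule integral_diff[OF PQ_integrable[OF x]])
  then have "\<bar>integral {0..x} (\<lambda>y. P r y - Q r y)\<bar> \<le> 1"
    using part_integral_bound[OF P_props(1,2) x] part_integral_bound[OF Q_props(1,2) x] P_props(3) Q_props(3)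
    by linarith
  then show ?thesis by (simp add: B_def abs_mult mult_left_le)
qed

lemma B_vderiv:
  assumes x: "x \<in> {0..1}"
  shows "(B r has_real_derivative m * (P r x - Q r x)) (at x within {0..1})"
  unfolding B_def
  by (intro DERIV_cmult integral_has_real_derivative continuous_on_diff P_props Q_props x)

lemma B_cont: "continuous_on {0..1} (B r)"
  using B_vderiv DERIV_continuous continuous_on_eq_continuous_within by blast

lemma W_cont: "continuous_on {0..1} (W r)"
  unfolding W_def by (intro continuous_intros B_cont)

lemma W_ends: "W r 0 = W r 1"
  by (simp add: W_def B_0 B_1)

lemma BP_bound: "\<bar>integral {0..1} (\<lambda>x. B r x * P r x)\<bar> \<le> \<bar>m\<bar>"
proof -
  have "norm (integral {0..1} (\<lambda>x. B r x * P r x)) \<le> integral {0..1} (\<lambda>x. \<bar>m\<bar> * P r x)"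
    by (rule integral_norm_bound_integral)
       (auto intro!: integrable_continuous_real continuous_intros B_cont P_props simp: abs_mult P_props(2) intro!: mult_right_mono B_bound)
  then show ?thesis using P_props(3) by simp
qed

lemma W_bound: "x \<in> {0..1} \<Longrightarrow> \<bar>W r x\<bar> \<le> 2 * \<bar>m\<bar>"
  using B_bound[of x] BP_bound unfolding W_def by linarith

lemma W_P_int: "integral {0..1} (\<lambda>x. W r x * P r x) = 0"
proof -
  have "integral {0..1} (\<lambda>x. W r x * P r x) =
      integral {0..1} (\<lambda>x. B r x * P r x) - integral {0..1} (\<lambda>x. integral {0..1} (\<lambda>x. B r x * P r x) * P r x)"
    unfolding W_def left_diff_distrib
    by (rule integral_diff) (auto intro!: integrable_continuous_real continuous_intros B_cont P_props)
  then show ?thesis using P_props(3) by simp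
qed

lemma W_vderiv:
  assumes x: "x \<in> {0..1}"
  shows "(W r has_real_derivative m * (P r x - Q r x)) (at x within {0..1})"
  unfolding W_def using B_vderiv[OF x] by (auto intro!: derivative_eq_intros)

text \<open>\<open>W\<close> times \<open>m (P - Q) = W'\<close> is the derivative of \<open>W\<^sup>2 / 2\<close>, which is periodic.\<close>

lemma W_Q_int: "integral {0..1} (\<lambda>x. W r x * Q r x) = 0"
proof -
  have "((\<lambda>x. W r x * (m * (P r x - Q r x))) has_integral ((W r 1)\<^sup>2 / 2 - (W r 0)\<^sup>2 / 2)) {0..1}"
  proof (rule fundamental_theorem_of_calculus)
    fix x :: real assume x: "x \<in> {0..1}"
    have "((\<lambda>x. (W r x)\<^sup>2 / 2) has_real_derivative W r x * (m * (P r x - Q r x))) (at x within {0..1})"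
      using W_vderiv[OF x] by (auto intro!: derivative_eq_intros)
    then show "((\<lambda>x. (W r x)\<^sup>2 / 2) has_vector_derivative W r x * (m * (P r x - Q r x))) (at x within {0..1})"
      by (simp add: has_real_derivative_iff_has_vector_derivative)
  qed simp
  then have "integral {0..1} (\<lambda>x. W r x * (m * (P r x - Q r x))) = 0"
    by (simp add: W_ends integral_unique)
  also have "(\<lambda>x. W r x * (m * (P r x - Q r x))) = (\<lambda>x. m * (W r x * P r x) - m * (W r x * Q r x))"
    by (simp add: algebra_simps)
  also have "integral {0..1} \<dots> = m * integral {0..1} (\<lambda>x. W r x * P r x) - m * integral {0..1} (\<lambda>x. W r x * Q r x)"
    by (subst integral_diff) (auto intro!: integrable_continuous_real continuous_intros W_cont P_props Q_props)
  finally show ?thesis using W_P_int m_nz by simp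
qed

end

lemma PQ_perturb:
  assumes r: "continuous_on {0..1} r" and r': "continuous_on {0..1} r'"
    and d: "\<And>x. x \<in> {0..1} \<Longrightarrow> \<bar>r' x - r x\<bar> \<le> e" and e: "e \<le> 1" and x: "x \<in> {0..1}"
  shows "\<bar>P r' x - P r x\<bar> \<le> 2 * exp 4 * e * P r x" "\<bar>Q r' x - Q r x\<bar> \<le> 4 * exp 4 * e * Q r x"
proof -
  have e0: "e \<ge> 0" using d[of 0] by auto
  have ex: "exp a \<le> exp c * exp b" if "a - b \<le> c" for a b c :: real
    using that by (simp flip: exp_add)
  have "\<bar>P r' x - P r x\<bar> \<le> (exp (2 * e) - 1) * P r x"
    unfolding P_def
  proof (rule normalised_perturbation[OF _ _ _ _ _ _ _ x])
    show "exp (r' y) \<le> exp e * exp (r y)" "exp (r y) \<le> exp e * exp (r' y)" if "y \<in> {0..1}" for y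
      using d[OF that] by (auto intro!: ex)
  qed (auto intro!: continuous_intros r r' int_exp_pos)
  also have "\<dots> \<le> (exp 4 * (2 * e)) * P r x"
    using e e0 P_props(2)[OF r x] by (intro mult_right_mono exp_minus_one_le) auto
  finally show "\<bar>P r' x - P r x\<bar> \<le> 2 * exp 4 * e * P r x" by (simp add: ac_simps)
  have "\<bar>Q r' x - Q r x\<bar> \<le> (exp (2 * (2 * e)) - 1) * Q r x"
    unfolding Q_def
  proof (rule normalised_perturbation[OF _ _ _ _ _ _ _ x])
    fix y :: real assume y: "y \<in> {0..1}"
    have "h y * exp (- 2 * r' y) \<le> h y * (exp (2 * e) * exp (- 2 * r y))"
      "h y * exp (- 2 * r y) \<le> h y * (exp (2 * e) * exp (- 2 * r' y))"
      using d[OF y] by (auto intro!: ex mult_left_mono h_nonneg)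
    then show "h y * exp (- 2 * r' y) \<le> exp (2 * e) * (h y * exp (- 2 * r y))"
      "h y * exp (- 2 * r y) \<le> exp (2 * e) * (h y * exp (- 2 * r' y))"
      by (simp_all only: ac_simps)
    show "0 \<le> h y * exp (- 2 * r y)" by (simp add: h_nonneg)
  qed (intro continuous_intros r r' h_cont_on int_h_exp_pos)+
  also have "\<dots> \<le> (exp 4 * (2 * (2 * e))) * Q r x"
    using e e0 Q_props(2)[OF r x] by (intro mult_right_mono exp_minus_one_le) auto
  finally show "\<bar>Q r' x - Q r x\<bar> \<le> 4 * exp 4 * e * Q r x" by (simp add: ac_simps)
qed

text \<open>For e > 1 the bound on \<open>W\<close> suffices. For e <= 1, in units of exp 4 * |m| *
  e, the relative errors 2 of \<open>P\<close> and 4 of \<open>Q\<close> give 6 for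
  \<open>B\<close>; the product B P in the subtracted mean costs a further 6 + 2, in total
  14.\<close>

lemma W_lipschitz:
  assumes r: "continuous_on {0..1} r" and r': "continuous_on {0..1} r'"
    and d: "\<And>x. x \<in> {0..1} \<Longrightarrow> \<bar>r' x - r x\<bar> \<le> e" and x: "x \<in> {0..1}"
  shows "\<bar>W r' x - W r x\<bar> \<le> 14 * exp 4 * \<bar>m\<bar> * e"
proof -
  have e0: "e \<ge> 0" using d[of 0] by auto
  let ?k = "exp 4 * e"
  show ?thesis
  proof (cases "e \<le> 1")
    case False
    have "\<bar>W r' x - W r x\<bar> \<le> 4 * \<bar>m\<bar>" using W_bound[OF r x] W_bound[OF r' x] by linarith
    also have "\<dots> \<le> (14 * exp 4) * \<bar>m\<bar>" using exp_ge_add_one_self[of 4] by (intro mult_right_mono) auto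
    also have "\<dots> \<le> (14 * exp 4) * \<bar>m\<bar> * e" using False mult_left_mono[of 1 e "14 * exp 4 * \<bar>m\<bar>"] by simp
    finally show ?thesis .
  next
    case True
    have pp: "\<bar>P r' x - P r x\<bar> \<le> 2 * exp 4 * e * P r x" "\<bar>Q r' x - Q r x\<bar> \<le> 4 * exp 4 * e * Q r x"
      if "x \<in> {0..1}" for x
      by (rule PQ_perturb[OF r r' _ True that], use d in blast)+
    have DB: "\<bar>B r' y - B r y\<bar> \<le> 6 * ?k * \<bar>m\<bar>" if y: "y \<in> {0..1}" for y
    proof -
      have sub: "{0..y} \<subseteq> {0..1}" using y by auto
      have c: "continuous_on {0..y} (P r)" "continuous_on {0..y} (Q r)" "continuous_on {0..y} (P r')" "continuous_on {0..y} (Q r')"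
        using P_props(1)[OF r] Q_props(1)[OF r] P_props(1)[OF r'] Q_props(1)[OF r'] continuous_on_subset[OF _ sub] by blast+
      have "B r' y - B r y = m * integral {0..y} (\<lambda>x. (P r' x - Q r' x) - (P r x - Q r x))"
        unfolding B_def
        by (subst integral_diff) (auto intro!: integrable_continuous_real continuous_intros c simp: algebra_simps)
      then have "\<bar>B r' y - B r y\<bar> = \<bar>m\<bar> * norm (integral {0..y} (\<lambda>x. (P r' x - Q r' x) - (P r x - Q r x)))"
        by (simp add: abs_mult)
      also have "\<dots> \<le> \<bar>m\<bar> * integral {0..y} (\<lambda>x. 2 * ?k * P r x + 4 * ?k * Q r x)"
      proof (intro mult_left_mono integral_norm_bound_integral)
        fix z assume "z \<in> {0..y}"
        then have "z \<in> {0..1}" using y by auto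
        from pp[OF this] show "norm (P r' z - Q r' z - (P r z - Q r z)) \<le> 2 * ?k * P r z + 4 * ?k * Q r z"
          by (simp add: mult.assoc)
      qed (auto intro!: integrable_continuous_real continuous_intros c)
      finally have 1: "\<bar>B r' y - B r y\<bar> \<le> \<bar>m\<bar> * integral {0..y} (\<lambda>x. 2 * ?k * P r x + 4 * ?k * Q r x)" .
      have "integral {0..y} (\<lambda>x. 2 * ?k * P r x + 4 * ?k * Q r x) =
          2 * ?k * integral {0..y} (P r) + 4 * ?k * integral {0..y} (Q r)"
        by (subst integral_add) (auto intro!: integrable_continuous_real continuous_intros c)
      also have "\<dots> \<le> 2 * ?k * 1 + 4 * ?k * 1"
        using part_integral_bound(2)[OF P_props(1,2)[OF r] y] part_integral_bound(2)[OF Q_props(1,2)[OF r] y]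
          P_props(3)[OF r] Q_props(3)[OF r] e0
        by (intro add_mono mult_left_mono) auto
      finally have "\<bar>m\<bar> * integral {0..y} (\<lambda>x. 2 * ?k * P r x + 4 * ?k * Q r x) \<le> \<bar>m\<bar> * (2 * ?k * 1 + 4 * ?k * 1)"
        by (rule mult_left_mono) simp
      then show ?thesis using 1 by (simp add: ac_simps)
    qed
    have "integral {0..1} (\<lambda>x. B r' x * P r' x) - integral {0..1} (\<lambda>x. B r x * P r x)
       = integral {0..1} (\<lambda>x. B r' x * P r' x - B r x * P r x)"
      by (subst integral_diff) (auto intro!: integrable_continuous_real continuous_intros B_cont P_props r r')
    then have "\<bar>integral {0..1} (\<lambda>x. B r' x * P r' x) - integral {0..1} (\<lambda>x. B r x * P r x)\<bar>
       = norm (integral {0..1} (\<lambda>x. B r' x * P r' x - B r x * P r x))" by simp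
    also have "\<dots> \<le> integral {0..1} (\<lambda>x. (8 * ?k * \<bar>m\<bar>) * P r x)"
    proof (rule integral_norm_bound_integral)
      fix z :: real assume z: "z \<in> {0..1}"
      have "B r' z * P r' z - B r z * P r z = B r' z * (P r' z - P r z) + (B r' z - B r z) * P r z"
        by (simp add: algebra_simps)
      then have "norm (B r' z * P r' z - B r z * P r z) \<le> \<bar>B r' z\<bar> * \<bar>P r' z - P r z\<bar> + \<bar>B r' z - B r z\<bar> * \<bar>P r z\<bar>"
        by (metis abs_mult abs_triangle_ineq real_norm_def)
      also have "\<dots> \<le> \<bar>m\<bar> * (2 * ?k * P r z) + (6 * ?k * \<bar>m\<bar>) * P r z"
        using pp(1)[OF z] P_props(2)[OF r z] DB[OF z] B_bound[OF r' z]
        by (intro add_mono mult_mono) (auto simp: mult.assoc)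
      finally show "norm (B r' z * P r' z - B r z * P r z) \<le> (8 * ?k * \<bar>m\<bar>) * P r z"
        by (simp add: algebra_simps)
    qed (auto intro!: integrable_continuous_real continuous_intros B_cont P_props r r')
    also have "\<dots> = 8 * ?k * \<bar>m\<bar>" using P_props(3)[OF r] by simp
    finally have "\<bar>W r' x - W r x\<bar> \<le> 6 * ?k * \<bar>m\<bar> + 8 * ?k * \<bar>m\<bar>"
      unfolding W_def using DB[OF x] by linarith
    then show ?thesis by (simp add: algebra_simps)
  qed
qed

text \<open>Extension by \<open>frac\<close> lets the field act on bounded continuous functions on
  the line, a Banach space. Equal end values of \<open>W\<close> make the extension continuous, and
  periodicity of the solution is recovered afterwards from the zero initial value.\<close>

definition F :: "(real \<Rightarrow>\<^sub>C real) \<Rightarrow> (real \<Rightarrow>\<^sub>C real)" where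
  "F r = Bcontfun (\<lambda>x. W (apply_bcontfun r) (frac x))"

lemma frac_in: "frac x \<in> {0..1::real}"
  by (simp add: frac_lt_1 less_imp_le)

lemma apply_F: "apply_bcontfun (F r) x = W (apply_bcontfun r) (frac x)"
proof -
  have r: "continuous_on {0..1} (apply_bcontfun r)" by simp
  have "(\<lambda>x. W (apply_bcontfun r) (frac x)) \<in> bcontfun"
  proof (rule bcontfun_normI)
    show "continuous_on UNIV (\<lambda>x. W (apply_bcontfun r) (frac x))"
      by (rule continuous_on_frac_extension[OF W_cont[OF r] W_ends[OF r]])
    show "norm (W (apply_bcontfun r) (frac x)) \<le> 2 * \<bar>m\<bar>" for x
      using W_bound[OF r frac_in] by simp
  qed
  then show ?thesis by (simp add: F_def Bcontfun_inverse)
qed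

lemma F_lipschitz: "norm (F r - F r') \<le> (14 * exp 4 * \<bar>m\<bar> + 1) * norm (r - r')"
proof -
  have "dist (F r) (F r') \<le> 14 * exp 4 * \<bar>m\<bar> * norm (r - r')"
  proof (rule dist_bound)
    fix x
    have "\<bar>W (apply_bcontfun r) (frac x) - W (apply_bcontfun r') (frac x)\<bar> \<le> 14 * exp 4 * \<bar>m\<bar> * norm (r - r')"
    proof (rule W_lipschitz[OF _ _ _ frac_in])
      show "\<bar>apply_bcontfun r x - apply_bcontfun r' x\<bar> \<le> norm (r - r')" for x
        using dist_bounded[of r x r'] by (simp add: dist_norm)
    qed auto
    then show "dist (apply_bcontfun (F r) x) (apply_bcontfun (F r') x) \<le> 14 * exp 4 * \<bar>m\<bar> * norm (r - r')"
      by (simp add: apply_F dist_real_def)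
  qed
  then show ?thesis by (simp add: dist_norm distrib_right add_increasing2)
qed

lemma lagrange_flow_exists:
  obtains r where "r 0 = 0" "\<And>t. (r has_vector_derivative F (r t)) (at t)"
proof (rule lipschitz_ode_global[of "14 * exp 4 * \<bar>m\<bar> + 1" F 0])
  show "0 < 14 * exp 4 * \<bar>m\<bar> + 1" by (rule add_nonneg_pos) auto
qed (use F_lipschitz that in auto)

end

subsection \<open>The Lagrangian flow\<close>

lemma bounded_linear_apply_bcontfun: "bounded_linear (\<lambda>f :: real \<Rightarrow>\<^sub>C real. apply_bcontfun f x)"
proof (rule bounded_linear_intro[where K = 1])
  fix f :: "real \<Rightarrow>\<^sub>C real"
  show "norm (apply_bcontfun f x) \<le> norm f * 1" using norm_bounded[of f x] by simp
qed (simp_all add: plus_bcontfun.rep_eq scaleR_bcontfun.rep_eq)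

text \<open>Continuity in \<open>t\<close> holds in the sup norm, hence uniformly in
  \<open>x\<close>; this combines with continuity in \<open>x\<close> at the limiting time.\<close>

lemma continuous_on_bcontfun_curve:
  fixes y :: "real \<Rightarrow> (real \<Rightarrow>\<^sub>C real)"
  assumes y: "continuous_on UNIV y"
  shows "continuous_on UNIV (\<lambda>(t, x). apply_bcontfun (y t) x)"
proof (rule continuous_at_imp_continuous_on, rule ballI)
  fix tx :: "real \<times> real"
  obtain t0 x0 where tx: "tx = (t0, x0)" by force
  have fst: "((\<lambda>p::real \<times> real. fst p) \<longlongrightarrow> t0) (at tx)" and snd: "((\<lambda>p::real \<times> real. snd p) \<longlongrightarrow> x0) (at tx)"
    unfolding tx by (auto intro!: tendsto_eq_intros)
  have "(y \<longlongrightarrow> y t0) (nhds t0)"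
    using y by (simp add: continuous_on_def flip: tendsto_at_iff_tendsto_nhds)
  then have "((\<lambda>p::real \<times> real. y (fst p)) \<longlongrightarrow> y t0) (at tx)"
    using fst by (rule filterlim_compose)
  then have "((\<lambda>p::real \<times> real. dist (y (fst p)) (y t0)) \<longlongrightarrow> 0) (at tx)"
    by (rule tendsto_dist_iff[THEN iffD1])
  then have 1: "((\<lambda>p. apply_bcontfun (y (fst p)) (snd p) - apply_bcontfun (y t0) (snd p)) \<longlongrightarrow> 0) (at tx)"
  proof (rule Lim_null_comparison[rotated])
    show "\<forall>\<^sub>F p in at tx. norm (apply_bcontfun (y (fst p)) (snd p) - apply_bcontfun (y t0) (snd p)) \<le> dist (y (fst p)) (y t0)"
      unfolding dist_norm[symmetric] by (intro always_eventually allI dist_bounded)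
  qed
  have "isCont (apply_bcontfun (y t0)) x0"
    by (metis UNIV_I continuous_on_apply_bcontfun continuous_on_eq_continuous_at open_UNIV)
  then have 2: "((\<lambda>p::real \<times> real. apply_bcontfun (y t0) (snd p)) \<longlongrightarrow> apply_bcontfun (y t0) x0) (at tx)"
    using snd by (rule isCont_tendsto_compose)
  have "((\<lambda>p. apply_bcontfun (y (fst p)) (snd p)) \<longlongrightarrow> apply_bcontfun (y t0) x0) (at tx)"
    using tendsto_add[OF 1 2] by simp
  then show "isCont (\<lambda>(t, x). apply_bcontfun (y t) x) tx"
    by (simp add: isCont_def tx case_prod_unfold)
qed

text \<open>The substitution makes the interval of integration independent of \<open>x\<close>, so
  that continuity of parameter integrals applies jointly in time and space.\<close>

lemma antider_stretch:
  fixes g :: "real \<Rightarrow> real"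
  assumes g: "continuous_on UNIV g"
  shows "antider g x = integral {0..1} (\<lambda>\<theta>. x * g (x * \<theta>))"
proof -
  have "((\<lambda>\<theta>. x * g (x * \<theta>)) has_integral (antider g (x * 1) - antider g (x * 0))) {0..1}"
  proof (rule fundamental_theorem_of_calculus)
    fix \<theta> :: real
    have "(antider g has_real_derivative g (x * \<theta>)) (at (x * \<theta>))"
      using antider_has_vderiv[OF g] by (simp add: has_real_derivative_iff_has_vector_derivative)
    moreover have "((\<lambda>\<theta>. x * \<theta>) has_real_derivative x) (at \<theta>)"
      using DERIV_cmult_Id[of x] by simp
    ultimately have "((\<lambda>\<theta>. antider g (x * \<theta>)) has_real_derivative g (x * \<theta>) * x) (at \<theta>)"
      by (rule DERIV_chain2)
    then show "((\<lambda>\<theta>. antider g (x * \<theta>)) has_vector_derivative x * g (x * \<theta>)) (at \<theta> within {0..1})"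
      by (auto simp: has_real_derivative_iff_has_vector_derivative mult.commute intro: has_vector_derivative_at_within)
  qed simp
  from integral_unique[OF this] show ?thesis by (simp only: mult_1_right mult_zero_right antider_0 diff_zero)
qed

lemma continuous_on_section:
  assumes "continuous_on UNIV (\<lambda>(t, x). f t x)"
  shows "continuous_on S (f t)"
proof -
  have "continuous_on S (\<lambda>x. (\<lambda>(t, x). f t x) (t, x))"
    by (rule continuous_on_compose2[OF assms]) (auto intro!: continuous_intros)
  then show ?thesis by simp
qed

lemma continuous_on_joint_compose:
  assumes "continuous_on UNIV (\<lambda>(t, x). f t x)" "continuous_on S a" "continuous_on S b"
  shows "continuous_on S (\<lambda>p. f (a p) (b p))"
proof -
  have "continuous_on S (\<lambda>p. (\<lambda>(t, x). f t x) (a p, b p))"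
    by (rule continuous_on_compose2[OF assms(1)]) (auto intro!: continuous_intros assms)
  then show ?thesis by simp
qed

lemma continuous_on_antider_joint:
  fixes f :: "real \<Rightarrow> real \<Rightarrow> real"
  assumes f: "continuous_on UNIV (\<lambda>(t, x). f t x)"
  shows "continuous_on UNIV (\<lambda>(t, x). antider (f t) x)"
proof -
  have "continuous_on UNIV (\<lambda>p::real \<times> real. integral (cbox 0 1) (\<lambda>\<theta>. snd p * f (fst p) (snd p * \<theta>)))"
    by (rule integral_continuous_on_param)
       (auto simp: case_prod_unfold intro!: continuous_intros continuous_on_joint_compose[OF f])
  then show ?thesis
    by (simp add: case_prod_unfold antider_stretch[OF continuous_on_section[OF f]])
qed

lemma circle_diffeo:
  fixes a :: real and p :: "real \<Rightarrow> real"
  assumes p: "continuous_on UNIV p" "\<And>x. p x > 0" "\<And>x. p (x + 1) = p x" "integral {0..1} p = 1"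
  defines "\<phi> \<equiv> \<lambda>x. a + antider p x"
  obtains \<psi> where "\<And>y. \<phi> (\<psi> y) = y" "\<And>x. \<psi> (\<phi> x) = x"
    "\<And>y. (\<psi> has_real_derivative 1 / p (\<psi> y)) (at y)" "\<And>y. \<psi> (y + 1) = \<psi> y + 1"
proof -
  have d: "(\<phi> has_real_derivative p x) (at x)" for x
    unfolding \<phi>_def using antider_has_vderiv[OF p(1)]
    by (auto simp: has_real_derivative_iff_has_vector_derivative[symmetric] intro!: derivative_eq_intros)
  have s: "\<phi> (x + 1) = \<phi> x + 1" for x
    unfolding \<phi>_def by (simp add: antider_shift[OF p(1,3)] p(4))
  have c: "isCont \<phi> x" for x using d DERIV_isCont by blast
  have mono: "\<phi> x < \<phi> y" if "x < y" for x y
    by (rule DERIV_pos_imp_increasing[OF that]) (use d p(2) in blast)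
  have inj: "x = y" if "\<phi> x = \<phi> y" for x y
    using that mono[of x y] mono[of y x] by linarith
  \<comment> \<open>Since \<open>\<phi>\<close> advances by 1 over each period,
    \<open>\<phi> x - x\<close> is periodic. The values at integers are therefore unbounded in both
    directions and bracket every target \<open>y\<close>.\<close>
  have int: "\<phi> (of_int k) = \<phi> 0 + of_int k" for k :: int
    using per1_frac[of "\<lambda>x. \<phi> x - x" "of_int k"] s by simp
  have surj: "\<exists>x. \<phi> x = y" for y
  proof -
    define k where "k = \<lfloor>y - \<phi> 0\<rfloor>"
    have "\<phi> (of_int k) \<le> y" "y \<le> \<phi> (of_int (k + 1))" unfolding int k_def by linarith+
    then have "\<exists>x\<ge>of_int k. x \<le> of_int (k + 1) \<and> \<phi> x = y"
      by (intro IVT) (use c in auto)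
    then show ?thesis by blast
  qed
  define \<psi> where "\<psi> y = (SOME x. \<phi> x = y)" for y
  have 1: "\<phi> (\<psi> y) = y" for y unfolding \<psi>_def using someI_ex[OF surj] .
  have 2: "\<psi> (\<phi> x) = x" for x using inj[OF 1] .
  have cc: "isCont \<psi> y" for y
  proof -
    have "isCont \<psi> (\<phi> (\<psi> y))"
      by (rule isCont_inverse_function[where d = 1]) (use 2 c in auto)
    then show ?thesis by (simp add: 1)
  qed
  have 3: "(\<psi> has_real_derivative 1 / p (\<psi> y)) (at y)" for y
    using DERIV_inverse_function[where f = \<phi> and g = \<psi> and D = "p (\<psi> y)" and x = y and a = "y - 1" and b = "y + 1"]
      d p(2)[of "\<psi> y"] 1 cc by (simp add: inverse_eq_divide)
  have 4: "\<psi> (y + 1) = \<psi> y + 1" for y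
    by (rule inj) (simp add: 1 s)
  show ?thesis using that 1 2 3 4 by blast
qed

lemma integral_period_shift:
  fixes g :: "real \<Rightarrow> 'a::banach"
  assumes "continuous_on UNIV g" "\<And>x. g (x + 1) = g x"
  shows "antider g (x + 1) - antider g x = integral {0..1} g"
  using antider_shift[OF assms] by simp

lemma circle_substitution:
  fixes g :: "real \<Rightarrow> 'a::banach"
  assumes p: "continuous_on UNIV p" "\<And>x. p (x + 1) = p x" "integral {0..1} p = 1"
    and g: "continuous_on UNIV g" "\<And>x. g (x + 1) = g x"
  shows "integral {0..1} (\<lambda>x. p x *\<^sub>R g (a + antider p x)) = integral {0..1} g"
proof -
  let ?f = "\<lambda>x. a + antider p x"
  have "((\<lambda>x. p x *\<^sub>R g (?f x)) has_integral ((antider g \<circ> ?f) 1 - (antider g \<circ> ?f) 0)) {0..1}"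
  proof (rule fundamental_theorem_of_calculus)
    fix x :: real
    have "(?f has_vector_derivative (0 + p x)) (at x)"
      by (intro has_vector_derivative_add has_vector_derivative_const antider_has_vderiv p)
    then have "((antider g \<circ> ?f) has_vector_derivative p x *\<^sub>R g (?f x)) (at x)"
      using vector_diff_chain_at[of ?f "p x" x "antider g" "g (?f x)"] antider_has_vderiv[OF g(1)] by simp
    then show "((antider g \<circ> ?f) has_vector_derivative p x *\<^sub>R g (?f x)) (at x within {0..1})"
      by (rule has_vector_derivative_at_within)
  qed simp
  moreover have "?f 1 = ?f 0 + 1" using antider_shift[OF p(1,2), of 0] p(3) by simp
  ultimately show ?thesis
    using integral_period_shift[OF g, of "?f 0"] by (simp add: integral_unique o_def)
qed

text \<open>\<open>R = ln \<phi>\<^sub>x\<close>, \<open>w = u\<^sub>x \<circ> \<phi>\<close>, \<open>p = \<phi>\<^sub>x\<close>, \<open>n = (q \<circ> \<phi>) \<phi>\<^sub>x\<close> and \<open>U = u \<circ> \<phi>\<close> live in Lagrangian coordinates, while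
  \<open>u\<close>, \<open>v = u\<^sub>x\<close> and the momentum \<open>q\<close> are Eulerian; \<open>\<psi>\<close> is the inverse of \<open>\<phi>\<close>.\<close>

locale lagrange_flow = lagrange +
  fixes rr :: "real \<Rightarrow> (real \<Rightarrow>\<^sub>C real)"
  assumes rr_0: "rr 0 = 0" and rr_deriv: "\<And>t. (rr has_vector_derivative F (rr t)) (at t)"
begin

definition R :: "real \<Rightarrow> real \<Rightarrow> real" where "R t x = apply_bcontfun (rr t) x"
definition w :: "real \<Rightarrow> real \<Rightarrow> real" where "w t x = apply_bcontfun (F (rr t)) x"
definition p :: "real \<Rightarrow> real \<Rightarrow> real" where "p t x = exp (R t x)"
definition n :: "real \<Rightarrow> real \<Rightarrow> real" where "n t x = m * (h x * exp (- 2 * R t x))"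

section \<open>Regularity, periodicity and conserved integrals of the Lagrangian variables\<close>

lemma rr_cont: "continuous_on UNIV rr"
  using rr_deriv has_vector_derivative_continuous by (meson continuous_at_imp_continuous_on)

lemma F_cont: "continuous_on UNIV F"
proof -
  have "(14 * exp 4 * \<bar>m\<bar> + 1)-lipschitz_on UNIV F"
    by (rule lipschitz_onI) (use F_lipschitz in \<open>auto simp: dist_norm\<close>)
  then show ?thesis by (rule lipschitz_on_continuous_on)
qed

lemma R_joint: "continuous_on UNIV (\<lambda>(t, x). R t x)"
  unfolding R_def by (rule continuous_on_bcontfun_curve[OF rr_cont])

lemma w_joint: "continuous_on UNIV (\<lambda>(t, x). w t x)"
  unfolding w_def
  by (rule continuous_on_bcontfun_curve) (auto intro: continuous_on_compose2[OF F_cont rr_cont])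

lemmas joint_intros = continuous_intros continuous_on_joint_compose[OF R_joint] continuous_on_joint_compose[OF w_joint]
  continuous_on_compose2[OF h_cont]

lemma R_cont: "continuous_on S (R t)"
  by (rule continuous_on_section[OF R_joint])

lemma w_cont: "continuous_on S (w t)"
  by (rule continuous_on_section[OF w_joint])

lemma p_cont: "continuous_on S (p t)"
  unfolding p_def by (intro continuous_intros R_cont)

lemma n_cont: "continuous_on S (n t)"
  unfolding n_def by (intro continuous_intros R_cont h_cont_on)

lemma R_deriv: "((\<lambda>t. R t x) has_real_derivative w t x) (at t)"
  unfolding R_def w_def has_real_derivative_iff_has_vector_derivative
  using bounded_linear.has_vector_derivative[OF bounded_linear_apply_bcontfun rr_deriv] .

lemma R_0: "R 0 x = 0"
  by (simp add: R_def rr_0)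

lemma w_W: "w t x = W (R t) (frac x)"
  by (simp add: w_def apply_F R_def[abs_def])

lemma w_W01: "x \<in> {0..1} \<Longrightarrow> w t x = W (R t) x"
  using W_ends[OF R_cont, of t] by (cases "x = 1") (auto simp: w_W frac_eq)

lemma w_per: "w t (x + 1) = w t x"
  by (simp add: w_W frac_1_eq)

lemma R_per: "R t (x + 1) = R t x"
proof -
  have "((\<lambda>t. R t (x + 1) - R t x) has_real_derivative w t (x + 1) - w t x) (at t)" for t
    by (intro derivative_intros R_deriv)
  then have "((\<lambda>t. R t (x + 1) - R t x) has_vector_derivative 0) (at t)" for t
    by (simp add: w_per has_real_derivative_iff_has_vector_derivative)
  from vderiv_zero_imp_const[OF this, of t 0] show ?thesis by (simp add: R_0)
qed

lemma p_per: "p t (x + 1) = p t x"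
  by (simp add: p_def R_per)

lemma n_per: "n t (x + 1) = n t x"
  by (simp add: n_def R_per h_per)

lemma p_pos: "p t x > 0"
  by (simp add: p_def)

lemma w_bound: "\<bar>w t x\<bar> \<le> 2 * \<bar>m\<bar>"
  unfolding w_W by (rule W_bound[OF R_cont frac_in])

lemma R_bound: "\<bar>R t x\<bar> \<le> 2 * \<bar>m\<bar> * \<bar>t\<bar>"
proof -
  have "norm (R t x - R 0 x) \<le> 2 * \<bar>m\<bar> * norm (t - 0)"
    by (rule field_differentiable_bound[of UNIV "\<lambda>t. R t x" "\<lambda>t. w t x"])
       (auto intro: R_deriv w_bound)
  then show ?thesis by (simp add: R_0)
qed

text \<open>The time derivative is a multiple of the integral of \<open>W * P\<close>, which the
  constant in \<open>W\<close> makes zero. Hence the normalisation built into \<open>P\<close>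
  equals 1 along the flow; \<open>hexp_int\<close> does the same for \<open>Q\<close> by means of
  \<open>W_Q_int\<close>.\<close>

lemma p_int: "integral {0..1} (p t) = 1"
proof -
  have "((\<lambda>t. integral (cbox 0 1) (p t)) has_real_derivative integral (cbox 0 1) (\<lambda>x. p t x * w t x)) (at t within UNIV)" for t
  proof (rule leibniz_rule_field_derivative)
    show "((\<lambda>t. p t x) has_real_derivative p t x * w t x) (at t within UNIV)" for t x
      unfolding p_def by (auto intro!: derivative_eq_intros R_deriv)
    show "p t integrable_on cbox 0 1" for t by (intro integrable_continuous p_cont)
    show "continuous_on (UNIV \<times> cbox 0 1) (\<lambda>(t, x). p t x * w t x)"
      unfolding p_def case_prod_unfold by (intro joint_intros)
  qed auto
  moreover have "integral (cbox 0 1) (\<lambda>x. p t x * w t x) = 0" for t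
  proof -
    define I where "I = integral {0..1} (\<lambda>x. exp (R t x))"
    have I: "I > 0" unfolding I_def by (rule int_exp_pos[OF R_cont])
    have "integral {0..1} (\<lambda>x. p t x * w t x) = integral {0..1} (\<lambda>x. I * (W (R t) x * P (R t) x))"
      by (rule Henstock_Kurzweil_Integration.integral_cong)
         (use I in \<open>auto simp: w_W01 p_def P_def normalised_def I_def[symmetric]\<close>)
    then show ?thesis using W_P_int[OF R_cont, of t] by simp
  qed
  ultimately have "((\<lambda>t. integral {0..1} (p t)) has_vector_derivative 0) (at t)" for t
    by (simp add: has_real_derivative_iff_has_vector_derivative)
  from vderiv_zero_imp_const[OF this, of t 0] show ?thesis by (simp add: p_def[abs_def] R_0)
qed

lemma hexp_int: "integral {0..1} (\<lambda>x. h x * exp (- 2 * R t x)) = 1"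
proof -
  let ?f = "\<lambda>t x. h x * exp (- 2 * R t x)"
  have "((\<lambda>t. integral (cbox 0 1) (?f t)) has_real_derivative integral (cbox 0 1) (\<lambda>x. ?f t x * (- 2 * w t x))) (at t within UNIV)" for t
  proof (rule leibniz_rule_field_derivative)
    show "((\<lambda>t. ?f t x) has_real_derivative ?f t x * (- 2 * w t x)) (at t within UNIV)" for t x
      by (auto intro!: derivative_eq_intros R_deriv)
    show "?f t integrable_on cbox 0 1" for t by (intro integrable_continuous continuous_intros R_cont h_cont_on)
    show "continuous_on (UNIV \<times> cbox 0 1) (\<lambda>(t, x). ?f t x * (- 2 * w t x))"
      unfolding case_prod_unfold by (intro joint_intros) auto
  qed auto
  moreover have "integral (cbox 0 1) (\<lambda>x. ?f t x * (- 2 * w t x)) = 0" for t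
  proof -
    define I where "I = integral {0..1} (?f t)"
    have I: "I > 0" unfolding I_def by (rule int_h_exp_pos[OF R_cont])
    have Q: "?f t x = I * Q (R t) x" for x using I by (simp only: Q_def normalised_def I_def[symmetric]) simp
    have "integral {0..1} (\<lambda>x. ?f t x * (- 2 * w t x)) = integral {0..1} (\<lambda>x. (- 2 * I) * (W (R t) x * Q (R t) x))"
      by (rule Henstock_Kurzweil_Integration.integral_cong) (simp only: Q w_W01, simp)
    then show ?thesis using W_Q_int[OF R_cont, of t] by simp
  qed
  ultimately have "((\<lambda>t. integral {0..1} (?f t)) has_vector_derivative 0) (at t)" for t
    by (simp add: has_real_derivative_iff_has_vector_derivative)
  from vderiv_zero_imp_const[OF this, of t 0] show ?thesis by (simp add: R_0 h_int)
qed

lemma n_int: "integral {0..1} (n t) = m"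
  unfolding n_def using hexp_int by simp

text \<open>Both normalising integrals are now 1, so \<open>P\<close> and \<open>Q\<close> may be
  replaced by the actual phi_x and (q o phi) phi_x / m.\<close>

lemma w_deriv: "(w t has_real_derivative m * p t x - n t x) (at x)"
proof -
  define g where "g x = m * p t x - n t x" for x
  have gc: "continuous_on S g" for S unfolding g_def by (intro continuous_intros p_cont n_cont)
  have gp: "g (x + 1) = g x" for x by (simp add: g_def p_per n_per)
  have gi: "integral {0..1} g = 0"
    unfolding g_def by (subst integral_diff) (auto intro!: integrable_continuous_real continuous_intros p_cont n_cont simp: p_int n_int)
  \<comment> \<open>A primitive on the whole line, periodic because \<open>g\<close> has mean zero.
    Agreement with \<open>w t\<close> on one period then extends everywhere and yields two-sided
    derivatives at the integers as well.\<close>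
  define f where "f x = w t 0 + antider g x" for x
  have f01: "w t x = f x" if x: "x \<in> {0..1}" for x
  proof -
    have sub: "{0..x} \<subseteq> {0..1}" using x by auto
    have "B (R t) x = m * integral {0..x} (\<lambda>y. P (R t) y - Q (R t) y)" by (simp add: B_def)
    also have "\<dots> = integral {0..x} (\<lambda>y. m * (P (R t) y - Q (R t) y))" by simp
    also have "\<dots> = integral {0..x} g"
      using p_int[of t] hexp_int[of t]
      by (intro Henstock_Kurzweil_Integration.integral_cong) (auto simp: P_def Q_def normalised_def g_def n_def p_def[abs_def] right_diff_distrib)
    also have "\<dots> = antider g x" using x by (simp add: antider_nonneg)
    finally have "B (R t) x = antider g x" .
    then show ?thesis using x w_W01[of x t] w_W01[of 0 t] by (simp add: f_def W_def B_0[OF R_cont])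
  qed
  have fper: "f (x + 1) = f x" for x
    unfolding f_def by (simp add: antider_shift[OF gc gp] gi)
  have "w t x = f x" for x
    using per1_frac[of "w t", OF w_per] per1_frac[of f, OF fper] f01[OF frac_in] by metis
  then have "w t = f" by auto
  moreover have "(f has_vector_derivative 0 + g x) (at x)"
    unfolding f_def[abs_def] by (intro has_vector_derivative_add has_vector_derivative_const antider_has_vderiv gc)
  ultimately show ?thesis
    by (simp add: has_real_derivative_iff_has_vector_derivative g_def)
qed

text \<open>The primitive of (u_x o phi) phi_x, that is, u o phi up to a function of time.\<close>

definition V :: "real \<Rightarrow> real \<Rightarrow> real" where "V t = antider (\<lambda>x. w t x * p t x)"
text \<open>That function of time, fixed by requiring the Eulerian velocity to have mean
  \<open>m\<close>.\<close>

definition c :: "real \<Rightarrow> real" where "c t = m - integral {0..1} (\<lambda>x. V t x * p t x)"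
definition U :: "real \<Rightarrow> real \<Rightarrow> real" where "U t x = c t + V t x"
text \<open>The trajectory of the particle labelled 0: \<open>V t 0 = 0\<close>, so its velocity is
  \<open>c t\<close>.\<close>

definition a where "a t = antider c t"
definition \<phi> where "\<phi> t x = a t + antider (p t) x"

lemma wp_cont: "continuous_on S (\<lambda>x. w t x * p t x)"
  by (intro continuous_intros w_cont p_cont)

lemma V_joint: "continuous_on UNIV (\<lambda>(t, x). V t x)"
  unfolding V_def
  by (rule continuous_on_antider_joint) (auto simp: case_prod_unfold p_def intro!: joint_intros)

lemma V_cont: "continuous_on S (V t)"
  by (rule continuous_on_section[OF V_joint])

lemma c_cont: "continuous_on UNIV c"
proof -
  have "continuous_on UNIV (\<lambda>t. integral (cbox 0 1) (\<lambda>x. V t x * p t x))"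
    by (rule integral_continuous_on_param)
       (auto simp: case_prod_unfold p_def intro!: joint_intros continuous_on_joint_compose[OF V_joint])
  then show ?thesis unfolding c_def by (auto intro!: continuous_intros)
qed

lemma U_joint: "continuous_on UNIV (\<lambda>(t, x). U t x)"
  unfolding U_def case_prod_unfold
  by (intro continuous_intros continuous_on_joint_compose[OF V_joint] continuous_on_compose2[OF c_cont]) auto

lemma \<phi>_joint: "continuous_on UNIV (\<lambda>(t, x). \<phi> t x)"
proof -
  have "continuous_on UNIV (\<lambda>(t, x). antider (p t) x)"
    by (rule continuous_on_antider_joint) (auto simp: case_prod_unfold p_def intro!: joint_intros)
  then show ?thesis
    unfolding \<phi>_def a_def case_prod_unfold
    by (intro continuous_intros continuous_on_compose2[OF continuous_on_antider[OF c_cont]]) auto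
qed

text \<open>On the unit interval \<open>antider\<close> is an integral over {0..x}, to which the
  Leibniz rule applies. One period suffices, because the result is used under an integral over
  it.\<close>

lemma \<phi>_deriv:
  assumes x: "x \<in> {0..1}"
  shows "((\<lambda>t. \<phi> t x) has_real_derivative U t x) (at t)"
proof -
  have "((\<lambda>t. integral (cbox 0 x) (p t)) has_real_derivative integral (cbox 0 x) (\<lambda>x. w t x * p t x)) (at t within UNIV)" for t
  proof (rule leibniz_rule_field_derivative)
    show "((\<lambda>t. p t x) has_real_derivative w t x * p t x) (at t within UNIV)" for t x
      unfolding p_def by (auto intro!: derivative_eq_intros R_deriv)
    show "p t integrable_on cbox 0 x" for t by (intro integrable_continuous p_cont)
    show "continuous_on (UNIV \<times> cbox 0 x) (\<lambda>(t, x). w t x * p t x)"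
      unfolding p_def case_prod_unfold by (intro joint_intros)
  qed auto
  moreover have "(a has_real_derivative c t) (at t)"
    unfolding a_def[abs_def] using antider_has_vderiv[OF c_cont] by (simp add: has_real_derivative_iff_has_vector_derivative)
  ultimately show ?thesis
    using x unfolding \<phi>_def U_def V_def by (auto simp: antider_nonneg intro!: DERIV_add)
qed

lemma V_per: "V t (x + 1) = V t x"
proof -
  have "integral {0..1} (\<lambda>x. w t x * p t x) = integral {0..1} (\<lambda>x. W (R t) x * P (R t) x)"
    using p_int[of t]
    by (intro Henstock_Kurzweil_Integration.integral_cong) (auto simp: w_W01 P_def normalised_def p_def[abs_def])
  then have "integral {0..1} (\<lambda>x. w t x * p t x) = 0" using W_P_int[OF R_cont, of t] by simp
  then show ?thesis
    unfolding V_def using antider_shift[OF wp_cont, of t x] by (simp add: w_per p_per)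
qed

lemma U_int: "integral {0..1} (\<lambda>x. p t x * U t x) = m"
proof -
  have "integral {0..1} (\<lambda>x. p t x * U t x) = integral {0..1} (\<lambda>x. c t * p t x + V t x * p t x)"
    by (simp add: U_def algebra_simps)
  also have "\<dots> = c t * integral {0..1} (p t) + integral {0..1} (\<lambda>x. V t x * p t x)"
    by (subst integral_add) (auto intro!: integrable_continuous_real continuous_intros p_cont V_cont)
  finally show ?thesis by (simp add: p_int c_def)
qed

lemma U_deriv: "(U t has_real_derivative w t x * p t x) (at x)"
  unfolding U_def[abs_def] V_def using antider_has_vderiv[OF wp_cont]
  by (auto simp: has_real_derivative_iff_has_vector_derivative[symmetric] intro!: derivative_eq_intros)

section \<open>Return to Eulerian variables\<close>

definition \<psi> where "\<psi> t = (SOME f. (\<forall>y. \<phi> t (f y) = y) \<and> (\<forall>x. f (\<phi> t x) = x) \<and>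
    (\<forall>y. (f has_real_derivative 1 / p t (f y)) (at y)) \<and> (\<forall>y. f (y + 1) = f y + 1))"

lemma \<psi>_props:
  "\<phi> t (\<psi> t y) = y" "\<psi> t (\<phi> t x) = x" "(\<psi> t has_real_derivative 1 / p t (\<psi> t y)) (at y)" "\<psi> t (y + 1) = \<psi> t y + 1"
proof -
  have "\<exists>f. (\<forall>y. \<phi> t (f y) = y) \<and> (\<forall>x. f (\<phi> t x) = x) \<and>
    (\<forall>y. (f has_real_derivative 1 / p t (f y)) (at y)) \<and> (\<forall>y. f (y + 1) = f y + 1)"
    unfolding \<phi>_def
    by (rule circle_diffeo[where p = "p t" and a = "a t", OF p_cont p_pos p_per p_int]) blast
  from someI_ex[OF this]
  show "\<phi> t (\<psi> t y) = y" "\<psi> t (\<phi> t x) = x" "(\<psi> t has_real_derivative 1 / p t (\<psi> t y)) (at y)" "\<psi> t (y + 1) = \<psi> t y + 1"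
    unfolding \<psi>_def[symmetric] by auto
qed

lemma \<psi>_cont: "continuous_on S (\<psi> t)"
  using \<psi>_props(3) DERIV_isCont continuous_at_imp_continuous_on by metis

definition u where "u t y = U t (\<psi> t y)"
definition v where "v t y = w t (\<psi> t y)"
definition q where "q t y = n t (\<psi> t y) / p t (\<psi> t y)"

lemma u_deriv: "(u t has_real_derivative v t y) (at y)"
proof -
  have "(u t has_real_derivative (w t (\<psi> t y) * p t (\<psi> t y)) * (1 / p t (\<psi> t y))) (at y)"
    unfolding u_def[abs_def] by (rule DERIV_chain2[OF U_deriv \<psi>_props(3)])
  then show ?thesis using p_pos[of t "\<psi> t y"] by (simp add: v_def)
qed

lemma v_deriv: "(v t has_real_derivative m - q t y) (at y)"
proof -
  have "(v t has_real_derivative (m * p t (\<psi> t y) - n t (\<psi> t y)) * (1 / p t (\<psi> t y))) (at y)"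
    unfolding v_def[abs_def] by (rule DERIV_chain2[OF w_deriv \<psi>_props(3)])
  then show ?thesis using p_pos[of t "\<psi> t y"] by (simp add: q_def field_simps)
qed

lemma u_per: "u t (y + 1) = u t y"
  by (simp add: u_def \<psi>_props U_def V_per)

lemma v_per: "v t (y + 1) = v t y"
  by (simp add: v_def \<psi>_props w_per)

lemma q_per: "q t (y + 1) = q t y"
  by (simp add: q_def \<psi>_props n_per p_per)

lemma u_cont: "continuous_on S (u t)"
  using u_deriv DERIV_isCont continuous_at_imp_continuous_on by metis

lemma v_cont: "continuous_on S (v t)"
  using v_deriv DERIV_isCont continuous_at_imp_continuous_on by metis

lemma q_cont: "continuous_on S (q t)"
  unfolding q_def using p_pos
  by (intro continuous_intros continuous_on_compose2[OF n_cont[of UNIV] \<psi>_cont] continuous_on_compose2[OF p_cont[of UNIV] \<psi>_cont])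
     (auto simp: less_imp_neq[symmetric])

lemma flow_substitution:
  fixes g :: "real \<Rightarrow> 'a::banach"
  assumes "continuous_on UNIV g" "\<And>x. g (x + 1) = g x"
  shows "integral {0..1} g = integral {0..1} (\<lambda>x. p t x *\<^sub>R g (\<phi> t x))"
  unfolding \<phi>_def by (rule circle_substitution[symmetric, OF p_cont p_per p_int assms])

lemma u_mean: "integral {0..1} (u t) = m"
  by (subst flow_substitution[where t = t, OF u_cont u_per]) (simp add: u_def \<psi>_props U_int)

lemma q_0: "q 0 y = m * h y"
proof -
  have a0: "a 0 = 0" by (simp add: a_def)
  have "p 0 = (\<lambda>x. 1)" by (auto simp: p_def R_0)
  then have p1: "p 0 x = 1" for x by simp
  have "antider (p 0) x = x" for x
    using antider_unique[OF p_cont[of _ 0], of "\<lambda>x. x" x] p1 by simp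
  then have "\<phi> 0 x = x" for x by (simp add: \<phi>_def a0)
  then have "\<psi> 0 y = y" using \<psi>_props(1)[of 0 y] by simp
  then show ?thesis by (simp add: q_def n_def R_0 p1)
qed

text \<open>The momentum is m h exp(-3 R) along the flow, and |R| grows at most linearly in time.
  This excludes blow-up of u_xx at any finite time.\<close>

lemma q_bound: "\<exists>K. \<forall>t y. \<bar>t\<bar> < T \<longrightarrow> \<bar>q t y\<bar> \<le> K"
proof -
  have "bounded (h ` {0..1})" using h_cont_on compact_continuous_image compact_imp_bounded by blast
  then obtain H where "\<forall>y\<in>h ` {0..1}. norm y \<le> H" by (auto simp: bounded_iff)
  then have H: "\<And>x. x \<in> {0..1} \<Longrightarrow> \<bar>h x\<bar> \<le> H" by auto
  have Hx: "\<bar>h x\<bar> \<le> H" for x using H[OF frac_in, of x] per1_frac[of h, OF h_per] by metis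
  have "\<bar>q t y\<bar> \<le> \<bar>m\<bar> * (H * exp (3 * (2 * \<bar>m\<bar> * T)))" if "\<bar>t\<bar> < T" for t y
  proof -
    have "2 * \<bar>m\<bar> * \<bar>t\<bar> \<le> 2 * \<bar>m\<bar> * T" using that by (intro mult_left_mono) auto
    then have R: "\<bar>R t x\<bar> \<le> 2 * \<bar>m\<bar> * T" for x using R_bound[of t x] by linarith
    have e: "exp (- 2 * r) / exp r = exp (- 3 * r)" for r :: real
    proof -
      have "- 3 * r = - 2 * r - r" by simp
      then show ?thesis by (simp only: exp_diff)
    qed
    have "q t y = m * (h (\<psi> t y) * exp (- 3 * R t (\<psi> t y)))"
      by (simp only: q_def n_def p_def e flip: times_divide_eq_right)
    then have "\<bar>q t y\<bar> = \<bar>m\<bar> * (\<bar>h (\<psi> t y)\<bar> * exp (- 3 * R t (\<psi> t y)))" by (simp add: abs_mult)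
    also have "\<dots> \<le> \<bar>m\<bar> * (H * exp (3 * (2 * \<bar>m\<bar> * T)))"
    proof (intro mult_left_mono mult_mono)
      show "exp (- 3 * R t (\<psi> t y)) \<le> exp (3 * (2 * \<bar>m\<bar> * T))"
        unfolding exp_le_cancel_iff using R[of "\<psi> t y"] by linarith
    qed (use Hx order_trans[OF abs_ge_zero Hx] in auto)
    finally show ?thesis .
  qed
  then show ?thesis by blast
qed

text \<open>The weak form of q_t = -(u q)_x - 2 u_x q. The function \<open>q\<close> is only known
  to be continuous, so it is not differentiated itself: after passing to Lagrangian coordinates all
  time dependence sits in \<open>n\<close> and in the exponential along
  \<open>\<phi>\<close>.\<close>

lemma q_coeff_deriv:
  "((\<lambda>t. cfc (\<lambda>y. of_real (q t y)) k) has_vector_derivative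
     (cfc (\<lambda>y. of_real (- 2 * (v t y * q t y))) k - dsym k * cfc (\<lambda>y. of_real (u t y * q t y)) k)) (at t)"
proof -
  let ?e = "\<lambda>t x. ek (- k) (\<phi> t x)"
  have qphi: "p t x * q t (\<phi> t x) = n t x" for t x
    using p_pos[of t x] by (simp add: q_def \<psi>_props)
  have sub: "cfc (\<lambda>y. of_real (g y)) k = integral {0..1} (\<lambda>x. of_real (p t x * g (\<phi> t x)) * ?e t x)"
    if "continuous_on UNIV g" "\<And>x. g (x + 1) = g x" for g t
    unfolding cfc_def
    by (subst flow_substitution[of _ t])
       (auto intro!: continuous_intros that simp: ek_per scaleR_conv_of_real mult.assoc)
  have eq: "cfc (\<lambda>y. of_real (q t y)) k = integral (cbox 0 1) (\<lambda>x. of_real (n t x) * ?e t x)" for t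
    using sub[of "q t" t] q_cont q_per by (simp add: qphi)
  define D where "D t x = of_real (- 2 * w t x * n t x) * ?e t x + of_real (n t x) * (of_real (U t x) * (dsym (- k) * ?e t x))" for t x
  have "((\<lambda>t. integral (cbox 0 1) (\<lambda>x. of_real (n t x) * ?e t x)) has_vector_derivative integral (cbox 0 1) (D t)) (at t within UNIV)"
  proof (rule leibniz_rule_vector_derivative)
    fix t x :: real assume x: "x \<in> cbox 0 1"
    have "((\<lambda>t. n t x) has_real_derivative - 2 * w t x * n t x) (at t)"
      unfolding n_def by (auto intro!: derivative_eq_intros R_deriv)
    then have 1: "((\<lambda>t. complex_of_real (n t x)) has_vector_derivative of_real (- 2 * w t x * n t x)) (at t)"
      by (rule has_vector_derivative_of_real[unfolded has_real_derivative_iff_has_vector_derivative[symmetric]])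
    have "((\<lambda>t. \<phi> t x) has_vector_derivative U t x) (at t)"
      using \<phi>_deriv[of x t] x by (simp add: has_real_derivative_iff_has_vector_derivative)
    from vector_diff_chain_at[OF this ek_has_vderiv, of "- k"]
    have 2: "((\<lambda>t. ?e t x) has_vector_derivative of_real (U t x) * (dsym (- k) * ?e t x)) (at t)"
      by (simp add: o_def scaleR_conv_of_real)
    show "((\<lambda>t. of_real (n t x) * ?e t x) has_vector_derivative D t x) (at t within UNIV)"
      using has_vector_derivative_mult[OF 1 2] by (simp add: D_def algebra_simps)
  next
    show "(\<lambda>x. of_real (n t x) * ?e t x) integrable_on cbox 0 1" for t
      by (intro integrable_continuous continuous_intros n_cont continuous_on_section[OF \<phi>_joint])
    show "continuous_on (UNIV \<times> cbox 0 1) (\<lambda>(t, x). D t x)"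
      unfolding D_def n_def case_prod_unfold
      by (intro joint_intros continuous_on_joint_compose[OF U_joint] continuous_on_joint_compose[OF \<phi>_joint]) auto
  qed auto
  moreover have "integral (cbox 0 1) (D t) = cfc (\<lambda>y. of_real (- 2 * (v t y * q t y))) k - dsym k * cfc (\<lambda>y. of_real (u t y * q t y)) k"
  proof -
    have e1: "p t x * (- 2 * (v t (\<phi> t x) * q t (\<phi> t x))) = - 2 * w t x * n t x" for x
      unfolding qphi[of t x, symmetric] by (simp add: v_def \<psi>_props)
    have e2: "p t x * (u t (\<phi> t x) * q t (\<phi> t x)) = n t x * U t x" for x
      unfolding qphi[of t x, symmetric] by (simp add: u_def \<psi>_props)
    have 1: "cfc (\<lambda>y. of_real (- 2 * (v t y * q t y))) k = integral {0..1} (\<lambda>x. of_real (- 2 * w t x * n t x) * ?e t x)"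
      unfolding e1[symmetric] by (rule sub) (auto intro!: continuous_intros v_cont q_cont simp: v_per q_per)
    have 2: "cfc (\<lambda>y. of_real (u t y * q t y)) k = integral {0..1} (\<lambda>x. of_real (n t x * U t x) * ?e t x)"
      unfolding e2[symmetric] by (rule sub) (auto intro!: continuous_intros u_cont q_cont simp: u_per q_per)
    have "integral {0..1} (D t) = integral {0..1} (\<lambda>x. of_real (- 2 * w t x * n t x) * ?e t x - dsym k * (of_real (n t x * U t x) * ?e t x))"
      by (rule Henstock_Kurzweil_Integration.integral_cong) (simp add: D_def dsym_minus algebra_simps)
    also have "\<dots> = integral {0..1} (\<lambda>x. of_real (- 2 * w t x * n t x) * ?e t x) - integral {0..1} (\<lambda>x. dsym k * (of_real (n t x * U t x) * ?e t x))"
      by (intro integral_diff integrable_continuous_real continuous_intros w_cont n_cont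
          continuous_on_section[OF \<phi>_joint] continuous_on_section[OF U_joint])
    finally show ?thesis unfolding 1 2 by simp
  qed
  ultimately show ?thesis unfolding eq by simp
qed

end

section \<open>Global solutions\<close>

subsection \<open>Twice differentiable periodic functions\<close>

definition periodic_C2 :: "(real \<Rightarrow> real) \<Rightarrow> (real \<Rightarrow> real) \<Rightarrow> (real \<Rightarrow> real) \<Rightarrow> bool" where
  "periodic_C2 f f' f'' \<longleftrightarrow> per1 f \<and> (\<forall>x. (f has_real_derivative f' x) (at x)) \<and>
     (\<forall>x. (f' has_real_derivative f'' x) (at x)) \<and> continuous_on UNIV f''"

lemma per1_derivative:
  assumes "per1 f" "\<And>x. (f has_real_derivative f' x) (at x)"
  shows "per1 f'"
proof -
  have "f' (x + 1) = f' x" for x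
  proof -
    have "((\<lambda>x. f (x + 1)) has_real_derivative f' (x + 1)) (at x)"
      using DERIV_shift[of f "f' (x + 1)" x 1] assms(2)[of "x + 1"] by simp
    then have "(f has_real_derivative f' (x + 1)) (at x)"
      using assms(1) by (simp add: per1_def)
    then show ?thesis using assms(2) DERIV_unique by blast
  qed
  then show ?thesis by (simp add: per1_def)
qed

lemma continuous_on_derivative:
  assumes "\<And>x. (f has_real_derivative f' x) (at x)"
  shows "continuous_on S f"
  using assms DERIV_isCont continuous_at_imp_continuous_on by metis

lemma periodic_C2D:
  assumes "periodic_C2 f f' f''"
  shows "per1 f" "per1 f'" "per1 f''" "(f has_real_derivative f' x) (at x)" "(f' has_real_derivative f'' x) (at x)"
    "continuous_on S f" "continuous_on S f'" "continuous_on S f''" "deriv f = f'" "deriv f' = f''"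
proof -
  have d: "\<And>x. (f has_real_derivative f' x) (at x)" "\<And>x. (f' has_real_derivative f'' x) (at x)"
    using assms by (auto simp: periodic_C2_def)
  show "per1 f" using assms by (simp add: periodic_C2_def)
  then show "per1 f'" using per1_derivative d by blast
  then show "per1 f''" using per1_derivative d by blast
  show "continuous_on S f''" using assms continuous_on_subset unfolding periodic_C2_def by blast
  show "deriv f = f'" "deriv f' = f''" using d DERIV_imp_deriv by blast+
qed (use assms continuous_on_derivative in \<open>auto simp: periodic_C2_def\<close>)

section \<open>Fourier coefficients of differentiable periodic functions\<close>

lemma cfc_derivative:
  assumes g: "\<And>x. (g has_vector_derivative g' x) (at x)" "\<And>x. g (x + 1) = g x" "continuous_on {0..1} g'"
  shows "cfc g' k = dsym k * cfc g k"
proof -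
  have gc: "continuous_on {0..1} g"
    using g(1) has_vector_derivative_continuous continuous_at_imp_continuous_on by blast
  have "((\<lambda>x. g x * (dsym (- k) * ek (- k) x) + g' x * ek (- k) x) has_integral (g 1 * ek (- k) 1 - g 0 * ek (- k) 0)) {0..1}"
    by (rule fundamental_theorem_of_calculus)
       (auto intro!: has_vector_derivative_mult ek_has_vderiv has_vector_derivative_at_within[OF g(1)])
  moreover have "g 1 = g 0" using g(2)[of 0] by simp
  ultimately have "integral {0..1} (\<lambda>x. g x * (dsym (- k) * ek (- k) x) + g' x * ek (- k) x) = 0"
    by (simp add: integral_unique)
  also have "integral {0..1} (\<lambda>x. g x * (dsym (- k) * ek (- k) x) + g' x * ek (- k) x) =
      integral {0..1} (\<lambda>x. dsym (- k) * (g x * ek (- k) x)) + integral {0..1} (\<lambda>x. g' x * ek (- k) x)"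
    by (subst integral_add[symmetric])
       (auto intro!: integrable_continuous_real continuous_intros gc g(3) simp: ac_simps)
  finally show ?thesis by (simp add: cfc_def dsym_minus)
qed

lemma of_real_vderiv:
  assumes "(f has_real_derivative f') (at x)"
  shows "((\<lambda>x. complex_of_real (f x)) has_vector_derivative of_real f') (at x)"
  using assms by (rule has_vector_derivative_of_real[unfolded has_real_derivative_iff_has_vector_derivative[symmetric]])

lemma fcoeff_derivative:
  assumes f: "\<And>x. (f has_real_derivative f' x) (at x)" and p: "per1 f" and c: "continuous_on {0..1} f'"
  shows "fcoeff f' k = dsym k * fcoeff f k"
  unfolding fcoeff_eq_cfc
  by (rule cfc_derivative) (use p in \<open>auto intro!: of_real_vderiv f continuous_intros c simp: per1_def\<close>)

lemma fcoeff_diff: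
  assumes "continuous_on {0..1} f" "continuous_on {0..1} g"
  shows "fcoeff (\<lambda>x. f x - g x) k = fcoeff f k - fcoeff g k"
  unfolding fcoeff_eq_cfc of_real_diff by (rule cfc_diff) (auto intro!: continuous_intros assms)

lemma fcoeff_add:
  assumes "continuous_on {0..1} f" "continuous_on {0..1} g"
  shows "fcoeff (\<lambda>x. f x + g x) k = fcoeff f k + fcoeff g k"
  unfolding fcoeff_eq_cfc of_real_add by (rule cfc_add) (auto intro!: continuous_intros assms)

lemma fcoeff_cmult: "fcoeff (\<lambda>x. c * f x) k = of_real c * fcoeff f k"
  unfolding fcoeff_eq_cfc of_real_mult by (rule cfc_cmult)

lemma fcoeff_const: "fcoeff (\<lambda>x. c) k = (if k = 0 then of_real c else 0)"
proof -
  have "fcoeff (\<lambda>x. c) k = of_real c * integral {0..1} (ek (- k))"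
    unfolding fcoeff_eq_cfc cfc_def by simp
  then show ?thesis by (simp add: integral_ek)
qed

lemma fcoeff_0:
  assumes "continuous_on {0..1} f"
  shows "fcoeff f 0 = of_real (mu f)"
proof -
  have "f integrable_on {0..1}" by (rule integrable_continuous_real[OF assms])
  from integral_linear[OF this bounded_linear_of_real]
  have "integral {0..1} (\<lambda>x. complex_of_real (f x)) = of_real (integral {0..1} f)"
    by (simp add: o_def)
  then show ?thesis by (simp add: fcoeff_eq_cfc cfc_def mu_def)
qed

lemma fcoeff_cnj:
  assumes "continuous_on {0..1} f"
  shows "fcoeff f (- k) = cnj (fcoeff f k)"
proof -
  have "(\<lambda>x. complex_of_real (f x) * ek (- k) x) integrable_on {0..1}"
    by (intro integrable_continuous_real continuous_intros assms)
  from integral_linear[OF this bounded_linear_cnj]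
  show ?thesis by (simp add: fcoeff_eq_cfc cfc_def o_def cnj_ek)
qed

lemma norm_fcoeff_le:
  assumes "continuous_on {0..1} f" "\<And>x. x \<in> {0..1} \<Longrightarrow> \<bar>f x\<bar> \<le> K"
  shows "norm (fcoeff f k) \<le> K"
proof -
  have "norm (fcoeff f k) \<le> integral {0..1} (\<lambda>x::real. K)"
    unfolding fcoeff_eq_cfc cfc_def
    by (rule integral_norm_bound_integral)
       (auto intro!: integrable_continuous_real continuous_intros assms simp: norm_mult)
  then show ?thesis by simp
qed

lemma fcoeff_inject:
  assumes f: "continuous_on UNIV f" "per1 f" and g: "continuous_on UNIV g" "per1 g"
    and eq: "\<And>k. fcoeff f k = fcoeff g k"
  shows "f = g"
proof
  fix x
  define d where "d x = complex_of_real (f x) - complex_of_real (g x)" for x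
  have c: "continuous_on {0..1} f" "continuous_on {0..1} g" using f(1) g(1) continuous_on_subset by blast+
  have dp: "d (x + 1) = d x" for x using f(2) g(2) by (simp add: d_def per1_def)
  have "d y = 0" if "y \<in> {0..1}" for y
  proof (rule fourier_unique[OF _ _ _ that])
    show "continuous_on {0..1} d" unfolding d_def by (intro continuous_intros c)
    show "d 0 = d 1" using dp[of 0] by simp
    show "cfc d k = 0" for k
      unfolding d_def using eq[of k] by (subst cfc_diff) (auto intro!: continuous_intros c simp: fcoeff_eq_cfc)
  qed
  then have "d (frac x) = 0" by (simp add: frac_lt_1 less_imp_le)
  then have "d x = 0" using per1_frac[of d, OF dp] by simp
  then show "f x = g x" by (simp add: d_def)
qed

lemma periodic_C2_fcoeff_derivs:
  assumes "periodic_C2 f f' f''"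
  shows "fcoeff f' k = dsym k * fcoeff f k" "fcoeff f'' k = dsym k * (dsym k * fcoeff f k)"
proof -
  note c = periodic_C2D[OF assms]
  show 1: "fcoeff f' k = dsym k * fcoeff f k" by (rule fcoeff_derivative[OF c(4) c(1) c(7)])
  have "fcoeff f'' k = dsym k * fcoeff f' k" by (rule fcoeff_derivative[OF c(5) c(2) c(8)])
  then show "fcoeff f'' k = dsym k * (dsym k * fcoeff f k)" by (simp add: 1)
qed

text \<open>The sup bound on f'' gives decay of order k^(-2) for each coefficient, and through
  Bessel a square-summable sequence k^2 a_k. Then |k a_k| is at most y / |k| with y the size of the
  coefficient of f'', and y / |k| <= k^(-2) + y^2 is summable. The bound on the mean takes care of
  frequency 0.\<close>

lemma periodic_C2_seq_bound:
  assumes f: "periodic_C2 f f' f''" and K: "\<And>x. \<bar>f'' x\<bar> \<le> K" and K0: "\<bar>mu f\<bar> \<le> K0"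
  shows "seq_bound (K + K0 + K\<^sup>2 + 2 * (\<Sum>\<^sub>\<infinity>k::int. 1 / (1 + (real_of_int k)\<^sup>2))) (fcoeff f)"
proof -
  let ?S = "\<Sum>\<^sub>\<infinity>k::int. 1 / (1 + (real_of_int k)\<^sup>2)"
  note c = periodic_C2D[OF f] and d = periodic_C2_fcoeff_derivs[OF f]
  have K_nn: "K \<ge> 0" using K[of 0] by linarith
  have K0_nn: "K0 \<ge> 0" using K0 by linarith
  have S_nn: "?S \<ge> 0" by (intro infsum_nonneg) auto
  have b: "norm (fcoeff f'' k) \<le> K" for k by (rule norm_fcoeff_le[OF c(8)]) (rule K)
  have bess: "(\<Sum>k\<in>A. (norm (fcoeff f'' k))\<^sup>2) \<le> K\<^sup>2" if "finite A" for A
    unfolding fcoeff_eq_cfc by (rule bessel[OF _ _ that]) (auto intro!: continuous_intros c K)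
  have bs: "(\<lambda>k. (norm (fcoeff f'' k))\<^sup>2) summable_on UNIV"
    by (rule nonneg_bdd_above_summable_on) (use bess in \<open>auto simp: bdd_above_def\<close>)
  have bi: "(\<Sum>\<^sub>\<infinity>k. (norm (fcoeff f'' k))\<^sup>2) \<le> K\<^sup>2"
    by (rule infsum_le_finite_sums[OF bs]) (use bess in auto)
  have ab: "real_of_int k ^ 2 * norm (fcoeff f k) \<le> norm (fcoeff f'' k)" for k
  proof -
    have "norm (fcoeff f'' k) = (2 * pi)\<^sup>2 * ((real_of_int k)\<^sup>2 * norm (fcoeff f k))"
      by (simp add: d norm_mult norm_dsym power2_eq_square)
    moreover have "1 \<le> (2 * pi)\<^sup>2" using pi_gt3 by (intro one_le_power) auto
    ultimately show ?thesis using mult_right_mono[of 1 "(2 * pi)\<^sup>2" "(real_of_int k)\<^sup>2 * norm (fcoeff f k)"] by simp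
  qed
  have f0: "norm (fcoeff f 0) \<le> K0" using K0 fcoeff_0[OF c(6)] by simp
  have k1: "1 \<le> (real_of_int k)\<^sup>2" if "k \<noteq> 0" for k
  proof -
    have "1 \<le> \<bar>real_of_int k\<bar>" using that by linarith
    then show ?thesis by (metis one_le_power power2_abs)
  qed
  have C: "((\<lambda>k. 2 * (1 / (1 + (real_of_int k)\<^sup>2)) + (norm (fcoeff f'' k))\<^sup>2) has_sum (2 * ?S + (\<Sum>\<^sub>\<infinity>k. (norm (fcoeff f'' k))\<^sup>2))) UNIV"
    by (intro has_sum_add has_sum_cmult_right has_sum_infsum summable_inverse_squares bs)
  have le: "\<bar>of_int k\<bar> * norm (fcoeff f k) \<le> 2 * (1 / (1 + (real_of_int k)\<^sup>2)) + (norm (fcoeff f'' k))\<^sup>2" for k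
  proof (cases "k = 0")
    case False
    define x y where "x = \<bar>real_of_int k\<bar>" and "y = norm (fcoeff f'' k)"
    have x: "x \<ge> 1" using False unfolding x_def by linarith
    have "x * (x * norm (fcoeff f k)) \<le> y" using ab[of k] by (simp add: x_def y_def power2_eq_square mult.assoc[symmetric])
    then have "x * norm (fcoeff f k) \<le> y / x" using x by (simp add: field_simps)
    also have "y / x \<le> 1 / x\<^sup>2 + y\<^sup>2"
    proof -
      have "0 \<le> (1 / x - y)\<^sup>2" by simp
      then have "2 * (y / x) \<le> 1 / x\<^sup>2 + y\<^sup>2" by (simp add: power2_diff power_divide)
      moreover have "0 \<le> 1 / x\<^sup>2 + y\<^sup>2" by simp
      ultimately show ?thesis by linarith
    qed
    also have "1 / x\<^sup>2 \<le> 2 * (1 / (1 + x\<^sup>2))"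
    proof -
      have x2: "1 \<le> x\<^sup>2" using x by simp
      then have "0 < x\<^sup>2" by linarith
      then have "2 / (2 * x\<^sup>2) \<le> 2 / (1 + x\<^sup>2)"
        using x2 by (intro divide_left_mono mult_pos_pos add_pos_nonneg) auto
      then show ?thesis by simp
    qed
    finally show ?thesis by (simp add: x_def y_def)
  qed simp
  have sm: "(\<lambda>k. \<bar>of_int k\<bar> * norm (fcoeff f k)) summable_on UNIV"
    by (rule summable_on_comparison_test[OF has_sum_imp_summable[OF C] le]) simp
  have "(\<Sum>\<^sub>\<infinity>k. \<bar>of_int k\<bar> * norm (fcoeff f k)) \<le> 2 * ?S + K\<^sup>2"
    using has_sum_mono[OF has_sum_infsum[OF sm] C le] bi by linarith
  moreover have "norm (fcoeff f k) * (1 + (of_int k)\<^sup>2) \<le> K + K0 + K\<^sup>2" for k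
  proof (cases "k = 0")
    case True
    have "norm (fcoeff f 0) \<le> K + K0 + K\<^sup>2" using f0 K_nn zero_le_power2[of K] by linarith
    then show ?thesis using True by simp
  next
    case False
    have nn: "norm (fcoeff f k) * 1 \<le> norm (fcoeff f k) * (of_int k)\<^sup>2" using k1[OF False] by (intro mult_left_mono) auto
    have "2 * (norm (fcoeff f k) * (of_int k)\<^sup>2) \<le> norm (fcoeff f'' k)"
    proof -
      have "norm (fcoeff f'' k) = (2 * pi)\<^sup>2 * ((real_of_int k)\<^sup>2 * norm (fcoeff f k))"
        by (simp add: d norm_mult norm_dsym power2_eq_square)
      moreover have "2 \<le> (2 * pi)\<^sup>2"
      proof -
        have "2 * 2 \<le> (2 * pi) * (2 * pi)" using pi_gt3 by (intro mult_mono) auto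
        then show ?thesis by (simp add: power2_eq_square)
      qed
      ultimately show ?thesis using mult_right_mono[of 2 "(2 * pi)\<^sup>2" "(real_of_int k)\<^sup>2 * norm (fcoeff f k)"]
        by (simp add: mult.commute)
    qed
    then have "norm (fcoeff f k) * (1 + (of_int k)\<^sup>2) \<le> K" using b[of k] nn by (simp add: distrib_left)
    then show ?thesis using K0_nn zero_le_power2[of K] by linarith
  qed
  ultimately show ?thesis
    unfolding seq_bound_def using sm S_nn K_nn K0_nn by (smt (verit) zero_le_power2)
qed

lemma fcoeff_mult_conv:
  assumes f: "continuous_on UNIV f" "per1 f" "(\<lambda>k. norm (fcoeff f k)) summable_on UNIV"
    and g: "continuous_on {0..1} g"
  shows "fcoeff (\<lambda>x. f x * g x) k = conv (fcoeff f) (fcoeff g) k"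
proof -
  have e: "fcoeff f = cfc (\<lambda>x. of_real (f x))" for f by (auto simp: fcoeff_eq_cfc)
  show ?thesis unfolding e of_real_mult
    by (rule cfc_mult) (use f g in \<open>auto intro!: continuous_intros simp: per1_def e\<close>)
qed

lemma fcoeff_transport:
  assumes f: "periodic_C2 u u' u''"
  shows "fcoeff (\<lambda>x. u x * u' x) k = dsym k / 2 * conv (fcoeff u) (fcoeff u) k"
proof -
  note c = periodic_C2D[OF f]
  have "bounded (u'' ` {0..1})" using c(8) compact_continuous_image compact_imp_bounded by blast
  then obtain K where "\<forall>y\<in>u'' ` {0..1}. norm y \<le> K" by (auto simp: bounded_iff)
  then have K: "\<bar>u'' x\<bar> \<le> K" for x
    using per1_frac[of u'' x] c(3) frac_lt_1[of x] by (metis atLeastAtMost_iff frac_ge_0 imageI less_imp_le per1_def real_norm_def)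
  have as: "(\<lambda>k. norm (fcoeff u k)) summable_on UNIV"
    using periodic_C2_seq_bound[OF f K order_refl] by (rule seq_boundD(6))
  have "fcoeff (\<lambda>x. 2 * (u x * u' x)) k = dsym k * fcoeff (\<lambda>x. u x * u x) k"
  proof (rule fcoeff_derivative)
    show "((\<lambda>x. u x * u x) has_real_derivative 2 * (u x * u' x)) (at x)" for x
      using c(4) by (auto intro!: derivative_eq_intros)
  qed (use c in \<open>auto intro!: continuous_intros simp: per1_def\<close>)
  also have "fcoeff (\<lambda>x. u x * u x) k = conv (fcoeff u) (fcoeff u) k"
    by (rule fcoeff_mult_conv[OF c(6) c(1) as c(6)])
  finally have "of_real 2 * fcoeff (\<lambda>x. u x * u' x) k = dsym k * conv (fcoeff u) (fcoeff u) k"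
    unfolding fcoeff_cmult .
  then show ?thesis by (simp add: field_simps)
qed

subsection \<open>The inverse of the inertia operator\<close>

lemma periodic_C2_eqI:
  assumes f: "periodic_C2 f f' d" and g: "periodic_C2 g g' d" and m: "mu f = mu g"
  shows "f = g"
proof (rule fcoeff_inject)
  fix k
  show "fcoeff f k = fcoeff g k"
  proof (cases "k = 0")
    case True
    then show ?thesis using fcoeff_0[OF periodic_C2D(6)[OF f]] fcoeff_0[OF periodic_C2D(6)[OF g]] m by simp
  next
    case False
    have "dsym k * (dsym k * fcoeff f k) = dsym k * (dsym k * fcoeff g k)"
      unfolding periodic_C2_fcoeff_derivs(2)[OF f, symmetric] periodic_C2_fcoeff_derivs(2)[OF g, symmetric] ..
    then show ?thesis using False by auto
  qed
qed (use periodic_C2D[OF f] periodic_C2D[OF g] in auto)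

lemma periodic_antiderivative:
  fixes g :: "real \<Rightarrow> real"
  assumes g: "continuous_on UNIV g" "per1 g" "mu g = 0"
  obtains G where "per1 G" "\<And>x. (G has_real_derivative g x) (at x)" "mu G = c"
proof -
  have gp: "g (x + 1) = g x" for x using g(2) by (simp add: per1_def)
  have d: "(antider g has_real_derivative g x) (at x)" for x
    using antider_has_vderiv[OF g(1)] by (simp add: has_real_derivative_iff_has_vector_derivative)
  define G where "G x = antider g x + (c - mu (antider g))" for x
  show ?thesis
  proof
    show "per1 G" using antider_shift[OF g(1) gp] g(3) by (simp add: per1_def G_def mu_def)
    show "(G has_real_derivative g x) (at x)" for x
      using DERIV_add[OF d DERIV_const] unfolding G_def[abs_def] by simp
    have "integral {0..1} G = integral {0..1} (antider g) + integral {0..1} (\<lambda>x::real. c - mu (antider g))"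
      unfolding G_def[abs_def]
      by (intro Henstock_Kurzweil_Integration.integral_add integrable_continuous_real continuous_on_antider g continuous_on_const)
    then show "mu G = c" by (simp add: mu_def)
  qed
qed

text \<open>Integrating the equation for w'' over a period forces \<open>mu w = mu f\<close>. The
  specification thus becomes w'' = mu f - f with prescribed mean, solved by two periodic primitives,
  the first with mean 0 so that it can be integrated again. Uniqueness justifies the definite
  description.\<close>

lemma Lam_inv_props:
  assumes f: "continuous_on UNIV f" "per1 f"
  defines "w \<equiv> Lam_inv f"
  shows "periodic_C2 w (deriv w) (\<lambda>x. mu f - f x)" "mu w = mu f"
proof -
  have fc: "continuous_on {0..1} f" using f(1) continuous_on_subset by blast
  let ?spec = "\<lambda>w. per1 w \<and> (\<forall>x. (w has_real_derivative deriv w x) (at x)) \<and>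
                       (\<forall>x. (deriv w has_real_derivative (mu w - f x)) (at x))"
  have mean: "mu w = mu f" if "?spec w" for w
  proof -
    have wc: "continuous_on {0..1} w" using that continuous_on_derivative by blast
    have "per1 (deriv w)" using that per1_derivative by blast
    then have e: "deriv w 1 = deriv w 0" using per1_def[of "deriv w"] by (metis add_0)
    have "((\<lambda>x. mu w - f x) has_integral (deriv w 1 - deriv w 0)) {0..1}"
      using that by (intro fundamental_theorem_of_calculus)
        (auto simp: has_real_derivative_iff_has_vector_derivative intro: has_vector_derivative_at_within)
    then have "integral {0..1} (\<lambda>x. mu w - f x) = 0" by (simp add: e integral_unique)
    moreover have "integral {0..1} (\<lambda>x. mu w - f x) = mu w - mu f"
      by (subst integral_diff) (auto intro!: integrable_continuous_real fc simp: mu_def)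
    ultimately show ?thesis by simp
  qed
  have C2: "periodic_C2 w (deriv w) (\<lambda>x. mu f - f x)" if "?spec w" for w
    unfolding periodic_C2_def using that mean[OF that] f by (auto intro!: continuous_intros)
  have "mu (\<lambda>x. mu f - f x) = 0"
    unfolding mu_def[of "\<lambda>x. mu f - f x"] by (subst integral_diff) (auto intro!: integrable_continuous_real fc simp: mu_def)
  moreover have "continuous_on UNIV (\<lambda>x. mu f - f x)" by (intro continuous_intros f)
  moreover have "per1 (\<lambda>x. mu f - f x)" using f(2) by (simp add: per1_def)
  ultimately obtain G where G: "per1 G" "\<And>x. (G has_real_derivative mu f - f x) (at x)" "mu G = 0"
    using periodic_antiderivative[of "\<lambda>x. mu f - f x" 0] by blast
  obtain w0 where w0: "per1 w0" "\<And>x. (w0 has_real_derivative G x) (at x)" "mu w0 = mu f"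
    using periodic_antiderivative[of G "mu f", OF continuous_on_derivative[OF G(2)] G(1) G(3)] by blast
  have dw: "deriv w0 = G" using w0(2) DERIV_imp_deriv by blast
  have s0: "?spec w0" using w0 G by (simp add: dw)
  have "?spec w"
    unfolding w_def Lam_inv_def
  proof (rule theI[where a = w0])
    show "?spec w0" by (rule s0)
    fix x assume x: "?spec x"
    show "x = w0" by (rule periodic_C2_eqI[OF C2[OF x] C2[OF s0]]) (simp add: mean[OF x] mean[OF s0])
  qed
  then show "periodic_C2 w (deriv w) (\<lambda>x. mu f - f x)" "mu w = mu f" using C2 mean by auto
qed

lemma fcoeff_deriv_Lam_inv:
  assumes f: "continuous_on UNIV f" "per1 f"
  shows "fcoeff (deriv (Lam_inv f)) k = - (fcoeff f k / dsym k)"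
proof (cases "k = 0")
  case True
  \<comment> \<open>Division by \<open>dsym 0\<close> gives 0, which is the correct mean of a
    periodic derivative.\<close>
  then show ?thesis using periodic_C2_fcoeff_derivs(1)[OF Lam_inv_props(1)[OF f], of k] by simp
next
  case False
  have fc: "continuous_on {0..1} f" using f(1) continuous_on_subset by blast
  note c = periodic_C2D[OF Lam_inv_props(1)[OF f]]
  have "fcoeff (\<lambda>x. mu f - f x) k = dsym k * fcoeff (deriv (Lam_inv f)) k"
    by (rule fcoeff_derivative[OF c(5) c(2) c(8)])
  moreover have "fcoeff (\<lambda>x. mu f - f x) k = - fcoeff f k"
    using fcoeff_diff[of "\<lambda>x. mu f" f k] fc False by (simp add: fcoeff_const)
  ultimately show ?thesis using False by (simp add: field_simps)
qed

text \<open>The operator \<open>3 m \<partial>\<^sub>x \<Lambda>\<^sup>-\<^sup>2\<close> has the Fourier symbol \<open>\<i> * gam m k\<close>; \<open>gam m 0 = 0\<close> since \<open>x / 0 = 0\<close>.\<close>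

definition gam :: "real \<Rightarrow> int \<Rightarrow> real" where
  "gam m k = 3 * m / (2 * pi * real_of_int k)"

lemma abs_gam_le: "\<bar>gam m k\<bar> \<le> \<bar>m\<bar>"
proof (cases "k = 0")
  case False
  then have "1 \<le> \<bar>real_of_int k\<bar>" by linarith
  then have "3 * 1 \<le> (2 * pi) * \<bar>real_of_int k\<bar>" using pi_gt3 by (intro mult_mono) auto
  then have "3 * \<bar>m\<bar> / (2 * pi * \<bar>real_of_int k\<bar>) \<le> \<bar>m\<bar>"
    using mult_right_mono[of "3 * 1" "(2 * pi) * \<bar>real_of_int k\<bar>" "\<bar>m\<bar>"]
    by (simp add: divide_le_eq mult.commute mult.left_commute)
  then show ?thesis by (simp add: gam_def abs_mult)
qed (simp add: gam_def)

lemma fcoeff_muDP_velocity: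
  assumes u: "periodic_C2 u u' u''"
  shows "fcoeff (\<lambda>x. - (u x * u' x) - 3 * m * deriv (Lam_inv u) x) k = muDP_rhs (gam m) (fcoeff u) k"
proof -
  note c = periodic_C2D[OF u]
  have wc: "continuous_on S (deriv (Lam_inv u))" for S
    by (rule periodic_C2D(7)[OF Lam_inv_props(1)[OF c(6) c(1)]])
  have "fcoeff (\<lambda>x. - (u x * u' x) - 3 * m * deriv (Lam_inv u) x) k =
     fcoeff (\<lambda>x. (- 1) * (u x * u' x)) k - fcoeff (\<lambda>x. (3 * m) * deriv (Lam_inv u) x) k"
    by (subst fcoeff_diff[symmetric]) (auto intro!: continuous_intros c wc)
  also have "\<dots> = - (dsym k / 2 * conv (fcoeff u) (fcoeff u) k) + of_real (3 * m) * (fcoeff u k / dsym k)"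
    unfolding fcoeff_cmult fcoeff_transport[OF u] fcoeff_deriv_Lam_inv[OF c(6) c(1)] by simp
  also have "of_real (3 * m) * (fcoeff u k / dsym k) = - \<i> * of_real (gam m k) * fcoeff u k"
    by (cases "k = 0") (auto simp: gam_def dsym_def field_simps)
  finally show ?thesis by (simp add: muDP_rhs_def)
qed

subsection \<open>Periodic Sobolev functions\<close>

lemma Hs_iff: "f \<in> Hs s \<longleftrightarrow> per1 f \<and> continuous_on UNIV f \<and> hsum s (fcoeff f)"
  by (simp add: Hs_def hsum_def)

lemma hs_norm_eq: "hs_norm s f = sqrt (hs2 s (fcoeff f))"
  by (simp add: hs_norm_def hs2_def)

lemma Hs_continuous: "f \<in> Hs s \<Longrightarrow> continuous_on S f"
  using continuous_on_subset by (auto simp: Hs_iff)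

lemma tendsto_sqrt_hs2_iff: "((\<lambda>\<tau>. sqrt (hs2 s (X \<tau>))) \<longlongrightarrow> 0) F \<longleftrightarrow> ((\<lambda>\<tau>. hs2 s (X \<tau>)) \<longlongrightarrow> 0) F"
proof
  assume "((\<lambda>\<tau>. sqrt (hs2 s (X \<tau>))) \<longlongrightarrow> 0) F"
  then have "((\<lambda>\<tau>. (sqrt (hs2 s (X \<tau>)))\<^sup>2) \<longlongrightarrow> 0\<^sup>2) F" by (rule tendsto_power)
  then show "((\<lambda>\<tau>. hs2 s (X \<tau>)) \<longlongrightarrow> 0) F" by (simp add: hs2_nonneg)
next
  assume "((\<lambda>\<tau>. hs2 s (X \<tau>)) \<longlongrightarrow> 0) F"
  then have "((\<lambda>\<tau>. sqrt (hs2 s (X \<tau>))) \<longlongrightarrow> sqrt 0) F" by (rule tendsto_real_sqrt)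
  then show "((\<lambda>\<tau>. sqrt (hs2 s (X \<tau>))) \<longlongrightarrow> 0) F" by simp
qed

text \<open>For s >= 3 the sequence (1 + k^2) a_k is absolutely summable, so the Fourier series may
  be differentiated twice term by term. In particular the initial momentum is continuous.\<close>

lemma Hs_periodic_C2:
  assumes f: "f \<in> Hs s" and s: "s \<ge> 3"
  shows "periodic_C2 f (deriv f) (deriv (deriv f))"
proof -
  define a where "a = fcoeff f"
  have h: "hsum s a" using f by (simp add: Hs_iff a_def)
  note sm = abs_summable_of_hsum(1)[OF h s]
  have c1: "1 \<le> (2 * pi)\<^sup>2" and c2: "2 * pi \<le> (2 * pi)\<^sup>2"
  proof -
    show "1 \<le> (2 * pi)\<^sup>2" using pi_gt3 by (intro one_le_power) auto
    have "(2 * pi) * 1 \<le> (2 * pi) * (2 * pi)" using pi_gt3 by (intro mult_left_mono) auto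
    then show "2 * pi \<le> (2 * pi)\<^sup>2" by (simp add: power2_eq_square)
  qed
  have sum: "(\<lambda>k. norm (b k)) summable_on UNIV" if "\<And>k. norm (b k) \<le> (2 * pi)\<^sup>2 * ((1 + (of_int k)\<^sup>2) * norm (a k))" for b
    by (rule summable_on_comparison_test[OF summable_on_cmult_right[OF sm] that]) simp
  have s0: "(\<lambda>k. norm (a k)) summable_on UNIV"
  proof (rule sum)
    fix k
    have "1 * (1 * norm (a k)) \<le> (2 * pi)\<^sup>2 * ((1 + (of_int k)\<^sup>2) * norm (a k))"
      by (intro mult_mono c1) auto
    then show "norm (a k) \<le> (2 * pi)\<^sup>2 * ((1 + (of_int k)\<^sup>2) * norm (a k))" by simp
  qed
  have s1: "(\<lambda>k. norm (dsym k * a k)) summable_on UNIV"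
  proof (rule sum)
    fix k
    have "(2 * pi) * (\<bar>of_int k\<bar> * norm (a k)) \<le> (2 * pi)\<^sup>2 * ((1 + (of_int k)\<^sup>2) * norm (a k))"
      by (intro mult_mono c2 abs_int_le_sq) auto
    then show "norm (dsym k * a k) \<le> (2 * pi)\<^sup>2 * ((1 + (of_int k)\<^sup>2) * norm (a k))"
      by (simp add: norm_mult norm_dsym)
  qed
  have s2: "(\<lambda>k. norm (dsym k * (dsym k * a k))) summable_on UNIV"
  proof (rule sum)
    fix k
    have "norm (dsym k * (dsym k * a k)) = (2 * pi)\<^sup>2 * ((of_int k)\<^sup>2 * norm (a k))"
      by (simp add: norm_mult norm_dsym power2_eq_square)
    also have "\<dots> \<le> (2 * pi)\<^sup>2 * ((1 + (of_int k)\<^sup>2) * norm (a k))"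
      by (intro mult_left_mono mult_right_mono) auto
    finally show "norm (dsym k * (dsym k * a k)) \<le> (2 * pi)\<^sup>2 * ((1 + (of_int k)\<^sup>2) * norm (a k))" .
  qed
  have ae: "a = cfc (\<lambda>x. of_real (f x))" by (auto simp: a_def fcoeff_eq_cfc)
  have inv: "(\<lambda>x. complex_of_real (f x)) = fsum a"
    unfolding ae by (rule fourier_inversion) (use f s0 in \<open>auto simp: Hs_iff per1_def ae intro!: continuous_intros\<close>)
  have d1: "(f has_real_derivative Re (fsum (\<lambda>k. dsym k * a k) x)) (at x)" for x
  proof -
    have "((\<lambda>x. Re (fsum a x)) has_real_derivative Re (fsum (\<lambda>k. dsym k * a k) x)) (at x)"
      using fsum_has_vderiv[OF s0 s1, of x] unfolding has_vector_derivative_complex_iff by blast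
    then show ?thesis unfolding inv[symmetric] by simp
  qed
  have d2: "((\<lambda>x. Re (fsum (\<lambda>k. dsym k * a k) x)) has_real_derivative Re (fsum (\<lambda>k. dsym k * (dsym k * a k)) x)) (at x)" for x
    using fsum_has_vderiv[OF s1 s2, of x] unfolding has_vector_derivative_complex_iff by blast
  have "periodic_C2 f (\<lambda>x. Re (fsum (\<lambda>k. dsym k * a k) x)) (\<lambda>x. Re (fsum (\<lambda>k. dsym k * (dsym k * a k)) x))"
    unfolding periodic_C2_def using f d1 d2 by (auto simp: Hs_iff intro!: continuous_intros continuous_on_fsum s2)
  then show ?thesis using periodic_C2D(9,10) by metis
qed

lemma Hs_diff:
  assumes "f \<in> Hs s" "g \<in> Hs s"
  shows "(\<lambda>x. f x - g x) \<in> Hs s" "fcoeff (\<lambda>x. f x - g x) = (\<lambda>k. fcoeff f k - fcoeff g k)"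
proof -
  show e: "fcoeff (\<lambda>x. f x - g x) = (\<lambda>k. fcoeff f k - fcoeff g k)"
    using fcoeff_diff Hs_continuous[OF assms(1)] Hs_continuous[OF assms(2)] by blast
  show "(\<lambda>x. f x - g x) \<in> Hs s"
    using assms unfolding Hs_iff e by (auto intro!: continuous_intros hsum_diff(1) simp: per1_def)
qed

lemma Hs_mono: "s' \<le> s \<Longrightarrow> f \<in> Hs s \<Longrightarrow> f \<in> Hs s'"
  using hsum_mono(1) by (auto simp: Hs_iff)

lemma Hs_cmult:
  assumes "f \<in> Hs s"
  shows "(\<lambda>x. c * f x) \<in> Hs s"
proof -
  have "fcoeff (\<lambda>x. c * f x) = (\<lambda>k. of_real c * fcoeff f k)" by (auto simp: fcoeff_cmult)
  then show ?thesis
    using assms unfolding Hs_iff by (auto intro!: continuous_intros hsum_cmult(1) simp: per1_def)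
qed

lemma Hs_fcoeff_inject:
  assumes "f \<in> Hs s" "g \<in> Hs s'" "fcoeff f = fcoeff g"
  shows "f = g"
  using assms fcoeff_inject[of f g] by (auto simp: Hs_iff)

lemma locally_bounded_on_interval:
  fixes f :: "real \<Rightarrow> real"
  assumes "\<And>t. \<exists>d>0. \<exists>M. \<forall>\<tau>. \<bar>\<tau> - t\<bar> < d \<longrightarrow> f \<tau> \<le> M" "a \<le> b"
  shows "\<exists>M. \<forall>t. a \<le> t \<and> t \<le> b \<longrightarrow> f t \<le> M"
  using assms(2)
proof (induction rule: Bolzano)
  case (trans a b c)
  then obtain M1 M2 where "\<forall>t. a \<le> t \<and> t \<le> b \<longrightarrow> f t \<le> M1" "\<forall>t. b \<le> t \<and> t \<le> c \<longrightarrow> f t \<le> M2" by blast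
  then have "\<forall>t. a \<le> t \<and> t \<le> c \<longrightarrow> f t \<le> max M1 M2"
    by (metis le_max_iff_disj linear)
  then show ?case by blast
next
  case (local x)
  obtain d M where d: "d > 0" "\<forall>\<tau>. \<bar>\<tau> - x\<bar> < d \<longrightarrow> f \<tau> \<le> M" using assms(1) by blast
  have "f t \<le> M" if "a \<le> x \<and> x \<le> b \<and> b - a < d" "a \<le> t \<and> t \<le> b" for a b t
    using that d(2) by auto
  then show ?case using d(1) by blast
qed

subsection \<open>The Fourier coefficients of a solution\<close>

text \<open>Each Fourier coefficient is bounded by the H^(s-1) norm, so convergence of the
  difference quotients in that norm makes every coefficient differentiable. This brings arbitrary
  solutions within reach of \<open>muDP_uniqueness\<close>.\<close>

lemma solution_coefficients:
  assumes s: "s > 3" and sol: "muDP_global_solution s u0 u"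
  shows "muDP_seq (gam (mu u0)) (\<lambda>t. fcoeff (u t))"
proof -
  obtain ut where u: "u 0 = u0" "\<And>t. u t \<in> Hs s"
    "\<And>t. ((\<lambda>\<tau>. hs_norm s (\<lambda>x. u \<tau> x - u t x)) \<longlongrightarrow> 0) (at t)"
    and ut: "\<And>t. ut t \<in> Hs (s - 1)"
    "\<And>t. ((\<lambda>h. hs_norm (s - 1) (\<lambda>x. (u (t + h) x - u t x) / h - ut t x)) \<longlongrightarrow> 0) (at 0)"
    and eq: "\<And>t x. ut t x + u t x * deriv (u t) x + 3 * mu (u t) * deriv (Lam_inv (u t)) x = 0"
    using sol unfolding muDP_global_solution_def by blast
  define a where "a t = fcoeff (u t)" for t
  have C2: "periodic_C2 (u t) (deriv (u t)) (deriv (deriv (u t)))" for t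
    by (rule Hs_periodic_C2[OF u(2)]) (use s in simp)
  have ha: "hsum s (a t)" for t using u(2) by (simp add: Hs_iff a_def)
  have rhs: "fcoeff (ut t) k = muDP_rhs (gam (mu (u t))) (a t) k" for t k
  proof -
    have "ut t x = - (u t x * deriv (u t) x) - 3 * mu (u t) * deriv (Lam_inv (u t)) x" for x
      using eq[of t x] by linarith
    then have "ut t = (\<lambda>x. - (u t x * deriv (u t) x) - 3 * mu (u t) * deriv (Lam_inv (u t)) x)" by auto
    then show ?thesis using fcoeff_muDP_velocity[OF C2[of t]] by (simp add: a_def)
  qed
  have der: "((\<lambda>t. a t k) has_vector_derivative fcoeff (ut t) k) (at t)" for t k
  proof -
    let ?D = "\<lambda>h x. (u (t + h) x - u t x) / h - ut t x"
    have DH: "?D h \<in> Hs (s - 1)" for h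
    proof (rule Hs_diff(1)[OF _ ut(1)])
      have "(\<lambda>x. inverse h * (u (t + h) x - u t x)) \<in> Hs (s - 1)"
        by (intro Hs_cmult Hs_diff(1) Hs_mono[OF _ u(2)]) auto
      then show "(\<lambda>x. (u (t + h) x - u t x) / h) \<in> Hs (s - 1)"
        by (simp add: divide_inverse mult.commute)
    qed
    have Dk: "fcoeff (?D h) k = (a (t + h) k - a t k) / of_real h - fcoeff (ut t) k" for h
    proof -
      have c: "continuous_on {0..1} (u t)" "continuous_on {0..1} (ut t)" for t
        using Hs_continuous[OF u(2)] Hs_continuous[OF ut(1)] by blast+
      have "fcoeff (?D h) k = fcoeff (\<lambda>x. inverse h * (u (t + h) x - u t x)) k - fcoeff (ut t) k"
        by (subst fcoeff_diff[symmetric]) (auto intro!: continuous_intros c simp: divide_inverse mult.commute)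
      also have "fcoeff (\<lambda>x. inverse h * (u (t + h) x - u t x)) k = (a (t + h) k - a t k) / of_real h"
        unfolding fcoeff_cmult by (subst fcoeff_diff) (auto intro!: c simp: a_def divide_inverse mult.commute)
      finally show ?thesis .
    qed
    have "((\<lambda>h. (a (t + h) k - a t k) / of_real h - fcoeff (ut t) k) \<longlongrightarrow> 0) (at 0)"
    proof (rule Lim_null_comparison)
      have "norm (fcoeff (?D h) k) \<le> hs_norm (s - 1) (?D h)" for h
        unfolding hs_norm_eq
        by (rule real_le_rsqrt, rule hs2_coeff_bound) (use DH[of h] s in \<open>auto simp: Hs_iff\<close>)
      then show "\<forall>\<^sub>F h in at 0. norm ((a (t + h) k - a t k) / of_real h - fcoeff (ut t) k) \<le> hs_norm (s - 1) (?D h)"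
        unfolding Dk by (intro always_eventually) blast
    qed (rule ut(2))
    then have lim: "((\<lambda>h. norm ((a (t + h) k - a t k) / of_real h - fcoeff (ut t) k)) \<longlongrightarrow> 0) (at 0)"
      by (rule tendsto_norm_zero)
    have e: "norm ((a (t + h) k - a t k) / of_real h - fcoeff (ut t) k) =
        norm (a (t + h) k - a t k - h *\<^sub>R fcoeff (ut t) k) / norm h" if "h \<noteq> 0" for h
    proof -
      have "(a (t + h) k - a t k) / of_real h - fcoeff (ut t) k = (a (t + h) k - a t k - h *\<^sub>R fcoeff (ut t) k) / of_real h"
        using that by (simp add: scaleR_conv_of_real field_simps)
      then show ?thesis by (simp add: norm_divide)
    qed
    have "\<forall>\<^sub>F h in at 0. norm ((a (t + h) k - a t k) / of_real h - fcoeff (ut t) k) =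
        norm (a (t + h) k - a t k - h *\<^sub>R fcoeff (ut t) k) / norm h"
      unfolding eventually_at_filter using e by (auto intro!: always_eventually)
    then have "((\<lambda>h. norm (a (t + h) k - a t k - h *\<^sub>R fcoeff (ut t) k) / norm h) \<longlongrightarrow> 0) (at 0)"
      by (rule Lim_transform_eventually[OF lim])
    then show ?thesis
      unfolding has_vector_derivative_def has_derivative_at by (auto intro: bounded_linear_scaleR_left)
  qed
  \<comment> \<open>Both the transport symbol and \<open>gam\<close> vanish at frequency 0, so the
    mean is conserved. Hence \<open>gam (mu (u t))\<close> does not depend on time, as
    \<open>muDP_seq\<close> demands.\<close>
  have mean: "mu (u t) = mu u0" for t
  proof -
    have "((\<lambda>t. a t 0) has_vector_derivative 0) (at t)" for t
      using der[of 0 t] unfolding rhs by (simp add: muDP_rhs_def gam_def)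
    from vderiv_zero_imp_const[OF this, of t 0] have "a t 0 = a 0 0" .
    moreover have "a t 0 = of_real (mu (u t))" for t
      unfolding a_def by (rule fcoeff_0[OF Hs_continuous[OF u(2)]])
    ultimately show ?thesis by (simp add: u(1))
  qed
  \<comment> \<open>Continuity in H^s bounds the norm near each time, and compactness of the time
    interval gives a common bound, which \<open>seq_bound_of_hsum\<close> converts.\<close>
  have bd: "\<exists>M. \<forall>t. \<bar>t\<bar> < T \<longrightarrow> seq_bound M (a t)" for T
  proof (cases "T > 0")
    case True
    have "\<exists>d>0. \<exists>M. \<forall>\<tau>. \<bar>\<tau> - t\<bar> < d \<longrightarrow> hs2 s (a \<tau>) \<le> M" for t
    proof -
      have "((\<lambda>\<tau>. hs2 s (\<lambda>k. a \<tau> k - a t k)) \<longlongrightarrow> 0) (at t)"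
        using u(3)[of t] unfolding hs_norm_eq tendsto_sqrt_hs2_iff Hs_diff(2)[OF u(2) u(2)] a_def .
      then have "\<forall>\<^sub>F \<tau> in at t. dist (hs2 s (\<lambda>k. a \<tau> k - a t k)) 0 < 1" by (rule tendstoD) simp
      then obtain d where d: "d > 0" "\<And>\<tau>. \<tau> \<noteq> t \<Longrightarrow> dist \<tau> t < d \<Longrightarrow> hs2 s (\<lambda>k. a \<tau> k - a t k) < 1"
        unfolding eventually_at by (auto simp: hs2_nonneg)
      have "hs2 s (a \<tau>) \<le> 2 + 2 * hs2 s (a t)" if "\<bar>\<tau> - t\<bar> < d" for \<tau>
      proof (cases "\<tau> = t")
        case True
        then show ?thesis using hs2_nonneg[of s "a t"] by simp
      next
        case False
        have "hs2 s (\<lambda>k. (a \<tau> k - a t k) + a t k) \<le> 2 * hs2 s (\<lambda>k. a \<tau> k - a t k) + 2 * hs2 s (a t)"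
          by (intro hsum_add hsum_diff ha)
        then show ?thesis using d(2)[OF False] that by (simp add: dist_real_def)
      qed
      then show ?thesis using d(1) by blast
    qed
    from locally_bounded_on_interval[OF this, of "- T" T] True
    obtain M where M: "\<And>t. - T \<le> t \<Longrightarrow> t \<le> T \<Longrightarrow> hs2 s (a t) \<le> M" by auto
    let ?S = "\<Sum>\<^sub>\<infinity>k::int. 1 / (1 + (real_of_int k)\<^sup>2)"
    have "seq_bound (?S + M) (a t)" if "\<bar>t\<bar> < T" for t
    proof -
      have "seq_bound (?S + hs2 s (a t)) (a t)" by (rule seq_bound_of_hsum[OF ha]) (use s in simp)
      moreover have "hs2 s (a t) \<le> M" using that by (intro M) auto
      ultimately show ?thesis unfolding seq_bound_def by (smt (verit))
    qed
    then show ?thesis by blast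
  next
    case False
    then have "\<not> \<bar>t\<bar> < T" for t by linarith
    then show ?thesis by blast
  qed
  show ?thesis
    unfolding muDP_seq_def a_def[symmetric]
  proof (intro conjI allI)
    show "a t (- k) = cnj (a t k)" for t k
      unfolding a_def by (rule fcoeff_cnj[OF Hs_continuous[OF u(2)]])
    show "((\<lambda>t. a t k) has_vector_derivative muDP_rhs (gam (mu u0)) (a t) k) (at t)" for t k
      using der[of k t] unfolding rhs mean .
  qed (rule bd)
qed

subsection \<open>Construction of the solution\<close>

text \<open>The Lagrangian flow provides the evolution of the momentum; dividing its nonzero Fourier
  modes by the squared symbol yields the equation for the coefficients of the velocity.\<close>

lemma flow_solution_coefficients:
  assumes u0: "periodic_C2 u0 u0' u0''" and m: "mu u0 \<noteq> 0"
    and sgn: "(\<forall>x. mu u0 - u0'' x \<ge> 0) \<or> (\<forall>x. mu u0 - u0'' x \<le> 0)"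
  obtains u u' u'' where "u 0 = u0" "\<And>t. periodic_C2 (u t) (u' t) (u'' t)" "\<And>t. mu (u t) = mu u0"
    "muDP_seq (gam (mu u0)) (\<lambda>t. fcoeff (u t))"
proof -
  define m where "m = mu u0"
  \<comment> \<open>The initial momentum divided by its mean. The mean has the sign of the momentum,
    so \<open>h\<close> is nonnegative under either alternative.\<close>
  define h where "h x = (m - u0'' x) / m" for x
  note c0 = periodic_C2D[OF u0]
  have m0: "m \<noteq> 0" using assms(2) by (simp add: m_def)
  have int0: "integral {0..1} (\<lambda>x. m - u0'' x) = m"
  proof -
    have "fcoeff u0'' 0 = 0" using periodic_C2_fcoeff_derivs(2)[OF u0, of 0] by simp
    then have "integral {0..1} u0'' = 0" using fcoeff_0[OF c0(8)] by (simp add: mu_def)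
    then show ?thesis by (subst integral_diff) (auto intro!: integrable_continuous_real c0)
  qed
  have hm: "h x \<ge> 0" for x
    using sgn
  proof
    assume p: "\<forall>x. mu u0 - u0'' x \<ge> 0"
    have "0 \<le> integral {0..1} (\<lambda>x. m - u0'' x)"
      by (rule integral_nonneg) (use p in \<open>auto intro!: integrable_continuous_real continuous_intros c0 simp: m_def\<close>)
    then have "0 \<le> m" unfolding int0 .
    then show ?thesis using p by (simp add: h_def m_def)
  next
    assume p: "\<forall>x. mu u0 - u0'' x \<le> 0"
    have "integral {0..1} (\<lambda>x. m - u0'' x) \<le> integral {0..1} (\<lambda>x::real. 0)"
      by (rule integral_le) (use p in \<open>auto intro!: integrable_continuous_real continuous_intros c0 simp: m_def\<close>)
    then have "m \<le> 0" unfolding int0 by simp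
    then show ?thesis using p by (simp add: h_def m_def divide_nonpos_nonpos)
  qed
  interpret lagrange h m
  proof
    show "continuous_on UNIV h" unfolding h_def by (intro continuous_intros c0) (use m0 in auto)
    show "h (x + 1) = h x" for x using c0(3) by (simp add: h_def per1_def)
    show "integral {0..1} h = 1" unfolding h_def using int0 m0 by simp
  qed (use hm m0 in auto)
  obtain rr where "rr 0 = 0" "\<And>t. (rr has_vector_derivative F (rr t)) (at t)"
    using lagrange_flow_exists by blast
  then interpret lagrange_flow h m rr
    by unfold_locales
  define z where "z t y = m - q t y" for t y
  have C2: "periodic_C2 (u t) (v t) (z t)" for t
    unfolding periodic_C2_def z_def using u_deriv v_deriv u_per
    by (auto simp: per1_def intro!: continuous_intros q_cont)
  have mu: "mu (u t) = m" for t using u_mean by (simp add: mu_def)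
  have init: "u 0 = u0"
  proof (rule periodic_C2_eqI[of "u 0" "v 0" u0'' u0 u0'])
    have "z 0 = u0''" using m0 by (auto simp: z_def q_0 h_def)
    then show "periodic_C2 (u 0) (v 0) u0''" using C2[of 0] by simp
  qed (use u0 mu m_def in auto)
  define a where "a t = fcoeff (u t)" for t
  note c = periodic_C2D[OF C2] and d = periodic_C2_fcoeff_derivs[OF C2]
  have der: "((\<lambda>t. a t k) has_vector_derivative muDP_rhs (gam m) (a t) k) (at t)" for t k
  proof (cases "k = 0")
    case True
    have "a t 0 = of_real m" for t unfolding a_def using fcoeff_0[OF c(6)] mu by simp
    then show ?thesis using True by (simp add: muDP_rhs_def gam_def)
  next
    case False
    have q_eq: "q t y = m - z t y" for t y by (simp add: z_def)
    \<comment> \<open>Since q = m - u_xx, the nonzero modes of \<open>q\<close> are -dsym^2 times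
      those of \<open>u\<close>, and differentiability in time carries over.\<close>
    have aq: "a t k = - (cfc (\<lambda>y. of_real (q t y)) k / (dsym k * dsym k))" for t
    proof -
      have "fcoeff (\<lambda>y. m - q t y) k = - fcoeff (q t) k"
        using fcoeff_diff[of "\<lambda>x. m" "q t" k] q_cont False by (simp add: fcoeff_const)
      then have "dsym k * (dsym k * a t k) = - fcoeff (q t) k" using d(2)[of t k] by (simp add: a_def z_def[abs_def])
      then show ?thesis using False by (simp add: fcoeff_eq_cfc field_simps)
    qed
    have "((\<lambda>t. - (1 / (dsym k * dsym k)) * cfc (\<lambda>y. of_real (q t y)) k) has_vector_derivative
       - (1 / (dsym k * dsym k)) * (cfc (\<lambda>y. of_real (- 2 * (v t y * q t y))) k - dsym k * cfc (\<lambda>y. of_real (u t y * q t y)) k)) (at t)"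
      by (rule has_vector_derivative_mult_right[OF q_coeff_deriv])
    then have "((\<lambda>t. a t k) has_vector_derivative
       - (1 / (dsym k * dsym k)) * (fcoeff (\<lambda>y. - 2 * (v t y * q t y)) k - dsym k * fcoeff (\<lambda>y. u t y * q t y) k)) (at t)"
      unfolding aq by (simp add: fcoeff_eq_cfc)
    moreover have "- (1 / (dsym k * dsym k)) * (fcoeff (\<lambda>y. - 2 * (v t y * q t y)) k - dsym k * fcoeff (\<lambda>y. u t y * q t y) k) = muDP_rhs (gam m) (a t) k"
    proof -
      let ?d = "dsym k"
      \<comment> \<open>With z = u_xx, the products become derivatives: 2 v z = (v^2)_x and u z = (u
        v)_x - v^2. The v^2 contributions of \<open>1\<close> and \<open>2\<close> cancel, and the
        linear terms 2 m and m add up to the coefficient 3 m of the equation.\<close>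
      have vz: "fcoeff (\<lambda>y. 2 * (v t y * z t y)) k = ?d * fcoeff (\<lambda>y. v t y * v t y) k"
      proof (rule fcoeff_derivative[of "\<lambda>y. v t y * v t y"])
        show "((\<lambda>y. v t y * v t y) has_real_derivative 2 * (v t y * z t y)) (at y)" for y
          using DERIV_mult[OF c(5)[of t y] c(5)[of t y]] by (simp add: mult.commute)
      qed (use c in \<open>auto intro!: continuous_intros simp: per1_def\<close>)
      have uv: "fcoeff (\<lambda>y. v t y * v t y + u t y * z t y) k = ?d * fcoeff (\<lambda>y. u t y * v t y) k"
      proof (rule fcoeff_derivative[of "\<lambda>y. u t y * v t y"])
        show "((\<lambda>y. u t y * v t y) has_real_derivative v t y * v t y + u t y * z t y) (at y)" for y
          using DERIV_mult[OF c(4)[of t y] c(5)[of t y]] by (simp add: mult.commute)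
      qed (use c in \<open>auto intro!: continuous_intros simp: per1_def\<close>)
      have "fcoeff (\<lambda>y. v t y * v t y + u t y * z t y) k = fcoeff (\<lambda>y. v t y * v t y) k + fcoeff (\<lambda>y. u t y * z t y) k"
        by (rule fcoeff_add) (auto intro!: continuous_intros c)
      then have uz: "fcoeff (\<lambda>y. u t y * z t y) k = ?d * fcoeff (\<lambda>y. u t y * v t y) k - fcoeff (\<lambda>y. v t y * v t y) k"
        using uv by (simp add: algebra_simps)
      have 1: "fcoeff (\<lambda>y. - 2 * (v t y * q t y)) k = ?d * fcoeff (\<lambda>y. v t y * v t y) k - 2 * of_real m * (?d * a t k)"
      proof -
        have "fcoeff (\<lambda>y. - 2 * (v t y * q t y)) k = fcoeff (\<lambda>y. 2 * (v t y * z t y) - (2 * m) * v t y) k"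
          by (simp add: q_eq algebra_simps)
        also have "\<dots> = fcoeff (\<lambda>y. 2 * (v t y * z t y)) k - fcoeff (\<lambda>y. (2 * m) * v t y) k"
          by (rule fcoeff_diff) (auto intro!: continuous_intros c)
        finally show ?thesis using vz unfolding fcoeff_cmult d(1) by (simp add: a_def)
      qed
      have 2: "fcoeff (\<lambda>y. u t y * q t y) k = of_real m * a t k - (?d * fcoeff (\<lambda>y. u t y * v t y) k - fcoeff (\<lambda>y. v t y * v t y) k)"
      proof -
        have "fcoeff (\<lambda>y. u t y * q t y) k = fcoeff (\<lambda>y. m * u t y - u t y * z t y) k"
          by (simp add: q_eq algebra_simps)
        also have "\<dots> = fcoeff (\<lambda>y. m * u t y) k - fcoeff (\<lambda>y. u t y * z t y) k"
          by (rule fcoeff_diff) (auto intro!: continuous_intros c)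
        finally show ?thesis unfolding uz fcoeff_cmult by (simp add: a_def)
      qed
      have "- (1 / (?d * ?d)) * (fcoeff (\<lambda>y. - 2 * (v t y * q t y)) k - ?d * fcoeff (\<lambda>y. u t y * q t y) k)
         = 3 * of_real m * a t k / ?d - fcoeff (\<lambda>y. u t y * v t y) k"
        unfolding 1 2 using False by (simp add: field_simps)
      also have "3 * of_real m * a t k / ?d = - \<i> * of_real (gam m k) * a t k"
        using False by (simp add: gam_def dsym_def field_simps)
      also have "fcoeff (\<lambda>y. u t y * v t y) k = ?d / 2 * conv (a t) (a t) k"
        unfolding a_def by (rule fcoeff_transport[OF C2])
      finally show ?thesis by (simp add: muDP_rhs_def)
    qed
    ultimately show ?thesis by simp
  qed
  have bd: "\<exists>M. \<forall>t. \<bar>t\<bar> < T \<longrightarrow> seq_bound M (a t)" for T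
  proof -
    obtain K where K: "\<And>t y. \<bar>t\<bar> < T \<Longrightarrow> \<bar>q t y\<bar> \<le> K" using q_bound by blast
    have "seq_bound ((\<bar>m\<bar> + K) + \<bar>m\<bar> + (\<bar>m\<bar> + K)\<^sup>2 + 2 * (\<Sum>\<^sub>\<infinity>k::int. 1 / (1 + (real_of_int k)\<^sup>2))) (a t)" if "\<bar>t\<bar> < T" for t
      unfolding a_def
    proof (rule periodic_C2_seq_bound[OF C2])
      show "\<bar>z t x\<bar> \<le> \<bar>m\<bar> + K" for x using K[OF that, of x] by (simp add: z_def)
    qed (simp add: mu)
    then show ?thesis by blast
  qed
  have seq: "muDP_seq (gam m) a"
    unfolding muDP_seq_def using der bd by (auto simp: a_def fcoeff_cnj[OF c(6)])
  show ?thesis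
    by (rule that[of u v z]) (use init C2 mu seq in \<open>auto simp: a_def[abs_def] m_def\<close>)
qed

lemma seq_solution_is_global_solution:
  assumes s: "s > 3" and u0: "u0 \<in> Hs s" and init: "u 0 = u0"
    and C2: "\<And>t. periodic_C2 (u t) (u' t) (u'' t)" and mu: "\<And>t. mu (u t) = mu u0"
    and seq: "muDP_seq (gam (mu u0)) (\<lambda>t. fcoeff (u t))"
  shows "muDP_global_solution s u0 u"
proof -
  define m where "m = mu u0"
  define a where "a t = fcoeff (u t)" for t
  define ut where "ut t x = - (u t x * u' t x) - 3 * m * deriv (Lam_inv (u t)) x" for t x
  note c = periodic_C2D[OF C2]
  have seqa: "muDP_seq (gam m) a" using seq by (simp add: a_def[abs_def] m_def)
  have h0: "hsum s (a 0)" using u0 init by (simp add: a_def Hs_iff)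
  have s0: "s \<ge> 0" "s \<ge> 1" using s by auto
  have ha: "hsum s (a t)" for t by (rule muDP_persistence(1)[OF seqa s0(1) h0])
  have uH: "u t \<in> Hs s" for t using ha c by (auto simp: Hs_iff a_def)
  have der: "((\<lambda>t. a t k) has_vector_derivative muDP_rhs (gam m) (a t) k) (at t)" for t k
    using seqa by (simp add: muDP_seq_def)
  have cont: "((\<lambda>\<tau>. hs2 s (\<lambda>k. a \<tau> k - a t k)) \<longlongrightarrow> 0) (at t)" for t
  proof (rule hs2_tendsto_zeroI[OF ha ha])
    show "((\<lambda>\<tau>. a \<tau> k) \<longlongrightarrow> a t k) (at t)" for k
      using has_vector_derivative_continuous[OF der] by (simp add: isCont_def)
    fix e :: real assume e: "e > 0"
    define T where "T = \<bar>t\<bar> + 1"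
    obtain C where C: "\<And>t t'. \<bar>t\<bar> < T \<Longrightarrow> \<bar>t'\<bar> < T \<Longrightarrow> hs2 s (a t') \<le> exp (C * \<bar>t' - t\<bar>) * hs2 s (a t)"
      using muDP_persistence(2)[OF seqa s0(1) h0, of T] by blast
    have "((\<lambda>\<tau>. exp (C * \<bar>\<tau> - t\<bar>) * hs2 s (a t)) \<longlongrightarrow> exp (C * \<bar>t - t\<bar>) * hs2 s (a t)) (at t)"
      by (intro tendsto_intros)
    then have "\<forall>\<^sub>F \<tau> in at t. exp (C * \<bar>\<tau> - t\<bar>) * hs2 s (a t) < hs2 s (a t) + e"
      by (rule order_tendstoD) (use e in simp)
    moreover have "\<forall>\<^sub>F \<tau> in at t. \<bar>\<tau>\<bar> < T"
      unfolding eventually_at by (rule exI[of _ 1]) (auto simp: T_def dist_real_def)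
    ultimately show "\<forall>\<^sub>F \<tau> in at t. hs2 s (a \<tau>) \<le> hs2 s (a t) + e"
    proof eventually_elim
      case (elim \<tau>)
      then show ?case using C[of t \<tau>] by (simp add: T_def)
    qed
  qed
  have utc: "continuous_on S (ut t)" for S t
    unfolding ut_def by (intro continuous_intros c periodic_C2D(7)[OF Lam_inv_props(1)[OF c(6) c(1)]])
  have utp: "per1 (ut t)" for t
    using c(1,2)[of t] periodic_C2D(2)[OF Lam_inv_props(1)[OF c(6) c(1), of t]] by (simp add: per1_def ut_def)
  have utk: "fcoeff (ut t) = muDP_rhs (gam m) (a t)" for t
    unfolding ut_def a_def by (rule ext, rule fcoeff_muDP_velocity[OF C2])
  have hr: "hsum (s - 1) (muDP_rhs (gam m) (a t))" for t
    unfolding muDP_rhs_eq_bil by (rule hsum_bil(1)[OF ha ha s0(2) abs_gam_le])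
  have utH: "ut t \<in> Hs (s - 1)" for t using utc utp hr by (simp add: Hs_iff utk)
  have as: "(\<lambda>k. norm (a t k)) summable_on UNIV" for t
    using seq_boundD(6)[OF seq_bound_of_hsum[OF ha]] s by simp
  have cont': "((\<lambda>\<tau>. hs2 (s - 1) (\<lambda>k. muDP_rhs (gam m) (a \<tau>) k - muDP_rhs (gam m) (a t) k)) \<longlongrightarrow> 0) (at t)" for t
  proof (rule tendsto_sandwich[OF _ _ tendsto_const])
    let ?z = "\<lambda>\<tau>. hs2 s (\<lambda>k. a \<tau> k - a t k)"
    let ?b = "\<lambda>\<tau>. (alg_const s * (2 * ?z \<tau> + 2 * hs2 s (\<lambda>k. 2 * a t k)) + 2 * \<bar>m\<bar>\<^sup>2) * ?z \<tau>"
    show "\<forall>\<^sub>F \<tau> in at t. 0 \<le> hs2 (s - 1) (\<lambda>k. muDP_rhs (gam m) (a \<tau>) k - muDP_rhs (gam m) (a t) k)"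
      by (simp add: hs2_nonneg)
    have "hs2 (s - 1) (\<lambda>k. muDP_rhs (gam m) (a \<tau>) k - muDP_rhs (gam m) (a t) k) \<le> ?b \<tau>" for \<tau>
    proof -
      have "(\<lambda>k. muDP_rhs (gam m) (a \<tau>) k - muDP_rhs (gam m) (a t) k) = bil (gam m) (\<lambda>k. a \<tau> k + a t k) (\<lambda>k. a \<tau> k - a t k)"
        unfolding muDP_rhs_eq_bil by (rule ext, rule bil_diff[OF as as])
      then have "hs2 (s - 1) (\<lambda>k. muDP_rhs (gam m) (a \<tau>) k - muDP_rhs (gam m) (a t) k) \<le>
          (alg_const s * hs2 s (\<lambda>k. a \<tau> k + a t k) + 2 * \<bar>m\<bar>\<^sup>2) * ?z \<tau>"
        using hsum_bil(2)[OF hsum_add(1)[OF ha ha] hsum_diff(1)[OF ha ha] s0(2) abs_gam_le] by simp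
      also have "\<dots> \<le> ?b \<tau>"
      proof (intro mult_right_mono add_right_mono mult_left_mono)
        \<comment> \<open>Writing the sum as the difference plus twice the value at \<open>t\<close>
          leaves \<open>?z \<tau>\<close> as the only quantity that depends on
          \<open>\<tau>\<close>.\<close>
        have "hs2 s (\<lambda>k. (a \<tau> k - a t k) + 2 * a t k) \<le> 2 * ?z \<tau> + 2 * hs2 s (\<lambda>k. 2 * a t k)"
          by (intro hsum_add hsum_diff hsum_cmult ha)
        moreover have "(\<lambda>k. (a \<tau> k - a t k) + 2 * a t k) = (\<lambda>k. a \<tau> k + a t k)" by auto
        ultimately show "hs2 s (\<lambda>k. a \<tau> k + a t k) \<le> 2 * ?z \<tau> + 2 * hs2 s (\<lambda>k. 2 * a t k)" by simp
      qed (simp_all add: alg_const_nonneg hs2_nonneg)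
      finally show ?thesis .
    qed
    then show "\<forall>\<^sub>F \<tau> in at t. hs2 (s - 1) (\<lambda>k. muDP_rhs (gam m) (a \<tau>) k - muDP_rhs (gam m) (a t) k) \<le> ?b \<tau>"
      by (simp add: always_eventually)
    have "(?b \<longlongrightarrow> (alg_const s * (2 * 0 + 2 * hs2 s (\<lambda>k. 2 * a t k)) + 2 * \<bar>m\<bar>\<^sup>2) * 0) (at t)"
      by (intro tendsto_intros cont)
    then show "(?b \<longlongrightarrow> 0) (at t)" by simp
  qed
  have dq: "((\<lambda>h. hs2 (s - 1) (\<lambda>k. (a (t + h) k - a t k) / of_real h - muDP_rhs (gam m) (a t) k)) \<longlongrightarrow> 0) (at 0)" for t
    by (rule hs2_difference_quotient[OF der hr cont'])
  have dqk: "fcoeff (\<lambda>x. (u (t + h) x - u t x) / h - ut t x) = (\<lambda>k. (a (t + h) k - a t k) / of_real h - muDP_rhs (gam m) (a t) k)" for t h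
  proof
    fix k
    have "fcoeff (\<lambda>x. (u (t + h) x - u t x) / h - ut t x) k = fcoeff (\<lambda>x. inverse h * (u (t + h) x - u t x)) k - fcoeff (ut t) k"
      by (subst fcoeff_diff[symmetric]) (auto intro!: continuous_intros c utc simp: divide_inverse mult.commute)
    also have "fcoeff (\<lambda>x. inverse h * (u (t + h) x - u t x)) k = (a (t + h) k - a t k) / of_real h"
      unfolding fcoeff_cmult by (subst fcoeff_diff) (auto intro!: c simp: a_def divide_inverse mult.commute)
    finally show "fcoeff (\<lambda>x. (u (t + h) x - u t x) / h - ut t x) k = (a (t + h) k - a t k) / of_real h - muDP_rhs (gam m) (a t) k"
      by (simp add: utk)
  qed
  show ?thesis
    unfolding muDP_global_solution_def
  proof (intro conjI allI exI[of _ ut])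
    show "((\<lambda>\<tau>. hs_norm s (\<lambda>x. u \<tau> x - u t x)) \<longlongrightarrow> 0) (at t)" for t
      unfolding hs_norm_eq tendsto_sqrt_hs2_iff Hs_diff(2)[OF uH uH] using cont[of t] by (simp add: a_def)
    show "((\<lambda>\<tau>. hs_norm (s - 1) (\<lambda>x. ut \<tau> x - ut t x)) \<longlongrightarrow> 0) (at t)" for t
      unfolding hs_norm_eq tendsto_sqrt_hs2_iff Hs_diff(2)[OF utH utH] utk by (rule cont')
    show "((\<lambda>h. hs_norm (s - 1) (\<lambda>x. (u (t + h) x - u t x) / h - ut t x)) \<longlongrightarrow> 0) (at 0)" for t
      unfolding hs_norm_eq tendsto_sqrt_hs2_iff dqk by (rule dq)
    show "ut t x + u t x * deriv (u t) x + 3 * mu (u t) * deriv (Lam_inv (u t)) x = 0" for t x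
      by (simp add: ut_def c(9) mu m_def)
  qed (use init uH utH in auto)
qed

theorem theorem5p4:
  fixes s :: real and u0 :: "real \<Rightarrow> real"
  assumes "s > 3"
    and "u0 \<in> Hs s"
    and "mu u0 \<noteq> 0"
    and "(\<forall>x. Lam2 u0 x \<ge> 0) \<or> (\<forall>x. Lam2 u0 x \<le> 0)"
  shows "\<exists>!u. muDP_global_solution s u0 u"
proof (rule ex_ex1I)
  have "periodic_C2 u0 (deriv u0) (deriv (deriv u0))"
    by (rule Hs_periodic_C2[OF assms(2)]) (use assms(1) in simp)
  then obtain u u' u'' where "u 0 = u0" "\<And>t. periodic_C2 (u t) (u' t) (u'' t)" "\<And>t. mu (u t) = mu u0"
    "muDP_seq (gam (mu u0)) (\<lambda>t. fcoeff (u t))"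
    using flow_solution_coefficients assms(3,4) unfolding Lam2_def by blast
  then show "\<exists>u. muDP_global_solution s u0 u"
    using seq_solution_is_global_solution[OF assms(1,2)] by blast
next
  fix u v assume u: "muDP_global_solution s u0 u" and v: "muDP_global_solution s u0 v"
  have H: "u t \<in> Hs s" "v t \<in> Hs s" "u 0 = u0" "v 0 = u0" for t
    using u v by (auto simp: muDP_global_solution_def)
  have "fcoeff (u t) = fcoeff (v t)" for t
    using muDP_uniqueness[OF solution_coefficients[OF assms(1) u] solution_coefficients[OF assms(1) v], of t] H(3,4) by simp
  then have "u t = v t" for t using Hs_fcoeff_inject[OF H(1) H(2)] by blast
  then show "u = v" by auto
qed

end
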